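(* Let the incidence matrix $A$ of $\Sigma$ be irreducible (for all $i,j\in I$ there is $\omega\in\Sigma^*$ with $i\omega j\in\Sigma^*$) and let $\varphi,\psi:\Sigma\to\mathbb{R}$ be Hölder continuous with $\psi>0$. Then for every $a\in I$ $$\mathcal{P}_\psi(\varphi,\Sigma_a^{\mathrm{per}})=\sup\left\{\frac{h_\nu(\sigma)}{\int\psi\,d\nu}+\frac{\int\varphi\,d\nu}{\int\psi\,d\nu}:\ \nu\in\mathcal{M}_\sigma^1\text{ with }\varphi,\psi\in L^1(\nu)\right\}=\sup\left\{\frac{h_\nu(\sigma)}{\int\psi\,d\nu}+\frac{\int\varphi\,d\nu}{\int\psi\,d\nu}:\ \nu\in\mathcal{E}_{\sigma,c}^1\right\},$$ where $\mathcal{M}_\sigma^1$ denotes the set of $\sigma$-invariant Borel probability measures on $\Sigma$ and $\mathcal{E}_{\sigma,c}^1\subset\mathcal{M}_\sigma^1$ the subset of ergodic measures with compact support.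
   Context: Markov shift: $I\subset\mathbb{N}$ is an alphabet (finite or infinite), $A\in\{0,1\}^{I\times I}$ an incidence matrix, $\Sigma=\{\omega\in I^{\mathbb{N}}: A_{\omega_i\omega_{i+1}}=1\ \forall i\in\mathbb N\}$, $\sigma$ the left shift. $\Sigma^*$ is the set of all finite non-empty words over $I$ whose consecutive letters $ij$ satisfy $A_{ij}=1$; $|\omega|$ is the length of $\omega\in\Sigma^*$; $[\omega]=\{\tau\in\Sigma:\tau\text{ begins with }\omega\}$. $\Sigma$ is topologized by the metrics $d_\alpha(\omega,\omega')=e^{-\alpha|\omega\wedge\omega'|}$, $\alpha>0$, where $\omega\wedge\omega'$ is the longest common initial block. Hölder continuity: $f:\Sigma\to\mathbb{R}$ is Hölder continuous if there are $\alpha>0$ and $V\ge0$ with $|f(\omega)-f(\omega')|\le V d_\alpha(\omega,\omega')$ for all $\omega,\omega'\in\Sigma$ with $|\omega\wedge\omega'|\ge1$. Induced pressure ($\mathcal{C}\subset\Sigma^*$): $$\mathcal{P}_\psi(\varphi,\mathcal{C})=\limsup_{T\to\infty}\frac1T\log\sum_{\omega\in\mathcal{C},\ T-\eta<S_\omega\psi\le T}\exp S_\omega\varphi\in[-\infty,\infty],\qquad S_\omega f=\sup_{\tau\in[\omega]}\sum_{k=0}^{|\omega|-1}f(\sigma^k\tau),$$ where $\eta>0$ is any fixed number (the value does not depend on $\eta$), and $\log 0=-\infty$. $\Sigma_a^{\mathrm{per}}=\{\omega\in\Sigma^*:\omega_1=a,\ \overline\omega\in\Sigma\}$ with $\overline\omega=\omega\omega\omega\cdots$.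 $h_\nu(\sigma)$ is the measure-theoretic entropy of $\sigma$ with respect to $\nu$. *)

theory Defs
  imports "HOL-Analysis.Analysis"
begin

section \<open>Markov shifts\<close>

text \<open>
  Sequences are functions on nat and start at index 0; finite words are lists.
\<close>

definition shift_space :: "nat set \<Rightarrow> (nat \<Rightarrow> nat \<Rightarrow> nat) \<Rightarrow> (nat \<Rightarrow> nat) set" where
  "shift_space I A = {\<omega>. \<forall>n. \<omega> n \<in> I \<and> A (\<omega> n) (\<omega> (Suc n)) = 1}"

definition shift :: "(nat \<Rightarrow> nat) \<Rightarrow> (nat \<Rightarrow> nat)" where
  "shift \<omega> = (\<lambda>n. \<omega> (Suc n))"

definition words :: "nat set \<Rightarrow> (nat \<Rightarrow> nat \<Rightarrow> nat) \<Rightarrow> nat list set" where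
  "words I A = {w. w \<noteq> [] \<and> set w \<subseteq> I \<and> (\<forall>k. Suc k < length w \<longrightarrow> A (w ! k) (w ! Suc k) = 1)}"

definition irreducible_matrix :: "nat set \<Rightarrow> (nat \<Rightarrow> nat \<Rightarrow> nat) \<Rightarrow> bool" where
  "irreducible_matrix I A \<longleftrightarrow> (\<forall>i\<in>I. \<forall>j\<in>I. \<exists>w\<in>words I A. i # w @ [j] \<in> words I A)"

definition cylinder :: "nat set \<Rightarrow> (nat \<Rightarrow> nat \<Rightarrow> nat) \<Rightarrow> nat list \<Rightarrow> (nat \<Rightarrow> nat) set" where
  "cylinder I A w = {\<tau> \<in> shift_space I A. \<forall>k<length w. \<tau> k = w ! k}"

definition periodic_words :: "nat set \<Rightarrow> (nat \<Rightarrow> nat \<Rightarrow> nat) \<Rightarrow> nat \<Rightarrow> nat list set" where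
  "periodic_words I A a =
     {w \<in> words I A. hd w = a \<and> (\<lambda>n. w ! (n mod length w)) \<in> shift_space I A}"


subsection \<open>Metrics, topology and Hoelder continuity\<close>

definition meet_length :: "(nat \<Rightarrow> nat) \<Rightarrow> (nat \<Rightarrow> nat) \<Rightarrow> enat" where
  "meet_length \<omega> \<omega>' = Sup {enat n | n. \<forall>k<n. \<omega> k = \<omega>' k}"

definition shift_dist :: "real \<Rightarrow> (nat \<Rightarrow> nat) \<Rightarrow> (nat \<Rightarrow> nat) \<Rightarrow> real" where
  "shift_dist \<alpha> \<omega> \<omega>' =
     (case meet_length \<omega> \<omega>' of enat n \<Rightarrow> exp (- \<alpha> * real n) | \<infinity> \<Rightarrow> 0)"

definition hoelder_continuous ::
  "nat set \<Rightarrow> (nat \<Rightarrow> nat \<Rightarrow> nat) \<Rightarrow> ((nat \<Rightarrow> nat) \<Rightarrow> real) \<Rightarrow> bool" where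
  "hoelder_continuous I A f \<longleftrightarrow>
     (\<exists>\<alpha>>0. \<exists>V\<ge>0. \<forall>\<omega>\<in>shift_space I A. \<forall>\<omega>'\<in>shift_space I A.
        meet_length \<omega> \<omega>' \<ge> 1 \<longrightarrow> \<bar>f \<omega> - f \<omega>'\<bar> \<le> V * shift_dist \<alpha> \<omega> \<omega>')"

text \<open>
  All the metrics induce the same topology (lemma \<open>mtopology_shift_dist\<close> below), so
  the exponent 1 in the next definition is immaterial.
\<close>

definition shift_topology :: "nat set \<Rightarrow> (nat \<Rightarrow> nat \<Rightarrow> nat) \<Rightarrow> (nat \<Rightarrow> nat) topology" where
  "shift_topology I A = Metric_space.mtopology (shift_space I A) (shift_dist 1)"

lemma le_meet_length_iff: "enat n \<le> meet_length x y \<longleftrightarrow> (\<forall>k<n. x k = y k)"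
proof
  assume L: "enat n \<le> meet_length x y"
  show "\<forall>k<n. x k = y k"
  proof (rule ccontr)
    assume "\<not> (\<forall>k<n. x k = y k)"
    then obtain k where k: "k < n" "x k \<noteq> y k" by blast
    have "meet_length x y \<le> enat k"
      unfolding meet_length_def
    proof (rule Sup_least)
      fix e assume "e \<in> {enat n |n. \<forall>k<n. x k = y k}"
      then obtain m where m: "e = enat m" "\<forall>j<m. x j = y j" by blast
      then have "m \<le> k" using k(2) not_le by blast
      with m(1) show "e \<le> enat k" by simp
    qed
    with L have "enat n \<le> enat k" by (rule order_trans)
    with k show False by simp
  qed
next
  assume "\<forall>k<n. x k = y k"
  then show "enat n \<le> meet_length x y"
    unfolding meet_length_def by (intro Sup_upper CollectI exI[of _ n] conjI refl)
qed

lemma meet_length_ge_1_iff: "meet_length x y \<ge> 1 \<longleftrightarrow> x 0 = y 0"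
  using le_meet_length_iff[of 1 x y] by (simp add: one_enat_def)

lemma meet_length_eq_infinity_iff: "meet_length x y = \<infinity> \<longleftrightarrow> x = y"
proof
  assume E: "meet_length x y = \<infinity>"
  have "x k = y k" for k
    using le_meet_length_iff[of "Suc k" x y] E by simp
  then show "x = y" by auto
next
  assume "x = y"
  then have "enat n \<le> meet_length x y" for n by (simp add: le_meet_length_iff)
  then show "meet_length x y = \<infinity>"
    by (metis Suc_ile_eq enat.exhaust less_irrefl)
qed

lemma meet_length_commute: "meet_length x y = meet_length y x"
  unfolding meet_length_def by (simp add: eq_commute)

lemma shift_dist_nonneg: "0 \<le> shift_dist \<alpha> x y"
  by (simp add: shift_dist_def split: enat.split)

lemma shift_dist_le_iff:
  assumes "\<alpha> > 0"
  shows "shift_dist \<alpha> x y \<le> exp (- \<alpha> * real n) \<longleftrightarrow> (\<forall>k<n. x k = y k)"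
  using assms unfolding le_meet_length_iff[symmetric] shift_dist_def
  by (auto split: enat.split)

lemma Metric_space_shift_dist:
  assumes "\<alpha> > 0"
  shows "Metric_space (shift_space I A) (shift_dist \<alpha>)"
proof
  fix x y z :: "nat \<Rightarrow> nat"
  show "0 \<le> shift_dist \<alpha> x y" by (rule shift_dist_nonneg)
  show "shift_dist \<alpha> x y = shift_dist \<alpha> y x"
    by (simp add: shift_dist_def meet_length_commute)
  show "shift_dist \<alpha> x y = 0 \<longleftrightarrow> x = y"
    unfolding meet_length_eq_infinity_iff[symmetric] shift_dist_def
    by (auto split: enat.split)
  show "shift_dist \<alpha> x z \<le> shift_dist \<alpha> x y + shift_dist \<alpha> y z"
  proof (cases "meet_length x y = \<infinity> \<or> meet_length y z = \<infinity>")
    case True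
    then have "x = y \<or> y = z" by (simp add: meet_length_eq_infinity_iff)
    then show ?thesis
      using shift_dist_nonneg[of \<alpha>] by auto
  next
    case False
    then obtain m n where mn: "meet_length x y = enat m" "meet_length y z = enat n" by auto
    have d: "shift_dist \<alpha> x y = exp (- \<alpha> * real m)" "shift_dist \<alpha> y z = exp (- \<alpha> * real n)"
      using mn by (simp_all add: shift_dist_def)
    have "\<forall>k<m. x k = y k" "\<forall>k<n. y k = z k"
      using mn le_meet_length_iff[of m x y] le_meet_length_iff[of n y z] by simp_all
    then have "\<forall>k<min m n. x k = z k" by simp
    then have "shift_dist \<alpha> x z \<le> exp (- \<alpha> * real (min m n))"
      using shift_dist_le_iff[OF assms] by blast
    also have "\<dots> \<le> exp (- \<alpha> * real m) + exp (- \<alpha> * real n)"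
      by (cases "m \<le> n") (simp_all add: min_def)
    finally show ?thesis using d by simp
  qed
qed

lemma openin_mtopology_shift_dist_iff:
  assumes "\<alpha> > 0"
  shows "openin (Metric_space.mtopology (shift_space I A) (shift_dist \<alpha>)) U \<longleftrightarrow>
    U \<subseteq> shift_space I A \<and> (\<forall>x\<in>U. \<exists>n. {y \<in> shift_space I A. \<forall>k<n. y k = x k} \<subseteq> U)"
proof -
  interpret Metric_space "shift_space I A" "shift_dist \<alpha>"
    by (rule Metric_space_shift_dist[OF assms])
  have "(\<exists>r>0. mball x r \<subseteq> U) \<longleftrightarrow> (\<exists>n. {y \<in> shift_space I A. \<forall>k<n. y k = x k} \<subseteq> U)"
    if x: "x \<in> shift_space I A" for x
  proof
    assume "\<exists>r>0. mball x r \<subseteq> U"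
    then obtain r where r: "r > 0" "mball x r \<subseteq> U" by blast
    have "(\<lambda>n. exp (- \<alpha>) ^ n) \<longlonglongrightarrow> 0"
      using assms by (intro LIMSEQ_realpow_zero) auto
    then have "\<forall>\<^sub>F n in sequentially. exp (- \<alpha>) ^ n < r"
      using r(1) by (rule order_tendstoD)
    then obtain n where "exp (- \<alpha>) ^ n < r"
      by (auto simp: eventually_sequentially)
    then have n: "exp (- \<alpha> * real n) < r"
      by (metis exp_of_nat_mult mult.commute)
    have "{y \<in> shift_space I A. \<forall>k<n. y k = x k} \<subseteq> mball x r"
    proof
      fix y assume y: "y \<in> {y \<in> shift_space I A. \<forall>k<n. y k = x k}"
      then have "shift_dist \<alpha> x y \<le> exp (- \<alpha> * real n)"
        using shift_dist_le_iff[OF assms, of x y n] by simp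
      with n x y show "y \<in> mball x r" by simp
    qed
    with r(2) show "\<exists>n. {y \<in> shift_space I A. \<forall>k<n. y k = x k} \<subseteq> U" by blast
  next
    assume "\<exists>n. {y \<in> shift_space I A. \<forall>k<n. y k = x k} \<subseteq> U"
    then obtain n where n: "{y \<in> shift_space I A. \<forall>k<n. y k = x k} \<subseteq> U" by blast
    have "mball x (exp (- \<alpha> * real n)) \<subseteq> {y \<in> shift_space I A. \<forall>k<n. y k = x k}"
    proof
      fix y assume "y \<in> mball x (exp (- \<alpha> * real n))"
      then have "y \<in> shift_space I A" "shift_dist \<alpha> x y \<le> exp (- \<alpha> * real n)" by auto
      then show "y \<in> {y \<in> shift_space I A. \<forall>k<n. y k = x k}"
        using shift_dist_le_iff[OF assms, of x y n] by simp
    qed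
    with n show "\<exists>r>0. mball x r \<subseteq> U"
      by (intro exI[of _ "exp (- \<alpha> * real n)"]) auto
  qed
  then show ?thesis
    unfolding openin_mtopology by blast
qed

lemma openin_top_of_set_shift_space_iff:
  "openin (top_of_set (shift_space I A)) U \<longleftrightarrow>
    U \<subseteq> shift_space I A \<and> (\<forall>x\<in>U. \<exists>n. {y \<in> shift_space I A. \<forall>k<n. y k = x k} \<subseteq> U)"
  (is "?L \<longleftrightarrow> ?R")
proof
  assume ?L
  then obtain V where V: "open V" "U = shift_space I A \<inter> V"
    by (auto simp: openin_open)
  have "\<exists>n. {y \<in> shift_space I A. \<forall>k<n. y k = x k} \<subseteq> U" if x: "x \<in> U" for x
  proof -
    have "openin (product_topology (\<lambda>i. euclidean) UNIV) V"
      using V(1) by (simp add: open_fun_def)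
    moreover have "x \<in> V" using x V(2) by simp
    ultimately obtain X where X: "x \<in> (\<Pi>\<^sub>E i\<in>UNIV. X i)"
        "finite {i. X i \<noteq> topspace (euclidean :: nat topology)}" "(\<Pi>\<^sub>E i\<in>UNIV. X i) \<subseteq> V"
      using product_topology_open_contains_basis[of "\<lambda>i. euclidean :: nat topology" UNIV V x] by blast
    obtain n where n: "\<forall>i\<in>{i. X i \<noteq> UNIV}. i < n"
      using X(2) finite_nat_set_iff_bounded by auto
    have "{y \<in> shift_space I A. \<forall>k<n. y k = x k} \<subseteq> U"
    proof
      fix y assume y: "y \<in> {y \<in> shift_space I A. \<forall>k<n. y k = x k}"
      have "y i \<in> X i" for i
        using y n X(1) by (cases "i < n") (auto simp: PiE_iff)
      then have "y \<in> V" using X(3) by (auto simp: PiE_iff)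
      with y V(2) show "y \<in> U" by simp
    qed
    then show ?thesis by blast
  qed
  with V show ?R by blast
next
  assume R: ?R
  show ?L
  proof (subst openin_subopen, intro ballI)
    fix x assume x: "x \<in> U"
    then obtain n where n: "{y \<in> shift_space I A. \<forall>k<n. y k = x k} \<subseteq> U" using R by blast
    have "open (\<Inter>k\<in>{..<n}. (\<lambda>y :: nat \<Rightarrow> nat. y k) -` {x k})"
      by (intro open_INT ballI open_vimage open_discrete continuous_on_product_coordinates) simp
    moreover have "(\<Inter>k\<in>{..<n}. (\<lambda>y :: nat \<Rightarrow> nat. y k) -` {x k}) = {y. \<forall>k\<in>{..<n}. y k = x k}"
      by auto
    ultimately have "open {y :: nat \<Rightarrow> nat. \<forall>k\<in>{..<n}. y k = x k}" by simp
    then have "openin (top_of_set (shift_space I A)) (shift_space I A \<inter> {y. \<forall>k\<in>{..<n}. y k = x k})"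
      by (auto simp: openin_open)
    moreover have "shift_space I A \<inter> {y. \<forall>k\<in>{..<n}. y k = x k}
        = {y \<in> shift_space I A. \<forall>k<n. y k = x k}" by auto
    ultimately show "\<exists>T. openin (top_of_set (shift_space I A)) T \<and> x \<in> T \<and> T \<subseteq> U"
      using n x R by (intro exI[of _ "{y \<in> shift_space I A. \<forall>k<n. y k = x k}"]) auto
  qed
qed

lemma mtopology_shift_dist:
  assumes "\<alpha> > 0"
  shows "Metric_space.mtopology (shift_space I A) (shift_dist \<alpha>) = top_of_set (shift_space I A)"
  unfolding topology_eq
  by (simp add: openin_mtopology_shift_dist_iff[OF assms] openin_top_of_set_shift_space_iff)

lemma shift_topology_eq: "shift_topology I A = top_of_set (shift_space I A)"
  by (simp add: shift_topology_def mtopology_shift_dist)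


section \<open>Induced pressure\<close>

definition exp_ereal :: "ereal \<Rightarrow> ennreal" where
  "exp_ereal x = (case x of ereal r \<Rightarrow> ennreal (exp r) | PInfty \<Rightarrow> \<infinity> | MInfty \<Rightarrow> 0)"

definition ln_ennreal :: "ennreal \<Rightarrow> ereal" where
  "ln_ennreal x = (if x = 0 then -\<infinity> else if x = \<infinity> then \<infinity> else ereal (ln (enn2real x)))"

definition birkhoff_sup ::
  "nat set \<Rightarrow> (nat \<Rightarrow> nat \<Rightarrow> nat) \<Rightarrow> ((nat \<Rightarrow> nat) \<Rightarrow> real) \<Rightarrow> nat list \<Rightarrow> ereal" where
  "birkhoff_sup I A f w = (SUP \<tau>\<in>cylinder I A w. ereal (\<Sum>k<length w. f ((shift ^^ k) \<tau>)))"

text \<open>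
  The parameter \<open>\<eta>\<close> is the width of the window; the value is the same for all \<open>\<eta> > 0\<close>.
\<close>

definition induced_pressure ::
  "nat set \<Rightarrow> (nat \<Rightarrow> nat \<Rightarrow> nat) \<Rightarrow> real \<Rightarrow> ((nat \<Rightarrow> nat) \<Rightarrow> real) \<Rightarrow> ((nat \<Rightarrow> nat) \<Rightarrow> real) \<Rightarrow>
    nat list set \<Rightarrow> ereal" where
  "induced_pressure I A \<eta> \<psi> \<phi> C =
     Limsup at_top (\<lambda>T :: real.
       ln_ennreal (\<Sum>\<^sub>\<infinity> w \<in> {w \<in> C. ereal (T - \<eta>) < birkhoff_sup I A \<psi> w \<and>
                                       birkhoff_sup I A \<psi> w \<le> ereal T}.
                     exp_ereal (birkhoff_sup I A \<phi> w)) / ereal T)"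


section \<open>Invariant measures and entropy\<close>

definition borel_sets_of :: "'a topology \<Rightarrow> 'a set set" where
  "borel_sets_of X = sigma_sets (topspace X) {U. openin X U}"

definition invariant_measures ::
  "nat set \<Rightarrow> (nat \<Rightarrow> nat \<Rightarrow> nat) \<Rightarrow> (nat \<Rightarrow> nat) measure set" where
  "invariant_measures I A =
     {\<nu>. space \<nu> = shift_space I A \<and> sets \<nu> = borel_sets_of (shift_topology I A) \<and>
         emeasure \<nu> (space \<nu>) = 1 \<and>
         (\<forall>B\<in>sets \<nu>. emeasure \<nu> (shift -` B \<inter> space \<nu>) = emeasure \<nu> B)}"

definition ergodic :: "'a measure \<Rightarrow> ('a \<Rightarrow> 'a) \<Rightarrow> bool" where
  "ergodic \<nu> T \<longleftrightarrow>
     (\<forall>B\<in>sets \<nu>. T -` B \<inter> space \<nu> = B \<longrightarrow> emeasure \<nu> B = 0 \<or> emeasure \<nu> (space \<nu> - B) = 0)"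

definition measure_support :: "'a topology \<Rightarrow> 'a measure \<Rightarrow> 'a set" where
  "measure_support X \<nu> = {x \<in> topspace X. \<forall>U. openin X U \<and> x \<in> U \<longrightarrow> emeasure \<nu> U > 0}"

definition ergodic_compact_measures ::
  "nat set \<Rightarrow> (nat \<Rightarrow> nat \<Rightarrow> nat) \<Rightarrow> (nat \<Rightarrow> nat) measure set" where
  "ergodic_compact_measures I A =
     {\<nu> \<in> invariant_measures I A. ergodic \<nu> shift \<and>
        compactin (shift_topology I A) (measure_support (shift_topology I A) \<nu>)}"

text \<open>Partitions are finite; terms with \<open>\<nu>(B) = 0\<close> vanish in the entropy.\<close>

definition partition_entropy :: "'a measure \<Rightarrow> 'a set set \<Rightarrow> real" where
  "partition_entropy \<nu> P = - (\<Sum>B\<in>P. measure \<nu> B * ln (measure \<nu> B))"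

definition iterated_partition :: "'a measure \<Rightarrow> ('a \<Rightarrow> 'a) \<Rightarrow> 'a set set \<Rightarrow> nat \<Rightarrow> 'a set set" where
  "iterated_partition \<nu> T P n =
     common_refinement ((\<lambda>k. (\<lambda>B. (T ^^ k) -` B \<inter> space \<nu>) ` P) ` {..<n})"

text \<open>
  For invariant measures the sequence below converges by subadditivity, so its upper limit
  is the limit in the usual definition of the entropy of \<open>T\<close> with respect to a partition.
\<close>

definition entropy_wrt_partition :: "'a measure \<Rightarrow> ('a \<Rightarrow> 'a) \<Rightarrow> 'a set set \<Rightarrow> ereal" where
  "entropy_wrt_partition \<nu> T P =
     limsup (\<lambda>n. ereal (partition_entropy \<nu> (iterated_partition \<nu> T P n) / real n))"

definition measure_entropy :: "'a measure \<Rightarrow> ('a \<Rightarrow> 'a) \<Rightarrow> ereal" where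
  "measure_entropy \<nu> T =
     (SUP P\<in>{P. finite P \<and> partition_on (space \<nu>) P \<and> P \<subseteq> sets \<nu>}. entropy_wrt_partition \<nu> T P)"

end

theory Submission
  imports Defs "HOL-Probability.Independent_Family"
begin

text \<open>
  Put \<open>W b w = exp (S\<^sub>w \<phi> - b S\<^sub>w \<psi>)\<close> for a word \<open>w\<close>; bounded distortion makes \<open>W b\<close>
  multiplicative up to a constant.

  If \<open>b\<close> exceeds the pressure, then the sum of \<open>W b\<close> over all words joining two given letters is
  finite. For an invariant measure, Gibbs' inequality against these weights, applied after lumping
  together the letters \<open>\<ge> N\<close>, bounds the entropy of every partition that is approximated by
  finitely many lumped coordinates; this gives \<open>h \<le> - \<integral>(\<phi> - b \<psi>)\<close> as \<open>N\<close> grows.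

  Conversely, let \<open>b\<close> bound the ratios of all compactly supported ergodic measures. The Bernoulli
  measures on free concatenations of periodic words of a common length show that \<open>W b\<close> has a
  uniformly bounded sum over the periodic words of each length. As in the Kraft-McMillan inequality
  the bound extends to every uniquely decodable set, in particular to the lists of \<open>k\<close> first-return
  loops at \<open>a\<close>, uniformly in \<open>k\<close>. Because \<open>\<psi> > 0\<close>, a compactness argument gives exponential decay in
  \<open>k\<close> for some large exponent, and interpolation gives it for every \<open>b' > b\<close>. Hence \<open>W b'\<close> is
  summable over the periodic words, and the pressure is at most \<open>b'\<close>.
\<close>

text \<open>Two obstacles shape the proof. First, the alphabet may be infinite, so the partition
  into letters may have infinite entropy; the finite partitions in the definition of entropy are
  therefore treated directly, and finiteness is restored by truncating letters. Second, \<psi> is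
  positive only pointwise: its infimum may be 0, so Birkhoff sums of \<psi> need not grow linearly
  with the length of a word, and raising the exponent does not by itself produce decay in the
  length. The number of first-return loops takes over the role of the length. The interpolation then
  needs a bound at \<open>b\<close> that is uniform in the number of loops, which is why the
  decodability argument has to keep one constant for all \<open>k\<close>. The exponent may be
  negative, so errors carry a factor of its absolute value. The three quantities are bounded by each
  other in a cycle: all integrable invariant measures, pressure, compactly supported ergodic
  measures, and back by inclusion.\<close>

lemma geometric_sum_le:
  fixes r :: real
  assumes "0 \<le> r" "r < 1"
  shows "(\<Sum>k<n. r ^ k) \<le> 1 / (1 - r)"
  using assms suminf_geometric[of r] sum_le_suminf[of "\<lambda>k. r ^ k" "{..<n}"]
  by (simp add: summable_geometric)

section \<open>Words and points of the shift space\<close>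

lemma funpow_shift: "(shift ^^ k) x = (\<lambda>n. x (n + k))"
proof (induction k)
  case (Suc k)
  then show ?case by (simp add: shift_def fun_eq_iff)
qed simp

lemma shift_shift_space: "x \<in> shift_space I A \<Longrightarrow> shift x \<in> shift_space I A"
  by (simp add: shift_space_def shift_def)

lemma funpow_shift_shift_space: "x \<in> shift_space I A \<Longrightarrow> (shift ^^ k) x \<in> shift_space I A"
  by (simp add: shift_space_def funpow_shift)

lemma words_altdef:
  "w \<in> words I A \<longleftrightarrow> w \<noteq> [] \<and> set w \<subseteq> I \<and> successively (\<lambda>i j. A i j = 1) w"
  by (auto simp: words_def successively_conv_nth)

lemma words_append_iff:
  assumes "u \<noteq> []" "v \<noteq> []"
  shows "u @ v \<in> words I A \<longleftrightarrow> u \<in> words I A \<and> v \<in> words I A \<and> A (last u) (hd v) = 1"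
  using assms by (auto simp: words_altdef successively_append_iff)

definition cat_seq :: "'a list \<Rightarrow> (nat \<Rightarrow> 'a) \<Rightarrow> nat \<Rightarrow> 'a" where
  "cat_seq w x = (\<lambda>n. if n < length w then w ! n else x (n - length w))"

lemma cat_seq_shift_space:
  assumes w: "w \<in> words I A" and x: "x \<in> shift_space I A" and j: "A (last w) (x 0) = 1"
  shows "cat_seq w x \<in> shift_space I A"
  unfolding shift_space_def
proof (intro CollectI allI conjI)
  fix n
  show "cat_seq w x n \<in> I"
    using w x by (auto simp: cat_seq_def words_def shift_space_def)
  consider "Suc n < length w" | "Suc n = length w" | "n \<ge> length w" by linarith
  then show "A (cat_seq w x n) (cat_seq w x (Suc n)) = 1"
  proof cases
    case 1
    then show ?thesis using w by (auto simp: cat_seq_def words_def)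
  next
    case 2
    then have "n = length w - 1" by linarith
    then have "w ! n = last w" using w by (auto simp: last_conv_nth words_def)
    then show ?thesis using 2 j by (auto simp: cat_seq_def)
  next
    case 3
    then show ?thesis using x by (auto simp: cat_seq_def shift_space_def Suc_diff_le)
  qed
qed

lemma cylinder_shift_space: "x \<in> cylinder I A w \<Longrightarrow> x \<in> shift_space I A"
  by (simp add: cylinder_def)

lemma cylinder_append:
  "x \<in> cylinder I A (u @ v) \<longleftrightarrow> x \<in> cylinder I A u \<and> (shift ^^ length u) x \<in> cylinder I A v"
proof -
  have "(\<forall>k<length (u @ v). x k = (u @ v) ! k) \<longleftrightarrow>
    (\<forall>k<length u. x k = u ! k) \<and> (\<forall>k<length v. x (k + length u) = v ! k)"
  proof (intro iffI conjI allI impI; (elim conjE)?)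
    fix k assume *: "\<forall>k<length (u @ v). x k = (u @ v) ! k" "k < length u"
    then show "x k = u ! k" using *(1)[rule_format, of k] by (simp add: nth_append)
  next
    fix k assume *: "\<forall>k<length (u @ v). x k = (u @ v) ! k" "k < length v"
    then show "x (k + length u) = v ! k" using *(1)[rule_format, of "k + length u"] by (simp add: nth_append)
  next
    fix k assume *: "\<forall>k<length u. x k = u ! k" "\<forall>k<length v. x (k + length u) = v ! k"
      "k < length (u @ v)"
    show "x k = (u @ v) ! k"
    proof (cases "k < length u")
      case False
      then show ?thesis using *(2)[rule_format, of "k - length u"] *(3) by (auto simp: nth_append)
    qed (use * in \<open>auto simp: nth_append\<close>)
  qed
  then show ?thesis
    by (auto simp: cylinder_def funpow_shift_shift_space) (simp_all add: funpow_shift)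
qed

lemma prefix_in_words:
  assumes "x \<in> shift_space I A" "n > 0"
  shows "map x [i..<i + n] \<in> words I A"
  using assms by (auto simp: words_def shift_space_def)

lemma in_cylinder_prefix: "x \<in> shift_space I A \<Longrightarrow> x \<in> cylinder I A (map x [0..<n])"
  by (auto simp: cylinder_def)

text \<open>All transitions of the periodic sequence already occur inside the word, except the one
  at the seam from its last letter back to its first.\<close>

lemma periodic_words_iff:
  "w \<in> periodic_words I A a \<longleftrightarrow> w \<in> words I A \<and> hd w = a \<and> A (last w) a = 1"
proof (cases "w \<in> words I A \<and> hd w = a")
  case True
  then have ne: "w \<noteq> []" and I: "set w \<subseteq> I"
    and A: "\<And>k. Suc k < length w \<Longrightarrow> A (w ! k) (w ! Suc k) = 1" and a: "w ! 0 = a"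
    by (auto simp: words_def hd_conv_nth)
  let ?N = "length w"
  have mod: "Suc n mod ?N = (if Suc (n mod ?N) = ?N then 0 else Suc (n mod ?N))" for n
    by (simp add: mod_Suc)
  have "(\<lambda>n. w ! (n mod ?N)) \<in> shift_space I A \<longleftrightarrow> A (last w) a = 1"
  proof
    assume "(\<lambda>n. w ! (n mod ?N)) \<in> shift_space I A"
    then have "A (w ! ((?N - 1) mod ?N)) (w ! (Suc (?N - 1) mod ?N)) = 1"
      unfolding shift_space_def by blast
    then show "A (last w) a = 1" using ne a by (simp add: last_conv_nth)
  next
    assume L: "A (last w) a = 1"
    show "(\<lambda>n. w ! (n mod ?N)) \<in> shift_space I A"
      unfolding shift_space_def
    proof (intro CollectI allI conjI)
      fix n
      have lt: "n mod ?N < ?N" using ne by simp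
      then show "w ! (n mod ?N) \<in> I" using I nth_mem by blast
      show "A (w ! (n mod ?N)) (w ! (Suc n mod ?N)) = 1"
      proof (cases "Suc (n mod ?N) = ?N")
        case True
        then have "n mod ?N = ?N - 1" by linarith
        then have "w ! (n mod ?N) = last w" using ne by (simp add: last_conv_nth)
        then show ?thesis using L True a by (simp add: mod_Suc)
      next
        case False
        then show ?thesis using A lt mod by simp
      qed
    qed
  qed
  then show ?thesis using True by (simp add: periodic_words_def)
qed (auto simp: periodic_words_def)

section \<open>Birkhoff sums and bounded distortion\<close>

definition birkhoff_sum :: "((nat \<Rightarrow> nat) \<Rightarrow> real) \<Rightarrow> nat \<Rightarrow> (nat \<Rightarrow> nat) \<Rightarrow> real" where
  "birkhoff_sum f n x = (\<Sum>k<n. f ((shift ^^ k) x))"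

lemma birkhoff_sum_0 [simp]: "birkhoff_sum f 0 x = 0"
  by (simp add: birkhoff_sum_def)

lemma birkhoff_sum_add:
  "birkhoff_sum f (m + n) x = birkhoff_sum f m x + birkhoff_sum f n ((shift ^^ m) x)"
proof (induction n)
  case (Suc n)
  then show ?case by (simp add: birkhoff_sum_def) (simp add: funpow_shift add_ac)
qed (simp add: birkhoff_sum_def)

text \<open>The bound is uniform in the word, including its length. It lets the supremum over a
  cylinder be replaced by the value at any of its points at a fixed cost.\<close>

definition bounded_distortion ::
  "nat set \<Rightarrow> (nat \<Rightarrow> nat \<Rightarrow> nat) \<Rightarrow> ((nat \<Rightarrow> nat) \<Rightarrow> real) \<Rightarrow> real \<Rightarrow> bool" where
  "bounded_distortion I A f K \<longleftrightarrow> (\<forall>w. \<forall>x\<in>cylinder I A w. \<forall>y\<in>cylinder I A w.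
     \<bar>birkhoff_sum f (length w) x - birkhoff_sum f (length w) y\<bar> \<le> K)"

lemma bounded_distortionD:
  "bounded_distortion I A f K \<Longrightarrow> x \<in> cylinder I A w \<Longrightarrow> y \<in> cylinder I A w \<Longrightarrow>
     \<bar>birkhoff_sum f (length w) x - birkhoff_sum f (length w) y\<bar> \<le> K"
  unfolding bounded_distortion_def by blast

lemma bounded_distortion_mono: "bounded_distortion I A f K \<Longrightarrow> K \<le> L \<Longrightarrow> bounded_distortion I A f L"
  unfolding bounded_distortion_def by (meson order_trans)

lemma hoelder_continuousE:
  assumes "hoelder_continuous I A f"
  obtains \<alpha> V where "\<alpha> > 0" "V \<ge> 0"
    "\<And>x y n. x \<in> shift_space I A \<Longrightarrow> y \<in> shift_space I A \<Longrightarrow> n > 0 \<Longrightarrow> (\<And>k. k < n \<Longrightarrow> x k = y k) \<Longrightarrow>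
       \<bar>f x - f y\<bar> \<le> V * exp (- \<alpha> * real n)"
proof -
  obtain \<alpha> V where aV: "\<alpha> > 0" "V \<ge> 0" and
    H: "\<And>x y. x \<in> shift_space I A \<Longrightarrow> y \<in> shift_space I A \<Longrightarrow> meet_length x y \<ge> 1 \<Longrightarrow>
      \<bar>f x - f y\<bar> \<le> V * shift_dist \<alpha> x y"
    using assms unfolding hoelder_continuous_def by blast
  have "\<bar>f x - f y\<bar> \<le> V * exp (- \<alpha> * real n)"
    if "x \<in> shift_space I A" "y \<in> shift_space I A" "n > 0" "\<And>k. k < n \<Longrightarrow> x k = y k" for x y n
  proof -
    have "\<bar>f x - f y\<bar> \<le> V * shift_dist \<alpha> x y"
      using that by (intro H) (auto simp: meet_length_ge_1_iff)
    also have "\<dots> \<le> V * exp (- \<alpha> * real n)"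
      using that aV shift_dist_le_iff[of \<alpha> x y n] by (intro mult_left_mono) blast+
    finally show ?thesis .
  qed
  with aV that show thesis by blast
qed

text \<open>The \<open>k\<close>-th iterates of two points in a cylinder of length \<open>n\<close>
  still share \<open>n - k\<close> letters, so their values differ by a term of a geometric series
  whose sum does not depend on \<open>n\<close>.\<close>

lemma hoelder_bounded_distortion:
  assumes "hoelder_continuous I A f"
  shows "\<exists>K\<ge>0. bounded_distortion I A f K"
proof -
  obtain \<alpha> V where aV: "\<alpha> > 0" "V \<ge> 0" and
    H: "\<And>x y n. x \<in> shift_space I A \<Longrightarrow> y \<in> shift_space I A \<Longrightarrow> n > 0 \<Longrightarrow>
      (\<And>k. k < n \<Longrightarrow> x k = y k) \<Longrightarrow> \<bar>f x - f y\<bar> \<le> V * exp (- \<alpha> * real n)"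
    using hoelder_continuousE[OF assms] by metis
  define K where "K = V / (1 - exp (- \<alpha>))"
  have q: "0 \<le> exp (- \<alpha>)" "exp (- \<alpha>) < 1" using aV by auto
  have "\<bar>birkhoff_sum f (length w) x - birkhoff_sum f (length w) y\<bar> \<le> K"
    if xy: "x \<in> cylinder I A w" "y \<in> cylinder I A w" for w x y
  proof -
    let ?n = "length w"
    have "\<bar>birkhoff_sum f ?n x - birkhoff_sum f ?n y\<bar>
        \<le> (\<Sum>k<?n. \<bar>f ((shift ^^ k) x) - f ((shift ^^ k) y)\<bar>)"
      unfolding birkhoff_sum_def sum_subtractf[symmetric] by (rule sum_abs)
    also have "\<dots> \<le> (\<Sum>k<?n. V * exp (- \<alpha> * real (?n - k)))"
    proof (rule sum_mono)
      fix k assume "k \<in> {..<?n}"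
      then show "\<bar>f ((shift ^^ k) x) - f ((shift ^^ k) y)\<bar> \<le> V * exp (- \<alpha> * real (?n - k))"
        using xy by (intro H) (auto simp: cylinder_def funpow_shift_shift_space, simp add: funpow_shift)
    qed
    also have "\<dots> = (\<Sum>k<?n. V * exp (- \<alpha>) ^ Suc k)"
    proof -
      have "(\<Sum>k<?n. V * exp (- \<alpha> * real (?n - k))) = (\<Sum>k<?n. V * exp (- \<alpha>) ^ (?n - k))"
        by (intro sum.cong refl) (metis exp_of_nat_mult mult.commute)
      also have "\<dots> = (\<Sum>k<?n. V * exp (- \<alpha>) ^ Suc k)"
        by (rule sum.reindex_bij_witness[of _ "\<lambda>k. ?n - Suc k" "\<lambda>k. ?n - Suc k"])
          (auto simp: Suc_diff_Suc)
      finally show ?thesis .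
    qed
    also have "\<dots> \<le> (\<Sum>k<?n. V * exp (- \<alpha>) ^ k)"
      using aV q by (intro sum_mono mult_left_mono power_decreasing) auto
    also have "\<dots> = V * (\<Sum>k<?n. exp (- \<alpha>) ^ k)" by (simp add: sum_distrib_left)
    also have "(\<Sum>k<?n. exp (- \<alpha>) ^ k) \<le> 1 / (1 - exp (- \<alpha>))"
      using q by (rule geometric_sum_le)
    finally show ?thesis using aV by (simp add: K_def mult_left_mono)
  qed
  moreover have "K \<ge> 0" using aV by (simp add: K_def)
  ultimately show ?thesis unfolding bounded_distortion_def by blast
qed

lemma hoelder_continuous_near:
  assumes "hoelder_continuous I A f" "e > 0"
  obtains n where "n > 0" "\<And>x y. x \<in> shift_space I A \<Longrightarrow> y \<in> shift_space I A \<Longrightarrow>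
    (\<And>k. k < n \<Longrightarrow> x k = y k) \<Longrightarrow> \<bar>f x - f y\<bar> < e"
proof -
  obtain \<alpha> V where aV: "\<alpha> > 0" "V \<ge> 0" and
    H: "\<And>x y n. x \<in> shift_space I A \<Longrightarrow> y \<in> shift_space I A \<Longrightarrow> n > 0 \<Longrightarrow>
      (\<And>k. k < n \<Longrightarrow> x k = y k) \<Longrightarrow> \<bar>f x - f y\<bar> \<le> V * exp (- \<alpha> * real n)"
    using hoelder_continuousE[OF assms(1)] by metis
  have "(\<lambda>n. V * exp (- \<alpha>) ^ n) \<longlonglongrightarrow> V * 0"
    using aV by (intro tendsto_mult_left LIMSEQ_realpow_zero) auto
  then have "(\<lambda>n. V * exp (- \<alpha>) ^ n) \<longlonglongrightarrow> 0" by simp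
  from order_tendstoD(2)[OF this assms(2)]
  obtain m where "\<forall>n\<ge>m. V * exp (- \<alpha>) ^ n < e" by (auto simp: eventually_sequentially)
  then have m: "V * exp (- \<alpha> * real (Suc m)) < e"
    by (metis exp_of_nat_mult mult.commute le_SucI order_refl)
  show thesis
  proof (rule that[of "Suc m"])
    fix x y assume "x \<in> shift_space I A" "y \<in> shift_space I A" "\<And>k. k < Suc m \<Longrightarrow> x k = y k"
    then have "\<bar>f x - f y\<bar> \<le> V * exp (- \<alpha> * real (Suc m))" by (intro H) auto
    with m show "\<bar>f x - f y\<bar> < e" by simp
  qed simp
qed

lemma hoelder_continuous_on:
  assumes "hoelder_continuous I A f"
  shows "continuous_on (shift_space I A) f"
proof -
  have "openin (top_of_set (shift_space I A)) (shift_space I A \<inter> f -` U)" if U: "open U" for U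
    unfolding openin_top_of_set_shift_space_iff
  proof (intro conjI ballI)
    fix x assume x: "x \<in> shift_space I A \<inter> f -` U"
    then obtain e where e: "e > 0" "\<And>z. \<bar>z - f x\<bar> < e \<Longrightarrow> z \<in> U"
      using U by (auto simp: open_dist dist_real_def)
    obtain n where n: "\<And>y. y \<in> shift_space I A \<Longrightarrow> (\<And>k. k < n \<Longrightarrow> y k = x k) \<Longrightarrow> \<bar>f y - f x\<bar> < e"
      using hoelder_continuous_near[OF assms e(1)] x by (metis IntD1)
    show "\<exists>n. {y \<in> shift_space I A. \<forall>k<n. y k = x k} \<subseteq> shift_space I A \<inter> f -` U"
      using n e(2) by (intro exI[of _ n]) auto
  qed auto
  then show ?thesis unfolding continuous_openin_preimage_eq by blast
qed

section \<open>Weights of words\<close>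

definition sup_sum ::
  "nat set \<Rightarrow> (nat \<Rightarrow> nat \<Rightarrow> nat) \<Rightarrow> ((nat \<Rightarrow> nat) \<Rightarrow> real) \<Rightarrow> nat list \<Rightarrow> real" where
  "sup_sum I A f w = (SUP x\<in>cylinder I A w. birkhoff_sum f (length w) x)"

text \<open>The exponent \<open>b\<close> may have either sign. An error in a Birkhoff sum of \<psi>
  that gets multiplied by \<open>b\<close> is controlled in this form.\<close>

lemma mult_le_abs_mult:
  fixes b z c :: real
  assumes "\<bar>z\<bar> \<le> c"
  shows "b * z \<le> \<bar>b\<bar> * c"
proof -
  have "b * z \<le> \<bar>b\<bar> * \<bar>z\<bar>" by (metis abs_ge_self abs_mult)
  also have "\<dots> \<le> \<bar>b\<bar> * c" using assms by (rule mult_left_mono) simp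
  finally show ?thesis .
qed

text \<open>A single \<open>K\<close> is a distortion constant of both potentials, so that all error
  terms depend on \<open>K\<close> and the exponent alone.\<close>

locale induced_system =
  fixes I :: "nat set" and A :: "nat \<Rightarrow> nat \<Rightarrow> nat"
    and \<phi> \<psi> :: "(nat \<Rightarrow> nat) \<Rightarrow> real" and a :: nat and K :: real
  assumes irreducible: "irreducible_matrix I A"
    and hoelder: "hoelder_continuous I A \<phi>" "hoelder_continuous I A \<psi>"
    and distortion: "bounded_distortion I A \<phi> K" "bounded_distortion I A \<psi> K"
    and psi_pos: "x \<in> shift_space I A \<Longrightarrow> \<psi> x > 0"
    and a_in: "a \<in> I"
    and K_nonneg: "K \<ge> 0"
begin

abbreviation "X \<equiv> shift_space I A"

abbreviation "cyl \<equiv> cylinder I A"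

abbreviation "\<Phi> \<equiv> sup_sum I A \<phi>"

abbreviation "\<Psi> \<equiv> sup_sum I A \<psi>"

lemma connect:
  assumes "i \<in> I" "j \<in> I"
  obtains w where "w \<in> words I A" "A i (hd w) = 1" "A (last w) j = 1"
proof -
  obtain w where w: "w \<in> words I A" "i # w @ [j] \<in> words I A"
    using irreducible assms unfolding irreducible_matrix_def by blast
  then have "w \<noteq> []" by (auto simp: words_def)
  then have "A i (hd w) = 1" "A (last w) j = 1"
    using w(2) words_append_iff[of "[i]" "w @ [j]" I A] words_append_iff[of w "[j]" I A] by auto
  with w(1) that show thesis by blast
qed

lemma words_hd_last: "w \<in> words I A \<Longrightarrow> hd w \<in> I \<and> last w \<in> I \<and> w \<noteq> []"
  by (auto simp: words_def)

lemma successor: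
  assumes "i \<in> I"
  obtains j where "j \<in> I" "A i j = 1"
  using connect[OF assms assms] words_hd_last by blast

lemma point_from:
  assumes "i \<in> I"
  obtains x where "x \<in> X" "x 0 = i"
proof -
  have "\<exists>x. \<forall>n. (x n \<in> I \<and> (n = 0 \<longrightarrow> x n = i)) \<and> A (x n) (x (Suc n)) = 1"
  proof (rule dependent_nat_choice)
    show "\<exists>x. x \<in> I \<and> (0 = (0::nat) \<longrightarrow> x = i)" using assms by auto
    fix x n assume "x \<in> I \<and> (n = (0::nat) \<longrightarrow> x = i)"
    then show "\<exists>y. (y \<in> I \<and> (Suc n = 0 \<longrightarrow> y = i)) \<and> A x y = 1" using successor by (metis nat.distinct(1))
  qed
  then show thesis using that by (auto simp: shift_space_def)
qed

text \<open>Irreducibility gives every letter a successor, so an admissible word can be continued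
  forever. Suprema over cylinders of admissible words are thus never taken over the empty
  set.\<close>

lemma cylinder_nonempty:
  assumes "w \<in> words I A"
  obtains x where "x \<in> cyl w"
proof -
  obtain j where j: "j \<in> I" "A (last w) j = 1" using successor words_hd_last[OF assms] by metis
  obtain x where x: "x \<in> X" "x 0 = j" using point_from[OF j(1)] .
  have "cat_seq w x \<in> cyl w"
    using cat_seq_shift_space[OF assms x(1)] j(2) x(2) by (simp add: cylinder_def) (simp add: cat_seq_def)
  then show thesis by (rule that)
qed

text \<open>Bounded distortion makes the supremum finite. Hence the extended real in the definition
  of the pressure is an ordinary real number, which every point of the cylinder computes up to
  \<open>K\<close>.\<close>

lemma sup_sum_bounds:
  assumes f: "bounded_distortion I A f K" and x: "x \<in> cyl w"
  shows "birkhoff_sum f (length w) x \<le> sup_sum I A f w"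
    and "sup_sum I A f w \<le> birkhoff_sum f (length w) x + K"
    and "birkhoff_sup I A f w = ereal (sup_sum I A f w)"
proof -
  have *: "birkhoff_sum f (length w) y \<le> birkhoff_sum f (length w) x + K" if "y \<in> cyl w" for y
    using bounded_distortionD[OF f x that] by linarith
  then have bdd: "bdd_above ((\<lambda>y. birkhoff_sum f (length w) y) ` cyl w)"
    by (auto simp: bdd_above_def)
  show le: "birkhoff_sum f (length w) x \<le> sup_sum I A f w"
    unfolding sup_sum_def using x bdd by (rule cSUP_upper)
  show "sup_sum I A f w \<le> birkhoff_sum f (length w) x + K"
    unfolding sup_sum_def using x * by (intro cSUP_least) auto
  have "\<bar>SUP y\<in>cyl w. ereal (birkhoff_sum f (length w) y)\<bar> \<noteq> \<infinity>"
  proof -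
    have "ereal (birkhoff_sum f (length w) x) \<le> (SUP y\<in>cyl w. ereal (birkhoff_sum f (length w) y))"
      using x by (rule SUP_upper)
    moreover have "(SUP y\<in>cyl w. ereal (birkhoff_sum f (length w) y))
        \<le> ereal (birkhoff_sum f (length w) x + K)"
      using * by (intro SUP_least) simp
    ultimately show ?thesis by (auto simp: abs_eq_infinity_cases) 
  qed
  from ereal_SUP[OF this] show "birkhoff_sup I A f w = ereal (sup_sum I A f w)"
    by (simp add: birkhoff_sup_def sup_sum_def birkhoff_sum_def)
qed

text \<open>One point of the long cylinder tests all three suprema, each of which exceeds the
  corresponding Birkhoff sum by at most \<open>K\<close>. Birkhoff sums add exactly, so the error
  lies between \<open>- 2 * K\<close> and \<open>K\<close>.\<close>

lemma sup_sum_append: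
  assumes f: "bounded_distortion I A f K" and uv: "u @ v \<in> words I A"
  shows "\<bar>sup_sum I A f (u @ v) - sup_sum I A f u - sup_sum I A f v\<bar> \<le> 2 * K"
proof -
  obtain x where x: "x \<in> cyl (u @ v)" using cylinder_nonempty[OF uv] .
  then have u: "x \<in> cyl u" and v: "(shift ^^ length u) x \<in> cyl v"
    by (auto simp: cylinder_append)
  show ?thesis
    using sup_sum_bounds[OF f x] sup_sum_bounds[OF f u] sup_sum_bounds[OF f v] K_nonneg
    by (simp add: birkhoff_sum_add)
qed

lemma birkhoff_sum_psi_nonneg: "x \<in> X \<Longrightarrow> birkhoff_sum \<psi> n x \<ge> 0"
  unfolding birkhoff_sum_def
  by (intro sum_nonneg) (meson funpow_shift_shift_space less_imp_le psi_pos)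

lemma sup_sum_psi_nonneg: "w \<in> words I A \<Longrightarrow> \<Psi> w \<ge> 0"
  by (meson birkhoff_sum_psi_nonneg cylinder_nonempty cylinder_shift_space distortion(2)
      order_trans sup_sum_bounds(1))

definition weight :: "real \<Rightarrow> nat list \<Rightarrow> real" where
  "weight b w = exp (\<Phi> w - b * \<Psi> w)"

text \<open>The additivity error \<open>2 * K\<close> of \<Phi> plus the absolute value of
  \<open>b\<close> times that of \<Psi>.\<close>

definition dist_const :: "real \<Rightarrow> real" where
  "dist_const b = 2 * K * (1 + \<bar>b\<bar>)"

lemma weight_pos: "weight b w > 0"
  by (simp add: weight_def)

lemma dist_const_nonneg: "dist_const b \<ge> 0"
  using K_nonneg by (simp add: dist_const_def)

lemma ln_weight_append:
  assumes "u @ v \<in> words I A"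
  shows "\<bar>ln (weight b (u @ v)) - ln (weight b u) - ln (weight b v)\<bar> \<le> dist_const b"
proof -
  define p where "p = \<Phi> (u @ v) - \<Phi> u - \<Phi> v"
  define q where "q = \<Psi> (u @ v) - \<Psi> u - \<Psi> v"
  have p: "\<bar>p\<bar> \<le> 2 * K" and q: "\<bar>q\<bar> \<le> 2 * K"
    unfolding p_def q_def using sup_sum_append assms distortion by blast+
  have "\<bar>p - b * q\<bar> \<le> \<bar>p\<bar> + \<bar>b\<bar> * \<bar>q\<bar>" by (metis abs_mult abs_triangle_ineq4)
  also have "\<dots> \<le> 2 * K + \<bar>b\<bar> * (2 * K)" using p q by (intro add_mono mult_left_mono) auto
  also have "p - b * q = ln (weight b (u @ v)) - ln (weight b u) - ln (weight b v)"
    by (simp add: weight_def p_def q_def algebra_simps)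
  finally show ?thesis by (simp add: dist_const_def algebra_simps)
qed

lemma weight_append:
  assumes "u @ v \<in> words I A"
  shows "weight b (u @ v) \<le> exp (dist_const b) * (weight b u * weight b v)"
    and "weight b u * weight b v \<le> exp (dist_const b) * weight b (u @ v)"
proof -
  have e: "weight b w = exp (ln (weight b w))" for w by (simp add: weight_pos)
  have "ln (weight b (u @ v)) \<le> dist_const b + (ln (weight b u) + ln (weight b v))"
    "ln (weight b u) + ln (weight b v) \<le> dist_const b + ln (weight b (u @ v))"
    using ln_weight_append[OF assms, of b] by linarith+
  then show "weight b (u @ v) \<le> exp (dist_const b) * (weight b u * weight b v)"
    "weight b u * weight b v \<le> exp (dist_const b) * weight b (u @ v)"
    using e by (metis exp_add exp_le_cancel_iff)+
qed

abbreviation "per \<equiv> periodic_words I A a"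

lemma per_append: "u \<in> per \<Longrightarrow> v \<in> per \<Longrightarrow> u @ v \<in> per"
  using words_hd_last by (auto simp: periodic_words_iff words_append_iff)

lemma per_loop: obtains u where "u \<in> per"
proof -
  obtain w where w: "w \<in> words I A" "A a (hd w) = 1" "A (last w) a = 1"
    using connect[OF a_in a_in] .
  then have "[a] @ w \<in> words I A"
    using words_hd_last[OF w(1)] a_in by (subst words_append_iff) (auto simp: words_def)
  then have "a # w \<in> per" using w words_hd_last[OF w(1)] by (simp add: periodic_words_iff)
  then show thesis by (rule that)
qed

text \<open>At the periodic point of \<open>u\<close> the Birkhoff sum of \<psi> over
  \<open>m\<close> periods is exactly \<open>m\<close> times a positive number. Long words need not
  have large \<Psi> when \<psi> comes close to 0; powers of a fixed loop do.\<close>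

lemma per_power:
  assumes u: "u \<in> per"
  shows "m > 0 \<Longrightarrow> concat (replicate m u) \<in> per"
    and "\<exists>s>0. \<forall>m>0. \<Psi> (concat (replicate m u)) \<ge> real m * s"
proof -
  show *: "concat (replicate m u) \<in> per" if "m > 0" for m
    using that
  proof (induction m)
    case (Suc m)
    then show ?case using u per_append by (cases "m = 0") auto
  qed simp
  define x where "x = (\<lambda>n. u ! (n mod length u))"
  have x: "x \<in> X" using u by (simp add: x_def periodic_words_def)
  have ne: "length u > 0" using u by (simp add: periodic_words_def words_def)
  have sx: "(shift ^^ length u) x = x" by (simp add: funpow_shift x_def)
  have cyl: "x \<in> cyl (concat (replicate m u)) \<and>
      birkhoff_sum \<psi> (length (concat (replicate m u))) x = real m * birkhoff_sum \<psi> (length u) x" for m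
  proof (induction m)
    case 0
    then show ?case using x by (simp add: cylinder_def)
  next
    case (Suc m)
    have "x \<in> cyl u" using x by (simp add: cylinder_def) (simp add: x_def)
    then show ?case using Suc by (simp add: cylinder_append sx birkhoff_sum_add algebra_simps)
  qed
  have "birkhoff_sum \<psi> (length u) x > 0"
    unfolding birkhoff_sum_def using ne x by (intro sum_pos psi_pos funpow_shift_shift_space) auto
  then show "\<exists>s>0. \<forall>m>0. \<Psi> (concat (replicate m u)) \<ge> real m * s"
    using cyl sup_sum_bounds(1)[OF distortion(2)] by metis
qed

section \<open>Pressure and summability of weights\<close>

definition window :: "real \<Rightarrow> real \<Rightarrow> nat list set" where
  "window \<eta> T = {w \<in> per. T - \<eta> < \<Psi> w \<and> \<Psi> w \<le> T}"

lemma birkhoff_sup_per: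
  "w \<in> per \<Longrightarrow> birkhoff_sup I A \<phi> w = ereal (\<Phi> w)"
  "w \<in> per \<Longrightarrow> birkhoff_sup I A \<psi> w = ereal (\<Psi> w)"
  by (meson cylinder_nonempty distortion periodic_words_iff sup_sum_bounds(3))+

text \<open>A sum of nonnegative extended reals is the supremum of its finite partial sums. From
  here on all estimates concern finite sets of words and real numbers.\<close>

lemma window_infsum:
  "(\<Sum>\<^sub>\<infinity> w \<in> {w \<in> per. ereal (T - \<eta>) < birkhoff_sup I A \<psi> w \<and> birkhoff_sup I A \<psi> w \<le> ereal T}.
      exp_ereal (birkhoff_sup I A \<phi> w)) =
    (SUP F\<in>{F. finite F \<and> F \<subseteq> window \<eta> T}. ennreal (\<Sum>w\<in>F. exp (\<Phi> w)))"
proof -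
  have "{w \<in> per. ereal (T - \<eta>) < birkhoff_sup I A \<psi> w \<and> birkhoff_sup I A \<psi> w \<le> ereal T} = window \<eta> T"
    by (auto simp: window_def birkhoff_sup_per)
  moreover have "(\<Sum>\<^sub>\<infinity> w\<in>window \<eta> T. exp_ereal (birkhoff_sup I A \<phi> w)) =
      (SUP F\<in>{F. finite F \<and> F \<subseteq> window \<eta> T}. \<Sum>w\<in>F. exp_ereal (birkhoff_sup I A \<phi> w))"
    by (rule nonneg_infsum_complete) simp
  moreover have "(\<Sum>w\<in>F. exp_ereal (birkhoff_sup I A \<phi> w)) = ennreal (\<Sum>w\<in>F. exp (\<Phi> w))"
    if "F \<subseteq> window \<eta> T" for F
  proof -
    have "(\<Sum>w\<in>F. exp_ereal (birkhoff_sup I A \<phi> w)) = (\<Sum>w\<in>F. ennreal (exp (\<Phi> w)))"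
      using that by (intro sum.cong) (auto simp: window_def birkhoff_sup_per exp_ereal_def)
    then show ?thesis by (simp add: sum_ennreal)
  qed
  ultimately show ?thesis by (auto intro!: SUP_cong)
qed

text \<open>In a window \<Psi> is nearly \<open>T\<close>, so \<open>exp (\<Phi> w)\<close> is the
  weight times \<open>exp (b * T)\<close> up to a factor independent of \<open>T\<close>. That
  factor disappears after taking the logarithm and dividing by \<open>T\<close>.\<close>

lemma pressure_le:
  assumes M: "\<And>F. finite F \<Longrightarrow> F \<subseteq> per \<Longrightarrow> (sum (weight b) F) \<le> M"
  shows "induced_pressure I A \<eta> \<psi> \<phi> per \<le> ereal b"
proof -
  \<comment> \<open>The exponential pays for the deviation of \<Psi> from \<open>T\<close> inside a
    window, for either sign of \<open>b\<close>; the added 1 makes \<open>C\<close> positive, so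
    that \<open>ln C\<close> may be used.\<close>
  define C where "C = (\<bar>M\<bar> + 1) * exp (\<bar>b\<bar> * \<bar>\<eta>\<bar>)"
  have C: "C > 0" by (simp add: C_def add_nonneg_pos)
  define S where "S = (\<lambda>T. SUP F\<in>{F. finite F \<and> F \<subseteq> window \<eta> T}. ennreal (\<Sum>w\<in>F. exp (\<Phi> w)))"
  have S: "S T \<le> ennreal (C * exp (b * T))" for T
    unfolding S_def
  proof (intro SUP_least ennreal_leI)
    fix F assume "F \<in> {F. finite F \<and> F \<subseteq> window \<eta> T}"
    then have F: "finite F" "F \<subseteq> window \<eta> T" by auto
    have "(\<Sum>w\<in>F. exp (\<Phi> w)) \<le> (\<Sum>w\<in>F. weight b w * (exp (b * T) * exp (\<bar>b\<bar> * \<bar>\<eta>\<bar>)))"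
    proof (rule sum_mono)
      fix w assume "w \<in> F"
      then have w: "\<bar>\<Psi> w - T\<bar> \<le> \<bar>\<eta>\<bar>" using F by (auto simp: window_def)
      have "b * (\<Psi> w - T) \<le> \<bar>b\<bar> * \<bar>\<eta>\<bar>"
        using w by (rule mult_le_abs_mult)
      then have "\<Phi> w \<le> (\<Phi> w - b * \<Psi> w) + (b * T + \<bar>b\<bar> * \<bar>\<eta>\<bar>)"
        by (simp add: algebra_simps)
      then show "exp (\<Phi> w) \<le> weight b w * (exp (b * T) * exp (\<bar>b\<bar> * \<bar>\<eta>\<bar>))"
        unfolding weight_def exp_add[symmetric] by simp
    qed
    also have "\<dots> = sum (weight b) F * (exp (b * T) * exp (\<bar>b\<bar> * \<bar>\<eta>\<bar>))" by (simp add: sum_distrib_right)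
    also have "\<dots> \<le> (\<bar>M\<bar> + 1) * (exp (b * T) * exp (\<bar>b\<bar> * \<bar>\<eta>\<bar>))"
    proof (rule mult_right_mono)
      have "F \<subseteq> per" using F(2) by (auto simp: window_def)
      then show "sum (weight b) F \<le> \<bar>M\<bar> + 1" using M[OF F(1)] by linarith
    qed simp
    finally show "(\<Sum>w\<in>F. exp (\<Phi> w)) \<le> C * exp (b * T)" by (simp add: C_def mult_ac)
  qed
  have pt: "ln_ennreal (S T) / ereal T \<le> ereal (ln C / T + b)" if T: "T > 0" for T
  proof (cases "S T = 0")
    case True
    then show ?thesis using T by (simp add: ln_ennreal_def)
  next
    case False
    have fin: "S T \<noteq> \<infinity>" using S[of T] by (auto simp: top_unique)
    have pos: "enn2real (S T) > 0" using False fin by (simp add: enn2real_positive_iff top.not_eq_extremum zero_less_iff_neq_zero)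
    have "enn2real (S T) \<le> C * exp (b * T)" using S[of T] C by (simp add: enn2real_leI)
    then have "ln (enn2real (S T)) \<le> ln (C * exp (b * T))" using pos by simp
    also have "\<dots> = ln C + b * T" using C by (simp add: ln_mult)
    finally show ?thesis using False fin T by (simp add: ln_ennreal_def field_simps)
  qed
  have "\<forall>\<^sub>F T in at_top. ln_ennreal (S T) / ereal T \<le> ereal (ln C / T + b)"
    using eventually_gt_at_top[of "0::real"] by eventually_elim (rule pt)
  then have "Limsup at_top (\<lambda>T. ln_ennreal (S T) / ereal T) \<le> Limsup at_top (\<lambda>T. ereal (ln C / T + b))"
    by (rule Limsup_mono)
  also have "\<dots> = ereal b"
  proof (rule lim_imp_Limsup)
    have "((\<lambda>T. ln C / T + b) \<longlongrightarrow> 0 + b) at_top"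
      by (intro tendsto_add tendsto_const tendsto_divide_0[OF tendsto_const] filterlim_at_top_imp_at_infinity filterlim_ident)
    then show "((\<lambda>T. ereal (ln C / T + b)) \<longlongrightarrow> ereal b) at_top" by simp
  qed simp
  finally show ?thesis unfolding induced_pressure_def window_infsum S_def .
qed

text \<open>For \<open>b0\<close> strictly between the pressure and \<open>b\<close>, the window
  sums are at most \<open>exp (b0 * T)\<close> for large \<open>T\<close>. Passing to weights at
  \<open>b\<close> gains \<open>exp (- (b - b0) * T)\<close>, so successive windows contribute a
  geometric series. An upper limit says nothing about small \<open>T\<close>, hence the threshold
  \<open>T0\<close>.\<close>

lemma weight_sum_bounded_long:
  assumes P: "induced_pressure I A \<eta> \<psi> \<phi> per < ereal b" and \<eta>: "\<eta> > 0"
  shows "\<exists>T0 M. \<forall>F. finite F \<longrightarrow> F \<subseteq> {w \<in> per. \<Psi> w > T0} \<longrightarrow> (sum (weight b) F) \<le> M"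
proof -
  obtain b0 where b0: "induced_pressure I A \<eta> \<psi> \<phi> per < ereal b0" "b0 < b"
    using ereal_dense2[OF P] by auto
  from b0(1) have "\<forall>\<^sub>F T in at_top. ln_ennreal (SUP F\<in>{F. finite F \<and> F \<subseteq> window \<eta> T}.
      ennreal (\<Sum>w\<in>F. exp (\<Phi> w))) / ereal T < ereal b0"
    unfolding induced_pressure_def window_infsum by (rule Limsup_lessD)
  then obtain T1 where T1: "\<And>T. T \<ge> T1 \<Longrightarrow> ln_ennreal (SUP F\<in>{F. finite F \<and> F \<subseteq> window \<eta> T}.
      ennreal (\<Sum>w\<in>F. exp (\<Phi> w))) / ereal T < ereal b0"
    unfolding eventually_at_top_linorder by blast
  define T0 where "T0 = max T1 1"
  have win: "(\<Sum>w\<in>F. exp (\<Phi> w)) \<le> exp (b0 * T)"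
    if T: "T \<ge> T0" and F: "finite F" "F \<subseteq> window \<eta> T" for F T
  proof -
    define S where "S = (SUP F\<in>{F. finite F \<and> F \<subseteq> window \<eta> T}. ennreal (\<Sum>w\<in>F. exp (\<Phi> w)))"
    have le: "ennreal (\<Sum>w\<in>F. exp (\<Phi> w)) \<le> S"
      unfolding S_def using F by (intro SUP_upper) auto
    have Tp: "T > 0" using T by (simp add: T0_def)
    have L: "ln_ennreal S / ereal T < ereal b0" using T1[of T] T by (simp add: S_def T0_def)
    show ?thesis
    proof (cases "S = 0")
      case True
      then have "(\<Sum>w\<in>F. exp (\<Phi> w)) \<le> 0" using le by (simp add: ennreal_eq_0_iff)
      then show ?thesis by (smt (verit) exp_ge_zero)
    next
      case False
      have fin: "S \<noteq> \<infinity>" using L Tp by (auto simp: ln_ennreal_def)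
      have pos: "enn2real S > 0" using False fin by (simp add: enn2real_positive_iff top.not_eq_extremum zero_less_iff_neq_zero)
      have "ln (enn2real S) < b0 * T" using L Tp False fin by (simp add: ln_ennreal_def field_simps)
      then have "enn2real S < exp (b0 * T)" using pos by (metis exp_less_mono exp_ln)
      moreover have "(\<Sum>w\<in>F. exp (\<Phi> w)) \<le> enn2real S"
        using le fin by (metis enn2real_ennreal enn2real_mono exp_ge_zero infinity_ennreal_def sum_nonneg top.not_eq_extremum)
      ultimately show ?thesis by simp
    qed
  qed
  define r where "r = exp (- (b - b0) * \<eta>)"
  have r: "0 < r" "r < 1" using b0 \<eta> by (auto simp: r_def mult_neg_pos)
  define C where "C = exp (- (b - b0) * T0 + \<bar>b\<bar> * \<eta>)"
  have C: "C > 0" by (simp add: C_def)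
  have win': "sum (weight b) F \<le> C * r ^ n"
    if F: "finite F" "F \<subseteq> window \<eta> (T0 + \<eta> * real n)" for F n
  proof -
    let ?T = "T0 + \<eta> * real n"
    have "sum (weight b) F \<le> (\<Sum>w\<in>F. exp (\<Phi> w) * exp (- b * ?T + \<bar>b\<bar> * \<eta>))"
    proof (rule sum_mono)
      fix w assume "w \<in> F"
      then have w: "\<bar>?T - \<Psi> w\<bar> \<le> \<eta>" using F by (auto simp: window_def)
      have "b * (?T - \<Psi> w) \<le> \<bar>b\<bar> * \<eta>"
        using w by (rule mult_le_abs_mult)
      then show "weight b w \<le> exp (\<Phi> w) * exp (- b * ?T + \<bar>b\<bar> * \<eta>)"
        unfolding weight_def exp_add[symmetric] by (simp add: algebra_simps)
    qed
    also have "\<dots> = (\<Sum>w\<in>F. exp (\<Phi> w)) * exp (- b * ?T + \<bar>b\<bar> * \<eta>)" by (simp add: sum_distrib_right)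
    also have "\<dots> \<le> exp (b0 * ?T) * exp (- b * ?T + \<bar>b\<bar> * \<eta>)"
      using win[of ?T F] F \<eta> by (intro mult_right_mono) auto
    also have "\<dots> = C * exp (real n * (- (b - b0) * \<eta>))"
      unfolding C_def exp_add[symmetric] by (simp add: algebra_simps)
    also have "exp (real n * (- (b - b0) * \<eta>)) = r ^ n" unfolding r_def by (rule exp_of_nat_mult)
    finally show ?thesis .
  qed
  have "sum (weight b) F \<le> C * (1 / (1 - r))"
    if F: "finite F" "F \<subseteq> {w \<in> per. \<Psi> w > T0}" for F
  proof -
    \<comment> \<open>The windows ending at \<open>T0 + \<eta> * real n\<close> are half-open and
      adjacent; the ceiling selects the one that contains \<open>\<Psi> w\<close>.\<close>
    define g where "g = (\<lambda>w. nat \<lceil>(\<Psi> w - T0) / \<eta>\<rceil>)"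
    have g: "w \<in> window \<eta> (T0 + \<eta> * real (g w))" if "w \<in> F" for w
    proof -
      define z where "z = (\<Psi> w - T0) / \<eta>"
      have z: "z > 0" using F \<eta> that by (auto simp: z_def)
      then have "real (g w) = of_int \<lceil>z\<rceil>" by (simp add: g_def z_def)
      then have "real (g w) - 1 < z" "z \<le> real (g w)" by linarith+
      then show ?thesis using F that \<eta> by (auto simp: window_def z_def field_simps)
    qed
    have "finite (g ` F)" using F by simp
    then obtain N where N: "g ` F \<subseteq> {..<N}" by (meson finite_nat_iff_bounded)
    have "sum (weight b) F = (\<Sum>n<N. \<Sum>w\<in>{w \<in> F. g w = n}. weight b w)"
      using F N by (subst sum.group) auto
    also have "\<dots> \<le> (\<Sum>n<N. C * r ^ n)"
      using F g by (intro sum_mono win') auto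
    also have "\<dots> = C * (\<Sum>n<N. r ^ n)" by (simp add: sum_distrib_left)
    also have "(\<Sum>n<N. r ^ n) \<le> 1 / (1 - r)"
      using r by (intro geometric_sum_le) auto
    finally show ?thesis using C by (simp add: mult_left_mono)
  qed
  then show ?thesis by blast
qed

text \<open>All words from \<open>i\<close> to \<open>j\<close> are wrapped, with the same prefix
  and suffix, into periodic words at \<open>a\<close>. This is injective and changes weights by
  bounded factors, and the suffix ends in a power of a loop that pushes \<Psi> beyond
  \<open>T0\<close>.\<close>

lemma weight_sum_bounded:
  assumes P: "induced_pressure I A \<eta> \<psi> \<phi> per < ereal b" and \<eta>: "\<eta> > 0" and ij: "i \<in> I" "j \<in> I"
  shows "\<exists>M. \<forall>F. finite F \<longrightarrow> F \<subseteq> {w \<in> words I A. hd w = i \<and> last w = j} \<longrightarrow> (sum (weight b) F) \<le> M"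
proof -
  obtain T0 M where M: "\<And>F. finite F \<Longrightarrow> F \<subseteq> {w \<in> per. \<Psi> w > T0} \<Longrightarrow> (sum (weight b) F) \<le> M"
    using weight_sum_bounded_long[OF P \<eta>] by blast
  obtain p where p: "p \<in> words I A" "A a (hd p) = 1" "A (last p) i = 1" using connect[OF a_in ij(1)] .
  obtain q where q: "q \<in> words I A" "A j (hd q) = 1" "A (last q) a = 1" using connect[OF ij(2) a_in] .
  obtain u where u: "u \<in> per" using per_loop .
  obtain s where s: "s > 0" "\<And>m. m > 0 \<Longrightarrow> \<Psi> (concat (replicate m u)) \<ge> real m * s"
    using per_power(2)[OF u] by blast
  \<comment> \<open>The extra \<open>2 * K\<close> absorbs the additivity error when
    \<open>v\<close> is split off the wrapped word; what remains in front of \<open>v\<close> has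
    nonnegative \<Psi>.\<close>
  obtain m where m: "real m * s > T0 + 2 * K" using s(1) ex_less_of_nat_mult by blast
  have m: "real (Suc m) * s > T0 + 2 * K" using m s(1) by (simp add: algebra_simps)
  define v where "v = concat (replicate (Suc m) u)"
  have v: "v \<in> per" "\<Psi> v > T0 + 2 * K"
    using per_power(1)[OF u, of "Suc m"] s(2)[of "Suc m"] m by (auto simp: v_def)
  define x where "x = a # p"
  define y where "y = q @ v"
  define h where "h = (\<lambda>w. x @ w @ y)"
  have ap: "a # p \<in> words I A" using p a_in words_append_iff[of "[a]" p I A] words_hd_last[OF p(1)]
    by (auto simp: words_def)
  have yw: "y \<in> words I A"
    using q v words_hd_last[OF q(1)] words_hd_last[of v] by (auto simp: y_def words_append_iff periodic_words_iff)
  have yh: "hd y = hd q" "last y = last v"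
    using words_hd_last[OF q(1)] v words_hd_last[of v] by (auto simp: y_def periodic_words_iff)
  have h: "h w \<in> per \<and> \<Psi> (h w) > T0 \<and>
      weight b w \<le> exp (2 * dist_const b) / (weight b x * weight b y) * weight b (h w)"
    if w: "w \<in> words I A" "hd w = i" "last w = j" for w
  proof -
    have ne: "w \<noteq> []" "y \<noteq> []" "v \<noteq> []" using w(1) yw v words_hd_last by (auto simp: periodic_words_iff)
    have wy: "w @ y \<in> words I A" using w yw yh q ne by (simp add: words_append_iff)
    have xwy: "x @ w @ y \<in> words I A"
      using wy ap p w ne words_hd_last[OF p(1)] words_append_iff[of "a # p" "w @ y" I A]
      by (simp add: x_def)
    then have per: "h w \<in> per" using ne yh v by (simp add: periodic_words_iff h_def) (simp add: x_def)
    have "(x @ w @ q) @ v \<in> words I A" using xwy by (simp add: y_def)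
    moreover have "x @ w @ q \<in> words I A"
      using calculation words_append_iff[of "x @ w @ q" v I A] ne by simp
    ultimately have "\<Psi> (h w) > T0"
      using sup_sum_append[OF distortion(2), of "x @ w @ q" v] sup_sum_psi_nonneg[of "x @ w @ q"] v(2)
      by (simp add: h_def y_def)
    have "weight b w * weight b y \<le> exp (dist_const b) * weight b (w @ y)"
      "weight b x * weight b (w @ y) \<le> exp (dist_const b) * weight b (h w)"
      unfolding h_def using weight_append(2) wy xwy by blast+
    then have "weight b x * (weight b w * weight b y) \<le> weight b x * (exp (dist_const b) * weight b (w @ y))"
      using weight_pos[of b x] by (intro mult_left_mono) auto
    also have "\<dots> = exp (dist_const b) * (weight b x * weight b (w @ y))" by simp
    also have "\<dots> \<le> exp (dist_const b) * (exp (dist_const b) * weight b (h w))"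
      using \<open>weight b x * weight b (w @ y) \<le> _\<close> by (intro mult_left_mono) auto
    also have "\<dots> = exp (2 * dist_const b) * weight b (h w)" by (simp add: exp_double power2_eq_square)
    finally have "weight b w \<le> exp (2 * dist_const b) / (weight b x * weight b y) * weight b (h w)"
      using weight_pos[of b x] weight_pos[of b y] by (simp add: field_simps)
    with per \<open>\<Psi> (h w) > T0\<close> show ?thesis by blast
  qed
  define c where "c = exp (2 * dist_const b) / (weight b x * weight b y)"
  have c: "c > 0" using weight_pos[of b x] weight_pos[of b y] by (simp add: c_def)
  have "sum (weight b) F \<le> c * M"
    if F: "finite F" "F \<subseteq> {w \<in> words I A. hd w = i \<and> last w = j}" for F
  proof -
    have "sum (weight b) F \<le> (\<Sum>w\<in>F. c * weight b (h w))"
      using F h by (intro sum_mono) (auto simp: c_def)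
    also have "\<dots> = c * (\<Sum>w\<in>F. weight b (h w))" by (simp add: sum_distrib_left)
    also have "(\<Sum>w\<in>F. weight b (h w)) = (\<Sum>w\<in>h ` F. weight b w)"
      by (subst sum.reindex) (auto simp: inj_on_def h_def)
    also have "c * \<dots> \<le> c * M"
      using F h c by (intro mult_left_mono M) auto
    finally show ?thesis .
  qed
  then show ?thesis by blast
qed

end

section \<open>Measurability on the shift space\<close>

lemma closed_shift_space: "closed (shift_space I A)"
proof -
  have o: "open {y :: nat \<Rightarrow> nat. y n \<in> S}" for n S
  proof -
    have "open ((\<lambda>y :: nat \<Rightarrow> nat. y n) -` S)"
      by (intro open_vimage open_discrete continuous_on_product_coordinates)
    then show ?thesis by (simp add: vimage_def)
  qed
  have "open (- shift_space I A)"
  proof (subst open_subopen, intro ballI)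
    fix x assume "x \<in> - shift_space I A"
    then obtain n where n: "x n \<notin> I \<or> A (x n) (x (Suc n)) \<noteq> 1" by (auto simp: shift_space_def)
    have "open ({y. y n \<in> {x n}} \<inter> {y. y (Suc n) \<in> {x (Suc n)}})"
      by (intro open_Int o)
    moreover have "{y. y n \<in> {x n}} \<inter> {y. y (Suc n) \<in> {x (Suc n)}} \<subseteq> - shift_space I A"
    proof
      fix y assume "y \<in> {y. y n \<in> {x n}} \<inter> {y. y (Suc n) \<in> {x (Suc n)}}"
      then have "y n \<notin> I \<or> A (y n) (y (Suc n)) \<noteq> 1" using n by simp
      then show "y \<in> - shift_space I A" unfolding shift_space_def by blast
    qed
    ultimately show "\<exists>T. open T \<and> x \<in> T \<and> T \<subseteq> - shift_space I A"
      by (intro exI[of _ "{y. y n \<in> {x n}} \<inter> {y. y (Suc n) \<in> {x (Suc n)}}"]) auto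
  qed
  then show ?thesis by (simp add: closed_def)
qed

text \<open>With the trace of the product Borel sets at hand, measurability can be checked on
  coordinates.\<close>

lemma borel_sets_of_shift_topology:
  "borel_sets_of (shift_topology I A) = sets (restrict_space borel (shift_space I A))"
proof -
  let ?X = "shift_space I A"
  have "sets (restrict_space borel ?X) = (\<inter>) ?X ` sigma_sets UNIV {S. open S}"
    by (simp add: sets_restrict_space borel_def sets_measure_of_conv)
  also have "\<dots> = sigma_sets ?X ((\<inter>) ?X ` {S. open S})"
  proof (rule sigma_sets_Int)
    have "?X \<in> sets borel" by (intro borel_closed closed_shift_space)
    then show "?X \<in> sigma_sets UNIV {S. open S}" by (simp add: borel_def sets_measure_of_conv)
  qed simp
  also have "(\<inter>) ?X ` {S. open S} = {U. openin (top_of_set ?X) U}"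
    by (auto simp: openin_open)
  finally show ?thesis by (simp add: borel_sets_of_def shift_topology_eq)
qed

lemma cylinder_iff_prefix:
  assumes "length w = n"
  shows "x \<in> cylinder I A w \<longleftrightarrow> x \<in> shift_space I A \<and> map x [0..<n] = w"
  using assms by (auto simp: cylinder_def list_eq_iff_nth_eq)

lemma openin_cylinder: "openin (top_of_set (shift_space I A)) (cylinder I A w)"
  unfolding openin_top_of_set_shift_space_iff
proof (intro conjI ballI)
  fix x assume "x \<in> cylinder I A w"
  then have "{y \<in> shift_space I A. \<forall>k<length w. y k = x k} \<subseteq> cylinder I A w"
    by (auto simp: cylinder_def)
  then show "\<exists>n. {y \<in> shift_space I A. \<forall>k<n. y k = x k} \<subseteq> cylinder I A w" by blast
qed (auto simp: cylinder_def)

lemma openin_eq_Union_cylinders: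
  assumes "openin (top_of_set (shift_space I A)) U"
  shows "U = (\<Union>w\<in>{w. cylinder I A w \<subseteq> U}. cylinder I A w)"
proof
  show "U \<subseteq> (\<Union>w\<in>{w. cylinder I A w \<subseteq> U}. cylinder I A w)"
  proof
    fix x assume x: "x \<in> U"
    then obtain n where n: "{y \<in> shift_space I A. \<forall>k<n. y k = x k} \<subseteq> U" and X: "x \<in> shift_space I A"
      using assms unfolding openin_top_of_set_shift_space_iff by blast
    have "cylinder I A (map x [0..<n]) \<subseteq> U" using n by (auto simp: cylinder_def)
    then show "x \<in> (\<Union>w\<in>{w. cylinder I A w \<subseteq> U}. cylinder I A w)"
      using in_cylinder_prefix[OF X, of n] by blast
  qed
qed auto

text \<open>There are only countably many words, so every open set is a countable union of
  cylinders. This opens statements about Borel sets to induction starting from cylinders.\<close>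

lemma borel_sets_of_cylinders:
  "borel_sets_of (shift_topology I A) = sigma_sets (shift_space I A) (range (cylinder I A))"
proof -
  let ?X = "shift_space I A"
  interpret S: sigma_algebra ?X "sigma_sets ?X (range (cylinder I A))"
    by (intro sigma_algebra_sigma_sets) (auto simp: cylinder_def)
  have "U \<in> sigma_sets ?X (range (cylinder I A))" if U: "openin (top_of_set ?X) U" for U
    by (subst openin_eq_Union_cylinders[OF U], rule S.countable_UN'') auto
  then have "sigma_sets ?X {U. openin (top_of_set ?X) U} \<subseteq> sigma_sets ?X (range (cylinder I A))"
    by (intro sigma_sets_mono) auto
  moreover have "sigma_sets ?X (range (cylinder I A)) \<subseteq> sigma_sets ?X {U. openin (top_of_set ?X) U}"
    by (intro sigma_sets_mono) (auto simp: openin_cylinder)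
  ultimately show ?thesis by (simp add: borel_sets_of_def shift_topology_eq)
qed

text \<open>The symbol \<open>N\<close> stands for the lump of all letters that are at least
  \<open>N\<close>. Only finitely many codes of each length remain, even over an infinite
  alphabet.\<close>

definition trunc_code :: "nat \<Rightarrow> nat \<Rightarrow> (nat \<Rightarrow> nat) \<Rightarrow> nat list" where
  "trunc_code N L x = map (\<lambda>k. min (x k) N) [0..<L]"

lemma shift_measurable_restrict:
  "(shift ^^ k) \<in> measurable (restrict_space borel (shift_space I A)) (restrict_space borel (shift_space I A))"
proof -
  have "shift \<in> measurable (restrict_space borel (shift_space I A)) (restrict_space borel (shift_space I A))"
  proof (rule measurable_restrict_space3)
    show "shift \<in> borel_measurable borel"
      unfolding shift_def by (rule measurable_coordinatewise_then_product) measurable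
  qed (auto simp: shift_shift_space)
  then show ?thesis by (induction k) (auto intro: measurable_comp)
qed

locale shift_measure =
  fixes I :: "nat set" and A :: "nat \<Rightarrow> nat \<Rightarrow> nat" and \<nu> :: "(nat \<Rightarrow> nat) measure"
  assumes invariant: "\<nu> \<in> invariant_measures I A"

sublocale shift_measure \<subseteq> prob_space \<nu>
proof (rule prob_spaceI)
  show "emeasure \<nu> (space \<nu>) = 1" using invariant unfolding invariant_measures_def by blast
qed

context shift_measure
begin

abbreviation "X \<equiv> shift_space I A"

abbreviation "cyl \<equiv> cylinder I A"

lemma space_nu: "space \<nu> = X"
  using invariant by (simp add: invariant_measures_def)

lemma sets_nu: "sets \<nu> = sets (restrict_space borel X)"
  using invariant by (simp add: invariant_measures_def borel_sets_of_shift_topology)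

lemma sets_nu_cylinders: "sets \<nu> = sigma_sets X (range cyl)"
  using invariant by (simp add: invariant_measures_def borel_sets_of_cylinders)

lemma cylinder_sets [measurable]: "cyl w \<in> sets \<nu>"
  by (auto simp: sets_nu_cylinders)

lemma continuous_on_measurable:
  fixes f :: "(nat \<Rightarrow> nat) \<Rightarrow> real"
  assumes "continuous_on X f"
  shows "f \<in> borel_measurable \<nu>"
  unfolding measurable_cong_sets[OF sets_nu refl] by (rule borel_measurable_continuous_on_restrict[OF assms])

lemma prefix_measurable: "(\<lambda>x. map x [0..<n]) \<in> measurable \<nu> (count_space UNIV)"
proof (rule measurableI)
  fix B :: "nat list set"
  have "(\<lambda>x. map x [0..<n]) -` B \<inter> space \<nu> = (\<Union>w\<in>B \<inter> {w. length w = n}. cyl w)"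
    by (auto simp: space_nu cylinder_iff_prefix)
  also have "\<dots> \<in> sets \<nu>" by (intro sets.countable_UN'') auto
  finally show "(\<lambda>x. map x [0..<n]) -` B \<inter> space \<nu> \<in> sets \<nu>" .
qed simp

lemma shift_measurable [measurable]: "shift \<in> measurable \<nu> \<nu>"
  using shift_measurable_restrict[of 1] by (simp cong: measurable_cong_sets add: sets_nu)

lemma distr_shift: "distr \<nu> \<nu> shift = \<nu>"
proof (rule measure_eqI)
  fix B assume "B \<in> sets (distr \<nu> \<nu> shift)"
  then show "emeasure (distr \<nu> \<nu> shift) B = emeasure \<nu> B"
    using invariant by (subst emeasure_distr) (auto simp: invariant_measures_def)
qed simp

lemma integrable_shift: 
  fixes f :: "(nat \<Rightarrow> nat) \<Rightarrow> real"
  assumes "integrable \<nu> f"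
  shows "integrable \<nu> (\<lambda>x. f ((shift ^^ k) x))" "(\<integral>x. f ((shift ^^ k) x) \<partial>\<nu>) = (\<integral>x. f x \<partial>\<nu>)"
proof -
  have "integrable \<nu> (\<lambda>x. f ((shift ^^ k) x)) \<and> (\<integral>x. f ((shift ^^ k) x) \<partial>\<nu>) = (\<integral>x. f x \<partial>\<nu>)"
  proof (induction k)
    case (Suc k)
    let ?g = "\<lambda>x. f ((shift ^^ k) x)"
    have g: "?g \<in> borel_measurable \<nu>" using Suc by auto
    have "integrable (distr \<nu> \<nu> shift) ?g" using Suc by (simp add: distr_shift)
    then have "integrable \<nu> (\<lambda>x. ?g (shift x))" by (rule integrable_distr[rotated]) simp
    moreover have "(\<integral>x. ?g (shift x) \<partial>\<nu>) = (\<integral>x. ?g x \<partial>distr \<nu> \<nu> shift)"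
      using g by (intro integral_distr[symmetric]) auto
    ultimately show ?case using Suc by (simp add: distr_shift funpow_swap1)
  qed (use assms in simp)
  then show "integrable \<nu> (\<lambda>x. f ((shift ^^ k) x))" "(\<integral>x. f ((shift ^^ k) x) \<partial>\<nu>) = (\<integral>x. f x \<partial>\<nu>)"
    by auto
qed

lemma birkhoff_sum_integral:
  assumes "integrable \<nu> f"
  shows "integrable \<nu> (birkhoff_sum f n)" "(\<integral>x. birkhoff_sum f n x \<partial>\<nu>) = real n * (\<integral>x. f x \<partial>\<nu>)"
  unfolding birkhoff_sum_def using integrable_shift[OF assms] by (auto simp: Bochner_Integration.integral_sum)

section \<open>Approximation by finitely many coordinates with truncated letters\<close>

lemma trunc_code_measurable: "trunc_code N L \<in> measurable \<nu> (count_space UNIV)"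
proof -
  have "trunc_code N L = (\<lambda>w. map (\<lambda>v. min v N) w) \<circ> (\<lambda>x. map x [0..<L])"
    by (simp add: trunc_code_def fun_eq_iff)
  then show ?thesis using measurable_comp[OF prefix_measurable, where L = "count_space UNIV"] by simp
qed

lemma trunc_code_set: "{x \<in> X. trunc_code N L x \<in> S} \<in> sets \<nu>"
proof -
  have "trunc_code N L -` S \<inter> space \<nu> \<in> sets \<nu>" using trunc_code_measurable by (rule measurable_sets) simp
  then show ?thesis by (simp add: space_nu vimage_def Int_def conj_commute)
qed

text \<open>The same \<open>N\<close> is the number of coordinates and the truncation level. Asking
  for all large \<open>N\<close>, rather than for one, allows finitely many sets to share a common
  \<open>N\<close>.\<close>

definition approximable :: "(nat \<Rightarrow> nat) set \<Rightarrow> bool" where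
  "approximable B \<longleftrightarrow> (\<forall>\<delta>>0. \<forall>\<^sub>F N in sequentially. \<exists>S. 
     measure \<nu> (sym_diff B {x \<in> X. trunc_code N N x \<in> S}) < \<delta>)"

lemma approximableI:
  assumes "\<And>N. N \<ge> N0 \<Longrightarrow> \<exists>S. B = {x \<in> X. trunc_code N N x \<in> S}"
  shows "approximable B"
  unfolding approximable_def
proof (intro allI impI)
  fix \<delta> :: real assume \<delta>: "\<delta> > 0"
  show "\<forall>\<^sub>F N in sequentially. \<exists>S. measure \<nu> (sym_diff B {x \<in> X. trunc_code N N x \<in> S}) < \<delta>"
    using eventually_ge_at_top[of N0]
  proof eventually_elim
    case (elim N)
    obtain S where S: "B = {x \<in> X. trunc_code N N x \<in> S}" using assms[OF elim] by blast
    show ?case by (rule exI[of _ S]) (use \<delta> in \<open>simp flip: S\<close>)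
  qed
qed

lemma approximable_cylinder: "approximable (cyl w)"
proof -
  \<comment> \<open>Prepending 0 keeps the maximum over a nonempty set. The letters of
    \<open>w\<close> must lie strictly below \<open>N\<close>, because \<open>N\<close> itself
    denotes the lump.\<close>
  define N0 where "N0 = Suc (Max (set (0 # w)) + length w)"
  have "\<exists>S. cyl w = {x \<in> X. trunc_code N N x \<in> S}" if N: "N \<ge> N0" for N
  proof -
    have lt: "w ! k < N" if "k < length w" for k
    proof -
      have "w ! k \<le> Max (set (0 # w))" using that by (intro Max_ge) auto
      then show ?thesis using N by (simp add: N0_def)
    qed
    have len: "length w < N" using N by (simp add: N0_def)
    have "x k = w ! k \<longleftrightarrow> trunc_code N N x ! k = w ! k" if "k < length w" for x k
      using lt[OF that] len that by (auto simp: trunc_code_def min_def)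
    then have "(\<forall>k<length w. x k = w ! k) \<longleftrightarrow> trunc_code N N x \<in> {s. \<forall>k<length w. s ! k = w ! k}" for x
      by blast
    then have "cyl w = {x \<in> X. trunc_code N N x \<in> {s. \<forall>k<length w. s ! k = w ! k}}"
      unfolding cylinder_def by simp
    then show ?thesis by blast
  qed
  then show ?thesis by (rule approximableI)
qed

text \<open>Approximability passes from cylinders to the generated \<sigma>-algebra: complementing
  the code set leaves the symmetric difference unchanged, and a countable union is first cut to a
  finite one.\<close>

lemma approximable_sets:
  assumes "B \<in> sets \<nu>"
  shows "approximable B"
  using assms unfolding sets_nu_cylinders
proof (induction rule: sigma_sets.induct)
  case (Basic B)
  then show ?case using approximable_cylinder by auto
next
  case Empty
  have "{} = {x \<in> X. trunc_code N N x \<in> {}}" for N by simp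
  then show ?case by (intro approximableI[of 0]) blast
next
  case (Compl B)
  have BX: "B \<subseteq> X" using Compl(1) sets.sets_into_space[of B \<nu>] by (simp add: sets_nu_cylinders space_nu)
  have *: "sym_diff (X - B) {x \<in> X. trunc_code N N x \<in> - S} =
      sym_diff B {x \<in> X. trunc_code N N x \<in> S}" for N S
    using BX by auto
  show ?case unfolding approximable_def
  proof (intro allI impI)
    fix \<delta> :: real assume "\<delta> > 0"
    with Compl(2) have "\<forall>\<^sub>F N in sequentially. \<exists>S.
        measure \<nu> (sym_diff B {x \<in> X. trunc_code N N x \<in> S}) < \<delta>"
      unfolding approximable_def by blast
    then show "\<forall>\<^sub>F N in sequentially. \<exists>S.
        measure \<nu> (sym_diff (X - B) {x \<in> X. trunc_code N N x \<in> S}) < \<delta>"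
    proof eventually_elim
      case (elim N)
      then obtain S where "measure \<nu> (sym_diff B {x \<in> X. trunc_code N N x \<in> S}) < \<delta>"
        by blast
      then show ?case by (intro exI[of _ "- S"]) (simp only: *)
    qed
  qed
next
  case (Union B)
  have BS: "B i \<in> sets \<nu>" for i using Union(1) by (simp add: sets_nu_cylinders)
  show ?case unfolding approximable_def
  proof (intro allI impI)
    fix \<delta> :: real assume \<delta>: "\<delta> > 0"
    have "(\<lambda>m. measure \<nu> (\<Union>i<m. B i)) \<longlonglongrightarrow> measure \<nu> (\<Union>m. \<Union>i<m. B i)"
      using BS by (intro finite_Lim_measure_incseq incseq_SucI UN_mono) auto
    moreover have "(\<Union>m. \<Union>i<m. B i) = (\<Union>i. B i)" by auto
    ultimately have "\<forall>\<^sub>F m in sequentially. measure \<nu> (\<Union>i<m. B i) > measure \<nu> (\<Union>i. B i) - \<delta> / 2"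
      using \<delta> by (intro order_tendstoD(1)) auto
    then obtain m where m: "measure \<nu> (\<Union>i<m. B i) > measure \<nu> (\<Union>i. B i) - \<delta> / 2"
      by (auto simp: eventually_sequentially)
    \<comment> \<open>Half of \<delta> pays for cutting the union; the other half is shared by the
      \<open>m\<close> sets that are kept, with \<open>Suc m\<close> avoiding a division by
      zero.\<close>
    have "\<forall>\<^sub>F N in sequentially. \<forall>i\<in>{..<m}. \<exists>S.
        measure \<nu> (sym_diff (B i) {x \<in> X. trunc_code N N x \<in> S}) < \<delta> / (2 * real (Suc m))"
      using Union(2) \<delta> unfolding approximable_def by (intro eventually_ball_finite) auto
    then show "\<forall>\<^sub>F N in sequentially. \<exists>S.
        measure \<nu> (sym_diff (\<Union>i. B i) {x \<in> X. trunc_code N N x \<in> S}) < \<delta>"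
    proof eventually_elim
      case (elim N)
      from bchoice[OF elim] obtain S where S: "\<And>i. i < m \<Longrightarrow>
          measure \<nu> (sym_diff (B i) {x \<in> X. trunc_code N N x \<in> S i}) < \<delta> / (2 * real (Suc m))"
        by (auto simp only: lessThan_iff)
      let ?C = "\<lambda>S. {x \<in> X. trunc_code N N x \<in> S}"
      have sd: "sym_diff (B i) (?C (S i)) \<in> sets \<nu>" for i using BS trunc_code_set by auto
      have "measure \<nu> (sym_diff (\<Union>i. B i) (?C (\<Union>i<m. S i)))
          \<le> measure \<nu> (((\<Union>i. B i) - (\<Union>i<m. B i)) \<union> (\<Union>i<m. sym_diff (B i) (?C (S i))))"
        using BS sd by (intro finite_measure_mono) auto
      also have "\<dots> \<le> measure \<nu> ((\<Union>i. B i) - (\<Union>i<m. B i)) + measure \<nu> (\<Union>i<m. sym_diff (B i) (?C (S i)))"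
        using BS sd by (intro measure_Un_le) auto
      also have "measure \<nu> ((\<Union>i. B i) - (\<Union>i<m. B i)) = measure \<nu> (\<Union>i. B i) - measure \<nu> (\<Union>i<m. B i)"
        using BS by (intro finite_measure_Diff) auto
      also have "measure \<nu> (\<Union>i<m. sym_diff (B i) (?C (S i))) \<le> (\<Sum>i<m. measure \<nu> (sym_diff (B i) (?C (S i))))"
        using sd by (intro finite_measure_subadditive_finite) auto
      also have "\<dots> \<le> (\<Sum>i<m. \<delta> / (2 * real (Suc m)))" using S by (intro sum_mono) (auto intro: less_imp_le)
      also have "\<dots> \<le> \<delta> / 2" using \<delta> by (simp add: field_simps)
      finally show ?case using m by (intro exI[of _ "\<Union>i<m. S i"]) linarith
    qed
  qed
qed

end

section \<open>Iterated partitions\<close>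

context
  fixes \<nu> :: "'a measure" and T :: "'a \<Rightarrow> 'a" and P :: "'a set set" and n :: nat
  assumes T: "T \<in> measurable \<nu> \<nu>" and P: "finite P" "partition_on (space \<nu>) P" "P \<subseteq> sets \<nu>" and n: "n > 0"
begin

lemma funpow_measurable: "(T ^^ k) \<in> measurable \<nu> \<nu>"
  using T by (induction k) (auto intro: measurable_comp)

text \<open>A common refinement chooses one cell from each member of a set of partitions, and in
  that set equal preimage partitions of different times coincide. Here the choice is indexed by time
  instead.\<close>

lemma iterated_partition_inter:
  assumes "B \<in> iterated_partition \<nu> T P n"
  obtains f where "\<And>k. k < n \<Longrightarrow> f k \<in> P" "B = (\<Inter>k<n. (T ^^ k) -` f k \<inter> space \<nu>)" "B \<noteq> {}"
proof -
  let ?I = "\<lambda>k. (\<lambda>B. (T ^^ k) -` B \<inter> space \<nu>) ` P"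
  obtain f where f: "f \<in> (\<Pi> Q\<in>?I ` {..<n}. Q)" "B = \<Inter> (f ` ?I ` {..<n})" "B \<noteq> {}"
    using assms unfolding iterated_partition_def common_refinement by blast
  have "\<exists>C\<in>P. f (?I k) = (T ^^ k) -` C \<inter> space \<nu>" if "k < n" for k
  proof -
    have "f (?I k) \<in> ?I k" using that by (intro Pi_mem[OF f(1)]) blast
    then show ?thesis by blast
  qed
  then obtain g where g: "\<And>k. k < n \<Longrightarrow> g k \<in> P \<and> f (?I k) = (T ^^ k) -` g k \<inter> space \<nu>" by metis
  then have "B = (\<Inter>k<n. (T ^^ k) -` g k \<inter> space \<nu>)" unfolding f(2) by auto
  with g f(3) that show thesis by blast
qed

lemma finite_iterated_partition: "finite (iterated_partition \<nu> T P n)"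
  unfolding iterated_partition_def using P(1) by (intro finite_common_refinement) auto

lemma iterated_partition_sets: "B \<in> iterated_partition \<nu> T P n \<Longrightarrow> B \<in> sets \<nu>"
proof (elim iterated_partition_inter)
  fix f assume f: "\<And>k. k < n \<Longrightarrow> f k \<in> P" "B = (\<Inter>k<n. (T ^^ k) -` f k \<inter> space \<nu>)"
  have "(T ^^ k) -` f k \<inter> space \<nu> \<in> sets \<nu>" if "k < n" for k
    using f(1)[OF that] P(3) funpow_measurable by (auto intro: measurable_sets)
  then show "B \<in> sets \<nu>" unfolding f(2) using n by (intro sets.finite_INT) auto
qed

lemma Union_iterated_partition: "\<Union> (iterated_partition \<nu> T P n) = space \<nu>"
proof -
  have "\<Union> ((\<lambda>B. (T ^^ k) -` B \<inter> space \<nu>) ` P) = space \<nu>" for k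
  proof -
    have "(T ^^ k) x \<in> \<Union> P" if "x \<in> space \<nu>" for x
      using P(2) measurable_space[OF funpow_measurable that, of k] by (simp add: partition_on_def)
    then show ?thesis by blast
  qed
  then show ?thesis using n by (simp add: iterated_partition_def Union_common_refinement lessThan_empty_iff)
qed

lemma iterated_partition_subset: "B \<in> iterated_partition \<nu> T P n \<Longrightarrow> x \<in> B \<Longrightarrow> x \<in> space \<nu>"
  using Union_iterated_partition by blast

text \<open>The cells of \<open>P\<close> are disjoint, so each time selects exactly one of them and
  a representative \<open>x\<close> carries the whole itinerary of its cell. Later arguments see the
  refinement only through itineraries.\<close>

lemma iterated_partition_itinerary:
  assumes B: "B \<in> iterated_partition \<nu> T P n" and x: "x \<in> B" and y: "y \<in> space \<nu>"
  shows "y \<in> B \<longleftrightarrow> (\<forall>k<n. \<forall>C\<in>P. (T ^^ k) x \<in> C \<longleftrightarrow> (T ^^ k) y \<in> C)"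
proof -
  obtain f where f: "\<And>k. k < n \<Longrightarrow> f k \<in> P" "B = (\<Inter>k<n. (T ^^ k) -` f k \<inter> space \<nu>)"
    using iterated_partition_inter[OF B] by metis
  have "B = {z \<in> space \<nu>. \<forall>k<n. (T ^^ k) z \<in> f k}" using f(2) n by auto
  note f = f(1) this
  have xf: "(T ^^ k) x \<in> f k" if "k < n" for k using x f(2) that by simp
  have uniq: "C = f k" if "k < n" "C \<in> P" "z \<in> C" "z \<in> f k" for C k z
    using that f(1)[OF that(1)] P(2) by (auto simp: partition_on_def disjoint_def)
  have "y \<in> B \<longleftrightarrow> (\<forall>k<n. (T ^^ k) y \<in> f k)" using y f(2) n by auto
  also have "\<dots> \<longleftrightarrow> (\<forall>k<n. \<forall>C\<in>P. (T ^^ k) x \<in> C \<longleftrightarrow> (T ^^ k) y \<in> C)"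
    using xf uniq f(1) by metis
  finally show ?thesis .
qed

lemma iterated_partition_on: "partition_on (space \<nu>) (iterated_partition \<nu> T P n)"
proof (rule partition_onI)
  fix B C assume BC: "B \<in> iterated_partition \<nu> T P n" "C \<in> iterated_partition \<nu> T P n" "B \<noteq> C"
  show "disjnt B C"
  proof (rule ccontr)
    assume "\<not> disjnt B C"
    then obtain x where "x \<in> B" "x \<in> C" by (auto simp: disjnt_def)
    then have "y \<in> B \<longleftrightarrow> y \<in> C" if "y \<in> space \<nu>" for y
      using iterated_partition_itinerary[OF BC(1) _ that] iterated_partition_itinerary[OF BC(2) _ that] by metis
    then have "B = C" using iterated_partition_subset BC by blast
    with BC show False by simp
  qed
qed (use Union_iterated_partition iterated_partition_inter in blast)+

end

section \<open>The entropy of an invariant measure is bounded by summable weights\<close>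

text \<open>Gibbs' inequality for a subprobability vector \<open>q\<close>, resting on
  \<open>ln t \<le> t - 1\<close>. The majorant \<open>h\<close> lets the cost of a cell be
  estimated separately at each of its points and integrated afterwards.\<close>

lemma (in prob_space) partition_entropy_le_integral:
  assumes Q: "finite Q" "partition_on (space M) Q" "Q \<subseteq> sets M"
    and q: "\<And>B. B \<in> Q \<Longrightarrow> q B > 0" "(\<Sum>B\<in>Q. q B) \<le> 1"
    and h: "integrable M h" "\<And>B x. B \<in> Q \<Longrightarrow> x \<in> B \<Longrightarrow> - ln (q B) \<le> h x"
  shows "partition_entropy M Q \<le> (\<integral>x. h x \<partial>M)"
proof -
  have sumQ: "(\<Sum>B\<in>Q. c B * indicator B x) = c C" if "C \<in> Q" "x \<in> C" for c :: "'a set \<Rightarrow> real" and C x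
  proof -
    have "c B * indicator B x = (if B = C then c C else 0)" if "B \<in> Q" for B
    proof -
      have "x \<in> B \<longleftrightarrow> B = C" using that \<open>C \<in> Q\<close> \<open>x \<in> C\<close> Q(2) by (auto simp: partition_on_def disjoint_def)
      then show ?thesis by (simp add: indicator_def)
    qed
    then show ?thesis using that Q(1) by (simp cong: sum.cong)
  qed
  have Qx: "\<exists>C\<in>Q. x \<in> C" if "x \<in> space M" for x
    using that Q(2) by (auto simp: partition_on_def)
  have int: "integrable M (\<lambda>x. \<Sum>B\<in>Q. c B * indicator B x)" for c :: "'a set \<Rightarrow> real"
    using Q(3) by (intro Bochner_Integration.integrable_sum integrable_mult_right integrable_real_indicator)
      (auto simp: emeasure_eq_measure)
  have intv: "(\<integral>x. (\<Sum>B\<in>Q. c B * indicator B x) \<partial>M) = (\<Sum>B\<in>Q. c B * measure M B)" for c :: "'a set \<Rightarrow> real"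
    using Q(3) by (subst Bochner_Integration.integral_sum)
      (auto intro!: integrable_mult_right integrable_real_indicator sum.cong simp: emeasure_eq_measure Int_absorb2 sets.sets_into_space subset_eq)
  have one: "(\<Sum>B\<in>Q. measure M B) = 1"
  proof -
    have "(\<Sum>B\<in>Q. measure M B) = (\<integral>x. (\<Sum>B\<in>Q. 1 * indicator B x) \<partial>M)" by (simp only: intv) simp
    also have "\<dots> = (\<integral>x. 1 \<partial>M)"
      using Qx sumQ[of _ _ "\<lambda>_. 1"] by (intro Bochner_Integration.integral_cong refl) metis
    finally show ?thesis by (simp add: prob_space)
  qed
  \<comment> \<open>The slack \<open>q B - measure M B\<close> sums to at most 0 over the cells; on
    a null cell the inequality reduces to \<open>0 \<le> q B\<close>.\<close>
  have "- (measure M B * ln (measure M B)) \<le> - measure M B * ln (q B) + (q B - measure M B)"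
    if "B \<in> Q" for B
  proof (cases "measure M B = 0")
    case False
    then have p: "measure M B > 0" by (simp add: zero_less_measure_iff)
    have "ln (q B / measure M B) \<le> q B / measure M B - 1" using p q(1)[OF that] by (intro ln_le_minus_one) simp
    then have "measure M B * ln (q B / measure M B) \<le> measure M B * (q B / measure M B - 1)"
      using p by (intro mult_left_mono) auto
    also have "\<dots> = q B - measure M B" using p by (simp add: field_simps)
    finally show ?thesis using p q(1)[OF that] by (simp add: ln_div algebra_simps)
  qed (use q(1)[OF that] in simp)
  then have "partition_entropy M Q \<le> (\<Sum>B\<in>Q. - measure M B * ln (q B) + (q B - measure M B))"
    unfolding partition_entropy_def sum_negf[symmetric] by (rule sum_mono)
  also have "\<dots> \<le> (\<Sum>B\<in>Q. - ln (q B) * measure M B)"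
    using q(2) one by (simp add: sum.distrib sum_subtractf sum_negf algebra_simps)
  also have "\<dots> = (\<integral>x. (\<Sum>B\<in>Q. - ln (q B) * indicator B x) \<partial>M)" by (rule intv[symmetric])
  also have "\<dots> \<le> (\<integral>x. h x \<partial>M)"
  proof (rule integral_mono[OF int h(1)])
    fix x assume "x \<in> space M"
    then obtain C where C: "C \<in> Q" "x \<in> C" using Qx by blast
    then show "(\<Sum>B\<in>Q. - ln (q B) * indicator B x) \<le> h x"
      using sumQ[OF C, of "\<lambda>B. - ln (q B)"] h(2)[OF C] by simp
  qed
  finally show ?thesis .
qed

section \<open>Cores: the stretch between the first and the last letter below the truncation
  level\<close>

definition low :: "nat \<Rightarrow> nat \<Rightarrow> (nat \<Rightarrow> nat) \<Rightarrow> nat set" where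
  "low N L x = {k. k < L \<and> x k < N}"

text \<open>
  Words are compared through their cores only: the letters outside the core are at least \<open>N\<close>,
  and what they contribute to a Birkhoff sum is charged to the integrable function \<open>tail N\<close>.
\<close>

definition core :: "nat \<Rightarrow> nat \<Rightarrow> (nat \<Rightarrow> nat) \<Rightarrow> nat list" where
  "core N L x = map x [Min (low N L x)..<Suc (Max (low N L x))]"

lemma finite_low [simp]: "finite (low N L x)"
  by (simp add: low_def)

lemma low_Min_Max:
  assumes "low N L x \<noteq> {}"
  shows "Min (low N L x) \<le> Max (low N L x)" "Max (low N L x) < L"
    "x (Min (low N L x)) < N" "x (Max (low N L x)) < N"
  using Min_in[OF finite_low assms] Max_in[OF finite_low assms] assms by (auto simp: low_def[of N L x])

lemma hd_last_core:
  assumes "low N L x \<noteq> {}"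
  shows "hd (core N L x) = x (Min (low N L x))" "last (core N L x) = x (Max (low N L x))" "core N L x \<noteq> []"
  using low_Min_Max[OF assms] by (auto simp: core_def hd_map last_map simp del: upt_Suc)

text \<open>Outside the span of the core every letter is truncated to \<open>N\<close>, and inside
  it the core records the letters themselves. A code thus costs one word and two positions.\<close>

lemma core_determines:
  assumes "low N L x \<noteq> {}" "low N L y \<noteq> {}"
    and "Min (low N L x) = Min (low N L y)" "Max (low N L x) = Max (low N L y)" "core N L x = core N L y"
  shows "trunc_code N L x = trunc_code N L y"
proof -
  have "min (x k) N = min (y k) N" if k: "k < L" for k
  proof (cases "k \<in> {Min (low N L x)..Max (low N L x)}")
    case True
    have "map x [Min (low N L x)..<Suc (Max (low N L x))] = map y [Min (low N L x)..<Suc (Max (low N L x))]"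
      using assms(3-5) unfolding core_def by simp
    then have "x k = y k" using True by (auto simp: map_eq_conv simp del: upt_Suc)
    then show ?thesis by simp
  next
    case False
    then have "k \<notin> low N L x" "k \<notin> low N L y"
      using assms(3,4) Min_le[OF finite_low, of k] Max_ge[OF finite_low, of k] by (metis atLeastAtMost_iff)+
    then show ?thesis using k by (auto simp: low_def)
  qed
  then show ?thesis by (simp add: trunc_code_def)
qed

text \<open>\<open>W_sum\<close> restricts both end letters to values below \<open>N\<close>:
  summability is known for words joining two given letters, and only finitely many pairs lie below
  \<open>N\<close>. Cores have such end letters. The intended instance has \<phi> - b \<psi> as
  \<open>f\<close> and \<open>weight b\<close> as \<open>W\<close>.\<close>

locale weighted_measure = shift_measure +
  fixes f :: "(nat \<Rightarrow> nat) \<Rightarrow> real" and W :: "nat list \<Rightarrow> real" and c :: real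
  assumes f_int: "integrable \<nu> f"
    and W_pos: "W w > 0"
    and W_sum: "\<exists>M. \<forall>F. finite F \<longrightarrow> F \<subseteq> {w \<in> words I A. hd w < N \<and> last w < N} \<longrightarrow> (\<Sum>w\<in>F. W w) \<le> M"
    and W_ge: "x \<in> shift_space I A \<Longrightarrow> n > 0 \<Longrightarrow> birkhoff_sum f n x \<le> ln (W (map x [0..<n])) + c"
    and c_nonneg: "c \<ge> 0"
begin

text \<open>Only one truncated code of length \<open>L\<close> has no letter below \<open>N\<close>,
  so the value 1 adds a single unit to a sum over distinct codes.\<close>

definition core_weight :: "nat \<Rightarrow> nat \<Rightarrow> (nat \<Rightarrow> nat) \<Rightarrow> real" where
  "core_weight N L x = (if low N L x = {} then 1 else W (core N L x))"

definition tail :: "nat \<Rightarrow> (nat \<Rightarrow> nat) \<Rightarrow> real" where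
  "tail N x = (if x 0 < N then 0 else \<bar>f x\<bar>)"

lemma core_weight_pos: "core_weight N L x > 0"
  by (simp add: core_weight_def W_pos)

text \<open>The Birkhoff sum splits at the core. The inner part is bounded through
  \<open>W_ge\<close>; every outer position carries a letter that is at least \<open>N\<close>,
  where \<open>tail N\<close> majorizes \<open>f\<close>.\<close>

lemma birkhoff_sum_le_core_weight:
  assumes x: "x \<in> X"
  shows "birkhoff_sum f L x \<le> ln (core_weight N L x) + c + birkhoff_sum (tail N) L x"
proof -
  have t: "f ((shift ^^ k) x) \<le> tail N ((shift ^^ k) x)" if "x k \<ge> N" for k
    using that by (simp add: tail_def) (simp add: funpow_shift)
  have t0: "tail N y \<ge> 0" for y by (simp add: tail_def)
  show ?thesis
  proof (cases "low N L x = {}")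
    case True
    have "birkhoff_sum f L x \<le> birkhoff_sum (tail N) L x"
      unfolding birkhoff_sum_def using True by (intro sum_mono t) (auto simp: low_def)
    then show ?thesis using True c_nonneg by (simp add: core_weight_def)
  next
    case False
    define i j where "i = Min (low N L x)" "j = Max (low N L x)"
    have ij: "i \<le> j" "j < L" using low_Min_Max[OF False] by (auto simp: i_j_def)
    have "birkhoff_sum f L x = (\<Sum>k\<in>{i..j}. f ((shift ^^ k) x)) + (\<Sum>k\<in>{..<L} - {i..j}. f ((shift ^^ k) x))"
      unfolding birkhoff_sum_def using ij by (subst sum.subset_diff[of "{i..j}"]) auto
    also have "(\<Sum>k\<in>{i..j}. f ((shift ^^ k) x)) = birkhoff_sum f (Suc j - i) ((shift ^^ i) x)"
    proof -
      have "(\<Sum>k\<in>{i..j}. f ((shift ^^ k) x)) = (\<Sum>k<Suc j - i. f ((shift ^^ (k + i)) x))"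
        using ij by (intro sum.reindex_bij_witness[of _ "\<lambda>k. k + i" "\<lambda>k. k - i"]) auto
      then show ?thesis by (simp add: birkhoff_sum_def funpow_add)
    qed
    also have "\<dots> \<le> ln (W (map ((shift ^^ i) x) [0..<Suc j - i])) + c"
      using ij x by (intro W_ge funpow_shift_shift_space) auto
    also have "map ((shift ^^ i) x) [0..<Suc j - i] = core N L x"
    proof -
      have "[i..<Suc j] = map (\<lambda>k. k + i) [0..<Suc j - i]" using ij by (simp only: map_add_upt) simp
      then show ?thesis by (simp add: core_def funpow_shift flip: i_j_def) 
    qed
    also have "W (core N L x) = core_weight N L x" using False by (simp add: core_weight_def)
    also have "(\<Sum>k\<in>{..<L} - {i..j}. f ((shift ^^ k) x)) \<le> (\<Sum>k\<in>{..<L} - {i..j}. tail N ((shift ^^ k) x))"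
    proof (intro sum_mono t)
      fix k assume k: "k \<in> {..<L} - {i..j}"
      then have "k \<notin> low N L x" using Min_le[OF finite_low, of k] Max_ge[OF finite_low, of k]
        by (auto simp: i_j_def)
      then show "N \<le> x k" using k by (auto simp: low_def)
    qed
    also have "\<dots> \<le> (\<Sum>k<L. tail N ((shift ^^ k) x))" using t0 by (intro sum_mono2) auto
    finally show ?thesis by (simp add: birkhoff_sum_def)
  qed
qed

text \<open>The core has at most \<open>L ^ 2\<close> possible pairs of end positions. For each pair
  the cores are distinct words, so their weights have a total that does not depend on
  \<open>L\<close>. A polynomial factor is harmless on the exponential scale.\<close>

lemma core_weight_sum:
  "\<exists>M>0. \<forall>L Z. finite Z \<longrightarrow> Z \<subseteq> X \<longrightarrow> inj_on (trunc_code N L) Z \<longrightarrow>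
     (sum (core_weight N L) Z) \<le> 1 + real (L ^ 2) * M"
proof -
  obtain M where M: "\<And>F. finite F \<Longrightarrow> F \<subseteq> {w \<in> words I A. hd w < N \<and> last w < N} \<Longrightarrow> (\<Sum>w\<in>F. W w) \<le> M"
    using W_sum by blast
  have M0: "M \<ge> 0" using M[of "{}"] by simp
  have "sum (core_weight N L) Z \<le> 1 + real (L ^ 2) * (M + 1)"
    if Z: "finite Z" "Z \<subseteq> X" "inj_on (trunc_code N L) Z" for L Z
  proof -
    let ?Z0 = "{x \<in> Z. low N L x = {}}" and ?Z1 = "{x \<in> Z. low N L x \<noteq> {}}"
    let ?p = "\<lambda>x. (Min (low N L x), Max (low N L x))"
    have "sum (core_weight N L) Z = sum (core_weight N L) ?Z0 + sum (core_weight N L) ?Z1"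
    proof -
      have "Z = ?Z0 \<union> ?Z1" by blast
      then have "sum (core_weight N L) Z = (\<Sum>x\<in>?Z0 \<union> ?Z1. core_weight N L x)" by simp
      also have "\<dots> = sum (core_weight N L) ?Z0 + sum (core_weight N L) ?Z1"
        using Z(1) by (intro sum.union_disjoint) auto
      finally show ?thesis .
    qed
    moreover have "sum (core_weight N L) ?Z0 \<le> 1"
    proof -
      have "trunc_code N L x = replicate L N" if "low N L x = {}" for x
        using that by (auto simp: trunc_code_def low_def min_def intro!: nth_equalityI)
      then have "x = y" if "x \<in> ?Z0" "y \<in> ?Z0" for x y
        using that Z(3) by (auto simp: inj_on_def)
      then have "card ?Z0 \<le> Suc 0" using Z(1) by (subst card_le_Suc0_iff_eq) auto
      then show ?thesis by (simp add: core_weight_def)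
    qed
    moreover have "sum (core_weight N L) ?Z1 \<le> real (L ^ 2) * (M + 1)"
    proof -
      have "sum (core_weight N L) ?Z1 = (\<Sum>p\<in>{..<L} \<times> {..<L}. \<Sum>x\<in>{x \<in> ?Z1. ?p x = p}. core_weight N L x)"
      proof (rule sum.group[symmetric])
        show "?p ` ?Z1 \<subseteq> {..<L} \<times> {..<L}"
        proof
          fix p assume "p \<in> ?p ` ?Z1"
          then obtain x where "p = ?p x" "low N L x \<noteq> {}" by blast
          then show "p \<in> {..<L} \<times> {..<L}" using low_Min_Max(1,2)[of N L x] by auto
        qed
      qed (use Z in auto)
      also have "\<dots> \<le> (\<Sum>p\<in>{..<L} \<times> {..<L}. M)"
      proof (rule sum_mono)
        fix p
        let ?Y = "{x \<in> ?Z1. ?p x = p}"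
        have inj: "inj_on (core N L) ?Y"
        proof (rule inj_onI)
          fix x y assume xy: "x \<in> ?Y" "y \<in> ?Y" "core N L x = core N L y"
          have "trunc_code N L x = trunc_code N L y" using xy by (intro core_determines) auto
          then show "x = y" using xy Z(3) by (auto simp: inj_on_def)
        qed
        have "sum (core_weight N L) ?Y = (\<Sum>w\<in>core N L ` ?Y. W w)"
          by (subst sum.reindex[OF inj]) (auto simp: core_weight_def intro!: sum.cong)
        also have "\<dots> \<le> M"
        proof (rule M)
          show "core N L ` ?Y \<subseteq> {w \<in> words I A. hd w < N \<and> last w < N}"
          proof
            fix w assume "w \<in> core N L ` ?Y"
            then obtain x where x: "x \<in> X" "low N L x \<noteq> {}" "w = core N L x" using Z by blast
            have "core N L x \<in> words I A"
              using prefix_in_words[OF x(1), of "Suc (Max (low N L x)) - Min (low N L x)" "Min (low N L x)"]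
                low_Min_Max[OF x(2)] by (simp add: core_def del: upt_Suc)
            then show "w \<in> {w \<in> words I A. hd w < N \<and> last w < N}"
              using x hd_last_core[OF x(2)] low_Min_Max[OF x(2)] by simp
          qed
        qed (use Z in simp)
        finally show "sum (core_weight N L) ?Y \<le> M" .
      qed
      also have "\<dots> = real (L ^ 2) * M" by (simp add: power2_eq_square)
      also have "\<dots> \<le> real (L ^ 2) * (M + 1)" by (intro mult_left_mono) auto
      finally show ?thesis .
    qed
    ultimately show ?thesis by linarith
  qed
  then show ?thesis using M0 by (intro exI[of _ "M + 1"]) auto
qed

lemma tail_integrable: "integrable \<nu> (tail N)"
proof -
  have "{x \<in> X. trunc_code N 1 x \<in> {[N]}} \<in> sets \<nu>" by (rule trunc_code_set)
  then have "integrable \<nu> (\<lambda>x. \<bar>f x\<bar> * indicator {x \<in> X. trunc_code N 1 x \<in> {[N]}} x)"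
    using f_int by (intro integrable_real_mult_indicator integrable_abs)
  then show ?thesis
    by (rule Bochner_Integration.integrable_cong[THEN iffD1, rotated 2])
      (auto simp: tail_def space_nu trunc_code_def indicator_def min_def)
qed

lemma tail_tendsto: "(\<lambda>N. \<integral>x. tail N x \<partial>\<nu>) \<longlonglongrightarrow> 0"
proof -
  have "(\<lambda>N. \<integral>x. tail N x \<partial>\<nu>) \<longlonglongrightarrow> (\<integral>x. 0 \<partial>\<nu>)"
  proof (rule integral_dominated_convergence[where w = "\<lambda>x. \<bar>f x\<bar>"])
    show "AE x in \<nu>. (\<lambda>N. tail N x) \<longlonglongrightarrow> 0"
    proof (rule AE_I2)
      fix x
      have "\<forall>\<^sub>F N in sequentially. tail N x = 0"
        using eventually_gt_at_top[of "x 0"] by eventually_elim (simp add: tail_def)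
      then show "(\<lambda>N. tail N x) \<longlonglongrightarrow> 0" by (simp add: tendsto_eventually)
    qed
    show "AE x in \<nu>. norm (tail N x) \<le> \<bar>f x\<bar>" for N by (simp add: tail_def)
  qed (use f_int tail_integrable in auto)
  then show ?thesis by simp
qed

end

text \<open>Infinitely many points may share a truncated code, and the supremum of their weights
  need not be attained; the factor 2 buys an actual representative.\<close>

lemma almost_maximum:
  fixes h :: "'a \<Rightarrow> real"
  assumes "Y \<noteq> {}" "\<And>y. y \<in> Y \<Longrightarrow> h y > 0" "\<And>y. y \<in> Y \<Longrightarrow> h y \<le> B"
  shows "\<exists>y\<in>Y. \<forall>x\<in>Y. h x \<le> 2 * h y"
proof -
  have bdd: "bdd_above (h ` Y)" using assms(3) by (auto simp: bdd_above_def)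
  obtain y0 where "y0 \<in> Y" using assms(1) by blast
  then have "0 < (SUP y\<in>Y. h y)" using assms(2) cSUP_upper[OF _ bdd] by (metis less_le_trans)
  then have "(SUP y\<in>Y. h y) / 2 < (SUP y\<in>Y. h y)" by simp
  then obtain y where y: "y \<in> Y" "(SUP y\<in>Y. h y) / 2 < h y"
    using less_cSUP_iff[OF assms(1) bdd] by blast
  have "h x \<le> 2 * h y" if "x \<in> Y" for x
    using cSUP_upper[OF that bdd] y(2) by linarith
  with y(1) show ?thesis by blast
qed

text \<open>Products of subprobability vectors form a subprobability vector on all itineraries,
  among which \<open>l\<close> embeds the cells of \<open>Q\<close>.\<close>

lemma sum_prod_over_functions:
  fixes u :: "nat \<Rightarrow> 'b \<Rightarrow> real"
  assumes P: "finite P" and l: "inj_on l Q" "l ` Q \<subseteq> ({..<n} \<rightarrow>\<^sub>E P)"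
    and u: "\<And>k C. k < n \<Longrightarrow> C \<in> P \<Longrightarrow> u k C \<ge> 0" "\<And>k. k < n \<Longrightarrow> (\<Sum>C\<in>P. u k C) \<le> 1"
  shows "(\<Sum>B\<in>Q. \<Prod>k<n. u k (l B k)) \<le> 1"
proof -
  have "(\<Sum>B\<in>Q. \<Prod>k<n. u k (l B k)) = (\<Sum>h\<in>l ` Q. \<Prod>k<n. u k (h k))"
    by (subst sum.reindex[OF l(1)]) simp
  also have "\<dots> \<le> (\<Sum>h\<in>{..<n} \<rightarrow>\<^sub>E P. \<Prod>k<n. u k (h k))"
    using P l(2) u(1) by (intro sum_mono2 prod_nonneg finite_PiE) (auto simp: PiE_iff)
  also have "\<dots> = (\<Prod>k<n. \<Sum>C\<in>P. u k C)" using P by (subst prod_sum_PiE) auto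
  also have "\<dots> \<le> 1" using u by (intro prod_le_1) (auto intro: sum_nonneg)
  finally show ?thesis .
qed

section \<open>Gibbs' inequality against a noisy reading of the truncated code\<close>

context weighted_measure
begin

text \<open>Minus the logarithm of the probability given to the true cell when a guess is trusted
  with probability \<open>1 - \<epsilon>\<close> and the remaining \<epsilon> is spread over
  \<open>r\<close> cells, up to a discarded share; \<open>S\<close> is the event that the guess is
  right.\<close>

definition match_cost :: "real \<Rightarrow> real \<Rightarrow> (nat \<Rightarrow> nat) set \<Rightarrow> (nat \<Rightarrow> nat) \<Rightarrow> real" where
  "match_cost \<epsilon> r S x = - ln (if x \<in> S then 1 - \<epsilon> else \<epsilon> / r)"

lemma match_cost_integral:
  assumes \<epsilon>: "0 < \<epsilon>" "\<epsilon> < 1" and r: "r \<ge> 1" and S: "S \<in> sets \<nu>"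
  shows "integrable \<nu> (match_cost \<epsilon> r S)"
    and "(\<integral>x. match_cost \<epsilon> r S x \<partial>\<nu>) \<le> - ln (1 - \<epsilon>) - ln (\<epsilon> / r) * measure \<nu> (space \<nu> - S)"
proof -
  have eq: "match_cost \<epsilon> r S x = - ln (1 - \<epsilon>) * indicator S x - ln (\<epsilon> / r) * indicator (space \<nu> - S) x"
    if "x \<in> space \<nu>" for x
    using that by (simp add: match_cost_def indicator_def)
  have i: "integrable \<nu> (\<lambda>x. - ln (1 - \<epsilon>) * indicator S x)" "integrable \<nu> (\<lambda>x. ln (\<epsilon> / r) * indicator (space \<nu> - S) x)"
    using S by (intro integrable_mult_right integrable_real_indicator; auto simp: emeasure_eq_measure)+
  then have "integrable \<nu> (\<lambda>x. - ln (1 - \<epsilon>) * indicator S x - ln (\<epsilon> / r) * indicator (space \<nu> - S) x)"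
    by (rule Bochner_Integration.integrable_diff)
  then show "integrable \<nu> (match_cost \<epsilon> r S)"
    by (subst Bochner_Integration.integrable_cong[OF refl eq])
  have "(\<integral>x. match_cost \<epsilon> r S x \<partial>\<nu>) =
      (\<integral>x. - ln (1 - \<epsilon>) * indicator S x - ln (\<epsilon> / r) * indicator (space \<nu> - S) x \<partial>\<nu>)"
    by (rule Bochner_Integration.integral_cong[OF refl eq])
  also have "\<dots> = - ln (1 - \<epsilon>) * measure \<nu> S - ln (\<epsilon> / r) * measure \<nu> (space \<nu> - S)"
    using S by (subst Bochner_Integration.integral_diff[OF i]) (simp_all add: Int_absorb2 sets.sets_into_space)
  also have "- ln (1 - \<epsilon>) * measure \<nu> S \<le> - ln (1 - \<epsilon>) * 1"
    using \<epsilon> by (intro mult_left_mono) auto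
  finally show "(\<integral>x. match_cost \<epsilon> r S x \<partial>\<nu>) \<le> - ln (1 - \<epsilon>) - ln (\<epsilon> / r) * measure \<nu> (space \<nu> - S)"
    by simp
qed

text \<open>The reference distribution for Gibbs' inequality is a random itinerary: draw a code of
  length \<open>n + N\<close> with probability proportional to an almost maximal core weight, guess
  the cell at each time from the \<open>N\<close> symbols starting there, and perturb each guess by
  the noise \<epsilon>. The cost of an itinerary is then the cost of its code plus the costs of the
  guesses.\<close>

lemma iterated_entropy_bound:
  assumes P: "finite P" "partition_on (space \<nu>) P" "P \<subseteq> sets \<nu>"
    and \<epsilon>: "0 < \<epsilon>" "\<epsilon> < 1" and g: "\<And>s. g s \<in> P"
    and S_def: "S = {x \<in> space \<nu>. x \<in> g (trunc_code N N x)}" and S: "S \<in> sets \<nu>"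
  shows "\<exists>M>0. \<forall>n>0. partition_entropy \<nu> (iterated_partition \<nu> shift P n) \<le>
    ln (2 * (1 + real ((n + N) ^ 2) * M)) + c + real (n + N) * ((\<integral>x. tail N x \<partial>\<nu>) - (\<integral>x. f x \<partial>\<nu>))
      + real n * (\<integral>x. match_cost \<epsilon> (real (card P)) S x \<partial>\<nu>)"
proof -
  obtain M where M: "M > 0" "\<And>L Z. finite Z \<Longrightarrow> Z \<subseteq> X \<Longrightarrow> inj_on (trunc_code N L) Z \<Longrightarrow>
     (sum (core_weight N L) Z) \<le> 1 + real (L ^ 2) * M"
    using core_weight_sum[of N] by metis
  define r where "r = real (card P)"
  have "P \<noteq> {}" using g by blast
  then have "card P > 0" using P(1) by (simp add: card_gt_0_iff)
  then have r: "r \<ge> 1" by (simp add: r_def)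
  have "partition_entropy \<nu> (iterated_partition \<nu> shift P n) \<le>
    ln (2 * (1 + real ((n + N) ^ 2) * M)) + c + real (n + N) * ((\<integral>x. tail N x \<partial>\<nu>) - (\<integral>x. f x \<partial>\<nu>))
      + real n * (\<integral>x. match_cost \<epsilon> r S x \<partial>\<nu>)" if n: "n > 0" for n
  proof -
    \<comment> \<open>Each of the \<open>n\<close> guesses looks at \<open>N\<close> symbols,
      including the one at the last time.\<close>
    define L where "L = n + N"
    define Q where "Q = iterated_partition \<nu> shift P n"
    note Qfacts = finite_iterated_partition[OF shift_measurable P n, folded Q_def]
      iterated_partition_on[OF shift_measurable P n, folded Q_def]
      iterated_partition_sets[OF shift_measurable P n, folded Q_def]
    note itin = iterated_partition_itinerary[OF shift_measurable P n, folded Q_def]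
    define cs where "cs = trunc_code N L ` X"
    have "cs \<subseteq> {s. set s \<subseteq> {..N} \<and> length s = L}" by (auto simp: cs_def trunc_code_def)
    then have fin: "finite cs" by (rule finite_subset) (simp add: finite_lists_length_eq)
    have cw_le: "core_weight N L x \<le> 1 + real (L ^ 2) * M" if "x \<in> X" for x
      using M(2)[of "{x}" L] that by simp
    have "\<exists>z\<in>{x \<in> X. trunc_code N L x = s}. \<forall>x\<in>{x \<in> X. trunc_code N L x = s}.
        core_weight N L x \<le> 2 * core_weight N L z" if "s \<in> cs" for s
      using that by (intro almost_maximum[where B = "1 + real (L ^ 2) * M"]) (auto simp: cs_def core_weight_pos cw_le simp del: of_nat_power)
    then obtain z where z: "\<And>s. s \<in> cs \<Longrightarrow> z s \<in> X" "\<And>s. s \<in> cs \<Longrightarrow> trunc_code N L (z s) = s"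
      "\<And>s x. s \<in> cs \<Longrightarrow> x \<in> X \<Longrightarrow> trunc_code N L x = s \<Longrightarrow> core_weight N L x \<le> 2 * core_weight N L (z s)"
      by (simp add: bex_simps) metis
    \<comment> \<open>This dominates the weight of every point with code \<open>s\<close>, while the
      total \<open>Ct\<close> stays bounded because the representatives \<open>z s\<close> have
      distinct codes.\<close>
    define q0 where "q0 = (\<lambda>s. 2 * core_weight N L (z s))"
    have q0_pos: "q0 s > 0" for s by (simp add: q0_def core_weight_pos)
    define Ct where "Ct = (\<Sum>s\<in>cs. q0 s)"
    have "cs \<noteq> {}" using not_empty by (simp add: cs_def space_nu)
    then have Ct_pos: "Ct > 0" unfolding Ct_def using fin q0_pos by (intro sum_pos) auto
    have "inj_on z cs" using z(2) by (metis inj_onI)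
    then have "(\<Sum>s\<in>cs. core_weight N L (z s)) = (\<Sum>x\<in>z ` cs. core_weight N L x)"
      by (subst sum.reindex) auto
    also have "\<dots> \<le> 1 + real (L ^ 2) * M"
      using z fin by (intro M(2)) (auto simp: inj_on_def)
    finally have Ct_le: "Ct \<le> 2 * (1 + real (L ^ 2) * M)"
      by (simp add: Ct_def q0_def flip: sum_distrib_left)

    obtain p where p: "\<And>B. B \<in> Q \<Longrightarrow> p B \<in> B"
      using Qfacts(2) unfolding partition_on_def by (metis all_not_in_conv)
    have pX: "p B \<in> space \<nu>" if "B \<in> Q" for B
      using p[OF that] Qfacts(3)[OF that] sets.sets_into_space by blast
    define lab where "lab = (\<lambda>x. THE C. C \<in> P \<and> x \<in> C)"
    have lab: "x \<in> C \<longleftrightarrow> lab x = C" if "C \<in> P" "x \<in> space \<nu>" for x C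
    proof -
      have ex1: "\<exists>!C. C \<in> P \<and> x \<in> C" using that P(2) by (auto simp: partition_on_def disjoint_def)
      from theI'[OF this] have "lab x \<in> P \<and> x \<in> lab x" by (simp add: lab_def)
      then show ?thesis using ex1 that by blast
    qed
    have labP: "lab x \<in> P" if "x \<in> space \<nu>" for x
      using that P(2) lab unfolding partition_on_def by blast
    have sX: "(shift ^^ k) x \<in> space \<nu>" if "x \<in> space \<nu>" for k x
      using that by (simp add: space_nu funpow_shift_shift_space)
    define l where "l = (\<lambda>B. \<lambda>k\<in>{..<n}. lab ((shift ^^ k) (p B)))"
    define u where "u = (\<lambda>s k C. if C = g (take N (drop k s)) then 1 - \<epsilon> else \<epsilon> / r)"
    define t where "t = (\<lambda>B s. \<Prod>k<n. u s k (l B k))"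
    have t_pos: "t B s > 0" for B s using \<epsilon> r by (auto simp: t_def u_def intro!: prod_pos)
    have t_sum: "(\<Sum>B\<in>Q. t B s) \<le> 1" for s
      unfolding t_def
    proof (rule sum_prod_over_functions[OF P(1)])
      show "inj_on l Q"
      proof (rule inj_onI)
        fix B C assume BC: "B \<in> Q" "C \<in> Q" "l B = l C"
        have "lab ((shift ^^ k) (p B)) = lab ((shift ^^ k) (p C))" if "k < n" for k
          using fun_cong[OF BC(3), of k] that by (simp add: l_def)
        then have "p C \<in> B"
          using itin[OF BC(1) p[OF BC(1)] pX[OF BC(2)]] lab sX pX BC by simp
        then have "B \<inter> C \<noteq> {}" using p BC by blast
        then show "B = C" using BC Qfacts(2) by (auto simp: partition_on_def disjoint_def)
      qed
      show "l ` Q \<subseteq> {..<n} \<rightarrow>\<^sub>E P" using labP sX pX by (auto simp: l_def)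
      show "u s k C \<ge> 0" for k C using \<epsilon> r by (simp add: u_def)
      show "(\<Sum>C\<in>P. u s k C) \<le> 1" for k
      proof -
        have "(\<Sum>C\<in>P. u s k C) \<le> (\<Sum>C\<in>P. (if C = g (take N (drop k s)) then 1 - \<epsilon> else 0) + \<epsilon> / r)"
          using \<epsilon> r by (intro sum_mono) (simp add: u_def)
        also have "\<dots> = (1 - \<epsilon>) + r * (\<epsilon> / r)"
          using P(1) g by (simp add: sum.distrib r_def)
        also have "\<dots> = 1" using r by simp
        finally show ?thesis .
      qed
    qed
    \<comment> \<open>A mixture over codes of the laws of the noisy itineraries.\<close>
    define q where "q = (\<lambda>B. (\<Sum>s\<in>cs. q0 s * t B s) / Ct)"
    define h where "h = (\<lambda>x. ln Ct + c - birkhoff_sum f L x + birkhoff_sum (tail N) L x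
       + birkhoff_sum (match_cost \<epsilon> r S) n x)"
    have "partition_entropy \<nu> Q \<le> (\<integral>x. h x \<partial>\<nu>)"
    proof (rule partition_entropy_le_integral[where q = q])
      show "q B > 0" for B
        unfolding q_def using Ct_pos fin \<open>cs \<noteq> {}\<close> q0_pos t_pos
        by (intro divide_pos_pos sum_pos mult_pos_pos) auto
      have "(\<Sum>B\<in>Q. q B) = (\<Sum>s\<in>cs. q0 s * (\<Sum>B\<in>Q. t B s)) / Ct"
        unfolding q_def sum_divide_distrib[symmetric] sum_distrib_left by (subst sum.swap) simp
      also have "\<dots> \<le> (\<Sum>s\<in>cs. q0 s * 1) / Ct"
        using Ct_pos q0_pos t_sum by (intro divide_right_mono sum_mono mult_left_mono) (auto intro: less_imp_le)
      finally show "(\<Sum>B\<in>Q. q B) \<le> 1" using Ct_pos by (simp add: Ct_def)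
      show "integrable \<nu> h"
        unfolding h_def using birkhoff_sum_integral(1)[OF f_int] birkhoff_sum_integral(1)[OF tail_integrable]
          birkhoff_sum_integral(1)[OF match_cost_integral(1)[OF \<epsilon> r S]]
        by (intro Bochner_Integration.integrable_add Bochner_Integration.integrable_diff) auto
      fix B x assume B: "B \<in> Q" "x \<in> B"
      then have x: "x \<in> space \<nu>" using Qfacts(3) sets.sets_into_space by blast
      define s where "s = trunc_code N L x"
      have s: "s \<in> cs" using x by (simp add: s_def cs_def space_nu)
      have "t B s = exp (- birkhoff_sum (match_cost \<epsilon> r S) n x)"
      proof -
        have "u s k (l B k) = exp (- match_cost \<epsilon> r S ((shift ^^ k) x))" if k: "k < n" for k
        proof -
          have tk: "take N (drop k s) = trunc_code N N ((shift ^^ k) x)"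
            using k by (auto simp: s_def trunc_code_def L_def funpow_shift drop_map take_map take_upt add.commute intro!: nth_equalityI)
          have "l B k = g (trunc_code N N ((shift ^^ k) x)) \<longleftrightarrow> (shift ^^ k) (p B) \<in> g (trunc_code N N ((shift ^^ k) x))"
            using lab[OF g sX[OF pX[OF B(1)]]] k by (simp add: l_def)
          also have "\<dots> \<longleftrightarrow> (shift ^^ k) x \<in> g (trunc_code N N ((shift ^^ k) x))"
            using itin[OF B(1) p[OF B(1)] x] B(2) k g by blast
          also have "\<dots> \<longleftrightarrow> (shift ^^ k) x \<in> S" using sX[OF x] by (simp add: S_def)
          finally show ?thesis using \<epsilon> r by (simp add: u_def tk match_cost_def)
        qed
        then show ?thesis by (simp add: t_def birkhoff_sum_def exp_sum flip: sum_negf)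
      qed
      then have lnt: "ln (t B s) = - birkhoff_sum (match_cost \<epsilon> r S) n x" by simp
      \<comment> \<open>For a lower bound of \<open>q B\<close> only the summand belonging to the
        code of \<open>x\<close> is kept.\<close>
      have "q0 s * t B s / Ct \<le> q B"
        unfolding q_def using s fin q0_pos t_pos Ct_pos
        by (intro divide_right_mono member_le_sum) (auto intro: less_imp_le)
      then have "ln (q0 s * t B s / Ct) \<le> ln (q B)"
        using q0_pos t_pos Ct_pos by (intro ln_mono) auto
      then have "- ln (q B) \<le> ln Ct - ln (q0 s) - ln (t B s)"
        using q0_pos[of s] t_pos[of B s] Ct_pos by (simp add: ln_div ln_mult)
      moreover have "ln (core_weight N L x) \<le> ln (q0 s)"
        using z(3)[OF s, of x] x core_weight_pos[of N L x] by (intro ln_mono) (auto simp: q0_def space_nu s_def)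
      moreover have "birkhoff_sum f L x \<le> ln (core_weight N L x) + c + birkhoff_sum (tail N) L x"
        using x by (intro birkhoff_sum_le_core_weight) (simp add: space_nu)
      ultimately show "- ln (q B) \<le> h x" unfolding h_def lnt by linarith
    qed (use Qfacts in auto)
    also have "(\<integral>x. h x \<partial>\<nu>) = ln Ct + c - real L * (\<integral>x. f x \<partial>\<nu>) + real L * (\<integral>x. tail N x \<partial>\<nu>)
        + real n * (\<integral>x. match_cost \<epsilon> r S x \<partial>\<nu>)"
      unfolding h_def
      using birkhoff_sum_integral[OF f_int] birkhoff_sum_integral[OF tail_integrable]
          birkhoff_sum_integral[OF match_cost_integral(1)[OF \<epsilon> r S]] by (simp add: prob_space)
    also have "ln Ct \<le> ln (2 * (1 + real (L ^ 2) * M))" using Ct_le Ct_pos by (intro ln_mono) auto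
    finally show ?thesis by (simp add: Q_def L_def algebra_simps)
  qed
  then show ?thesis using M(1) unfolding r_def by blast
qed

lemma ln_quadratic_over_n_tendsto_0:
  fixes M :: real
  assumes "M > 0"
  shows "(\<lambda>n. ln (2 * (1 + real ((n + N) ^ 2) * M)) / real n) \<longlonglongrightarrow> 0"
proof (rule tendsto_sandwich[where f = "\<lambda>_. 0"])
  define C where "C = 2 * (1 + real ((1 + N) ^ 2) * M)"
  have C: "C > 0" using assms by (simp add: C_def add_pos_nonneg)
  show "\<forall>\<^sub>F n in sequentially. 0 \<le> ln (2 * (1 + real ((n + N) ^ 2) * M)) / real n"
    using assms by (intro always_eventually allI divide_nonneg_nonneg ln_ge_zero) auto
  show "\<forall>\<^sub>F n in sequentially. ln (2 * (1 + real ((n + N) ^ 2) * M)) / real n \<le>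
      ln C * (1 / real n) + 2 * (ln (real n) / real n)"
    using eventually_gt_at_top[of 0]
  proof eventually_elim
    case (elim n)
    have "n + N \<le> n * (1 + N)" using elim by (cases n) auto
    then have "(n + N) ^ 2 \<le> (n * (1 + N)) ^ 2" by (rule power_mono) simp
    then have "real ((n + N) ^ 2) \<le> real ((n * (1 + N)) ^ 2)" by (rule of_nat_mono)
    then have "real ((n + N) ^ 2) * M \<le> real ((n * (1 + N)) ^ 2) * M"
      using assms by (intro mult_right_mono) auto
    also have "\<dots> = real n ^ 2 * (real ((1 + N) ^ 2) * M)"
      by (simp only: of_nat_power of_nat_mult power_mult_distrib mult_ac)
    finally have "real ((n + N) ^ 2) * M \<le> real n ^ 2 * (real ((1 + N) ^ 2) * M)" .
    moreover have "1 \<le> real n ^ 2" using elim by simp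
    ultimately have "2 * (1 + real ((n + N) ^ 2) * M) \<le> C * real n ^ 2"
      by (simp add: C_def algebra_simps)
    then have "ln (2 * (1 + real ((n + N) ^ 2) * M)) \<le> ln (C * real n ^ 2)"
      using assms by (intro ln_mono) (auto intro!: add_pos_nonneg)
    also have "\<dots> = ln C + 2 * ln (real n)" using C elim by (simp add: ln_mult ln_realpow)
    finally show ?case using elim by (simp add: field_simps)
  qed
  have "(\<lambda>n. ln C * (1 / real n) + 2 * (ln (real n) / real n)) \<longlonglongrightarrow> ln C * 0 + 2 * 0"
    by (intro tendsto_intros lim_1_over_n lim_ln_over_n)
  then show "(\<lambda>n. ln C * (1 / real n) + 2 * (ln (real n) / real n)) \<longlonglongrightarrow> 0" by simp
qed simp

text \<open>The order of choices matters: \<epsilon> makes right guesses cheap, then \<delta> makes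
  wrong guesses rare compared with their cost, then \<open>N\<close> achieves this \<delta> together
  with a small tail integral, and finally \<open>n\<close> tends to infinity. Each of the three
  errors takes a third of \<open>e\<close>.\<close>

lemma entropy_wrt_partition_le:
  assumes P: "finite P" "partition_on (space \<nu>) P" "P \<subseteq> sets \<nu>"
  shows "entropy_wrt_partition \<nu> shift P \<le> ereal (- (\<integral>x. f x \<partial>\<nu>))"
proof (rule ereal_le_epsilon2)
  fix e :: real assume e: "e > 0"
  define \<epsilon> where "\<epsilon> = 1 - exp (- e / 3)"
  have \<epsilon>: "0 < \<epsilon>" "\<epsilon> < 1" "- ln (1 - \<epsilon>) = e / 3" using e by (auto simp: \<epsilon>_def)
  have Pne: "P \<noteq> {}" using P(2) not_empty by (auto simp: partition_on_def)
  define r where "r = real (card P)"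
  have "card P > 0" using Pne P(1) by (simp add: card_gt_0_iff)
  then have r: "r \<ge> 1" by (simp add: r_def)
  define \<delta> where "\<delta> = e / (3 * (1 + \<bar>ln (\<epsilon> / r)\<bar>))"
  have \<delta>: "\<delta> > 0" using e by (simp add: \<delta>_def add_pos_nonneg)
  have "\<forall>\<^sub>F N in sequentially. \<forall>C\<in>P. \<exists>S. measure \<nu> (sym_diff C {x \<in> X. trunc_code N N x \<in> S}) < \<delta> / r"
    using P approximable_sets \<delta> r by (intro eventually_ball_finite) (auto simp: approximable_def)
  moreover have "\<forall>\<^sub>F N in sequentially. (\<integral>x. tail N x \<partial>\<nu>) < e / 3"
    using tail_tendsto e by (intro order_tendstoD(2)) auto
  ultimately have "\<forall>\<^sub>F N in sequentially. (\<forall>C\<in>P. \<exists>S. measure \<nu> (sym_diff C {x \<in> X. trunc_code N N x \<in> S}) < \<delta> / r)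
      \<and> (\<integral>x. tail N x \<partial>\<nu>) < e / 3" by (rule eventually_conj)
  then obtain N where N: "\<forall>C\<in>P. \<exists>S. measure \<nu> (sym_diff C {x \<in> X. trunc_code N N x \<in> S}) < \<delta> / r"
      "(\<integral>x. tail N x \<partial>\<nu>) < e / 3"
    by (auto simp: eventually_sequentially)
  from bchoice[OF N(1)] obtain T where
    T: "\<And>C. C \<in> P \<Longrightarrow> measure \<nu> (sym_diff C {x \<in> X. trunc_code N N x \<in> T C}) < \<delta> / r"
    by blast
  define D where "D = (\<lambda>C. sym_diff C {x \<in> X. trunc_code N N x \<in> T C})"
  have D: "D C \<in> sets \<nu>" if "C \<in> P" for C using that P(3) trunc_code_set by (auto simp: D_def)
  define g where "g = (\<lambda>s. SOME C. C \<in> P \<and> (s \<in> T C \<or> (\<forall>C'\<in>P. s \<notin> T C')))"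
  have g: "g s \<in> P \<and> (s \<in> T (g s) \<or> (\<forall>C'\<in>P. s \<notin> T C'))" for s
    unfolding g_def by (rule someI_ex) (use Pne in blast)
  define S where "S = {x \<in> space \<nu>. x \<in> g (trunc_code N N x)}"
  have "S = (\<Union>C\<in>P. C \<inter> {x \<in> X. trunc_code N N x \<in> {s. g s = C}})"
    using g by (auto simp: S_def space_nu)
  also have "\<dots> \<in> sets \<nu>" using P by (intro sets.finite_UN sets.Int trunc_code_set) auto
  finally have S: "S \<in> sets \<nu>" .
  \<comment> \<open>Off the exceptional sets \<open>D C\<close>, a code lies in \<open>T C\<close>
    exactly when the point lies in \<open>C\<close>. As the point lies in some cell, the guess
    \<open>g\<close> is then based on a true membership and is correct.\<close>
  have "space \<nu> - S \<subseteq> (\<Union>C\<in>P. D C)"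
  proof (rule subsetI, rule ccontr)
    fix x assume x: "x \<in> space \<nu> - S" "x \<notin> (\<Union>C\<in>P. D C)"
    then have *: "x \<in> C \<longleftrightarrow> trunc_code N N x \<in> T C" if "C \<in> P" for C
      using that by (auto simp: D_def space_nu)
    obtain C where "C \<in> P" "x \<in> C" using x P(2) by (auto simp: partition_on_def)
    then have "x \<in> g (trunc_code N N x)" using * g by blast
    then show False using x by (simp add: S_def)
  qed
  then have "measure \<nu> (space \<nu> - S) \<le> measure \<nu> (\<Union>C\<in>P. D C)"
    using P D by (intro finite_measure_mono) auto
  also have "\<dots> \<le> (\<Sum>C\<in>P. measure \<nu> (D C))" using P D by (intro finite_measure_subadditive_finite) auto
  also have "\<dots> \<le> (\<Sum>C\<in>P. \<delta> / r)" using T by (intro sum_mono) (auto simp: D_def intro: less_imp_le)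
  also have "\<dots> = \<delta>" using r by (simp add: r_def)
  finally have mS: "measure \<nu> (space \<nu> - S) \<le> \<delta>" .
  define \<tau> where "\<tau> = (\<integral>x. match_cost \<epsilon> r S x \<partial>\<nu>)"
  have "\<tau> \<le> - ln (1 - \<epsilon>) + \<bar>ln (\<epsilon> / r)\<bar> * measure \<nu> (space \<nu> - S)"
    unfolding \<tau>_def using match_cost_integral(2)[OF \<epsilon>(1,2) r S]
      mult_right_mono[OF abs_ge_minus_self[of "ln (\<epsilon> / r)"], of "measure \<nu> (space \<nu> - S)"] by simp
  also have "\<bar>ln (\<epsilon> / r)\<bar> * measure \<nu> (space \<nu> - S) \<le> (1 + \<bar>ln (\<epsilon> / r)\<bar>) * \<delta>"
    using mS by (intro mult_mono) auto
  also have "\<dots> = e / 3"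
  proof -
    have "1 + \<bar>ln (\<epsilon> / r)\<bar> \<noteq> 0" by linarith
    then show ?thesis unfolding \<delta>_def by (simp add: divide_simps)
  qed
  finally have \<tau>: "\<tau> \<le> 2 * e / 3" using \<epsilon>(3) by simp
  define F where "F = (\<integral>x. tail N x \<partial>\<nu>) - (\<integral>x. f x \<partial>\<nu>)"
  obtain M where M: "M > 0" "\<And>n. n > 0 \<Longrightarrow> partition_entropy \<nu> (iterated_partition \<nu> shift P n) \<le>
    ln (2 * (1 + real ((n + N) ^ 2) * M)) + c + real (n + N) * F + real n * \<tau>"
    using iterated_entropy_bound[OF P \<epsilon>(1,2) _ S_def S] g unfolding F_def \<tau>_def r_def by blast
  let ?b = "\<lambda>n. ln (2 * (1 + real ((n + N) ^ 2) * M)) / real n + (c + real N * F) * (1 / real n) + F + \<tau>"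
  have "\<forall>\<^sub>F n in sequentially. ereal (partition_entropy \<nu> (iterated_partition \<nu> shift P n) / real n) \<le> ereal (?b n)"
    using eventually_gt_at_top[of 0]
  proof eventually_elim
    case (elim n)
    have "(z + c + real (n + N) * F + real n * \<tau>) / real n = z / real n + (c + real N * F) * (1 / real n) + F + \<tau>" for z
      using elim by (simp add: field_simps)
    then show ?case using divide_right_mono[OF M(2)[OF elim], of "real n"] by simp
  qed
  then have "entropy_wrt_partition \<nu> shift P \<le> limsup (\<lambda>n. ereal (?b n))"
    unfolding entropy_wrt_partition_def by (rule Limsup_mono)
  also have "\<dots> = ereal (F + \<tau>)"
  proof (rule lim_imp_Limsup)
    have "?b \<longlonglongrightarrow> 0 + (c + real N * F) * 0 + F + \<tau>"
      by (intro tendsto_add tendsto_mult tendsto_const lim_1_over_n ln_quadratic_over_n_tendsto_0 M(1))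
    then show "(\<lambda>n. ereal (?b n)) \<longlonglongrightarrow> ereal (F + \<tau>)" by simp
  qed simp
  also have "\<dots> \<le> ereal (- (\<integral>x. f x \<partial>\<nu>)) + ereal e"
    using \<tau> N(2) by (simp add: F_def)
  finally show "entropy_wrt_partition \<nu> shift P \<le> ereal (- (\<integral>x. f x \<partial>\<nu>)) + ereal e" .
qed

theorem measure_entropy_le: "measure_entropy \<nu> shift \<le> ereal (- (\<integral>x. f x \<partial>\<nu>))"
  unfolding measure_entropy_def by (intro SUP_least entropy_wrt_partition_le) auto

end

section \<open>Bernoulli measures on concatenated blocks\<close>

text \<open>The words of \<open>G\<close> begin with \<open>a\<close> and may be followed by
  \<open>a\<close>, so they concatenate freely. Their common length puts the block boundaries at
  multiples of \<open>n\<close>, whatever blocks are drawn.\<close>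

locale block_system =
  fixes I :: "nat set" and A :: "nat \<Rightarrow> nat \<Rightarrow> nat" and a :: nat
    and G :: "nat list set" and n :: nat and p :: "nat list \<Rightarrow> real"
  assumes fin_G: "finite G" and G_per: "G \<subseteq> periodic_words I A a"
    and G_len: "w \<in> G \<Longrightarrow> length w = n"
    and p_pos: "w \<in> G \<Longrightarrow> p w > 0" and p_sum: "(\<Sum>w\<in>G. p w) = 1"
begin

abbreviation "X \<equiv> shift_space I A"

abbreviation "cyl \<equiv> cylinder I A"

definition coin :: "nat list measure" where
  "coin = point_measure G p"

definition \<Omega> :: "(nat \<Rightarrow> nat list) measure" where
  "\<Omega> = PiM UNIV (\<lambda>_. coin)"

lemma G_ne: "G \<noteq> {}"
  using p_sum by auto

lemma n_pos: "n > 0"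
  using G_ne G_len G_per by (fastforce simp: periodic_words_def words_def)

lemma space_coin: "space coin = G" and sets_coin: "sets coin = Pow G"
  by (simp_all add: coin_def space_point_measure sets_point_measure)

lemma prob_coin: "prob_space coin"
  unfolding coin_def by (intro prob_space_point_measure fin_G)
    (simp_all add: sum_ennreal p_pos less_imp_le p_sum)

sublocale C: product_prob_space "\<lambda>_ :: nat. coin" UNIV
  using prob_coin
  by (simp add: product_prob_space_def product_sigma_finite_def product_prob_space_axioms_def prob_space_imp_sigma_finite)

sublocale O: prob_space \<Omega>
  unfolding \<Omega>_def by (intro prob_space_PiM prob_coin)

lemma space_Omega: "x \<in> space \<Omega> \<longleftrightarrow> (\<forall>k. x k \<in> G)"
  by (auto simp: \<Omega>_def space_PiM space_coin)

lemma component_measurable: "(\<lambda>x. x k) \<in> measurable \<Omega> coin"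
  unfolding \<Omega>_def by (rule measurable_component_singleton) simp

lemma coin_measurable: "f ` G \<subseteq> space M \<Longrightarrow> f \<in> measurable coin M"
  by (auto simp: coin_def)

definition cat :: "(nat \<Rightarrow> nat list) \<Rightarrow> nat \<Rightarrow> nat" where
  "cat x m = x (m div n) ! (m mod n)"

definition letters :: "nat set" where
  "letters = (\<Union>w\<in>G. set w)"

lemma finite_letters: "finite letters"
  using fin_G by (simp add: letters_def)

lemma cat_letters: "x \<in> space \<Omega> \<Longrightarrow> cat x m \<in> letters"
  using n_pos G_len by (auto simp: cat_def letters_def space_Omega intro!: bexI[of _ "x (m div n)"] nth_mem)

lemma letters_I: "letters \<subseteq> I"
  using G_per by (auto simp: letters_def periodic_words_def words_def)

lemma cat_X:
  assumes x: "x \<in> space \<Omega>"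
  shows "cat x \<in> X"
  unfolding shift_space_def
proof (intro CollectI allI conjI)
  fix m
  show "cat x m \<in> I" using cat_letters[OF x] letters_I by blast
  have w: "x k \<in> periodic_words I A a" "length (x k) = n" for k
    using x G_per G_len by (auto simp: space_Omega)
  show "A (cat x m) (cat x (Suc m)) = 1"
  proof (cases "Suc (m mod n) = n")
    case True
    have "cat x m = last (x (m div n))"
      using w[of "m div n"] True n_pos
      by (subst last_conv_nth) (auto simp: cat_def periodic_words_def words_def intro: arg_cong)
    moreover have "cat x (Suc m) = hd (x (Suc (m div n)))"
      using w[of "Suc (m div n)"] True n_pos
      by (subst hd_conv_nth) (auto simp: cat_def mod_Suc div_Suc periodic_words_def words_def)
    ultimately show ?thesis using w by (simp add: periodic_words_iff)
  next
    case False
    then have "Suc m div n = m div n" "Suc m mod n = Suc (m mod n)" by (auto simp: mod_Suc div_Suc)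
    moreover have "Suc (m mod n) < n" using False n_pos by (simp add: Suc_lessI)
    ultimately show ?thesis using w[of "m div n"] by (simp add: cat_def periodic_words_def words_def)
  qed
qed

lemma cat_block: "x \<in> space \<Omega> \<Longrightarrow> i < n \<Longrightarrow> cat x (k * n + i) = x k ! i"
  using n_pos by (simp add: cat_def)

lemma cat_cylinder: "x \<in> space \<Omega> \<Longrightarrow> cat x \<in> cyl (x 0)"
  using cat_X cat_block[of x _ 0] G_len by (auto simp: cylinder_def space_Omega)

lemma shift_cat: "(shift ^^ n) (cat x) = cat (\<lambda>k. x (Suc k))"
  using n_pos by (simp add: funpow_shift cat_def fun_eq_iff)

lemma cat_measurable: "cat \<in> measurable \<Omega> (restrict_space borel X)"
proof (rule measurable_restrict_space2)
  show "cat \<in> space \<Omega> \<rightarrow> X" using cat_X by blast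
  show "cat \<in> borel_measurable \<Omega>"
  proof (rule measurable_coordinatewise_then_product)
    fix m
    have "(\<lambda>w. w ! (m mod n)) \<in> measurable coin (borel :: nat measure)" by (rule coin_measurable) simp
    from measurable_compose[OF component_measurable this]
    show "(\<lambda>x. cat x m) \<in> borel_measurable \<Omega>" by (simp add: cat_def)
  qed
qed

lemma orbit_measurable: "(\<lambda>x. (shift ^^ j) (cat x)) \<in> measurable \<Omega> (restrict_space borel X)"
  using measurable_compose[OF cat_measurable shift_measurable_restrict] .

section \<open>Shift invariance by averaging over phases\<close>

definition phased :: "nat \<times> (nat \<Rightarrow> nat list) \<Rightarrow> nat \<Rightarrow> nat" where
  "phased = (\<lambda>(j, x). (shift ^^ j) (cat x))"

definition phase :: "nat measure" where
  "phase = point_measure {..<n} (\<lambda>_. 1 / real n)"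

text \<open>Concatenating independent blocks gives a law that is invariant under \<open>n\<close>
  shifts. A uniformly random starting phase within the first block makes it invariant under a single
  shift.\<close>

definition \<nu> :: "(nat \<Rightarrow> nat) measure" where
  "\<nu> = distr (phase \<Otimes>\<^sub>M \<Omega>) (restrict_space borel X) phased"

lemma prob_phase: "prob_space phase"
proof -
  have "(\<Sum>j<n. ennreal (1 / real n)) = ennreal (\<Sum>j<n. 1 / real n)" by (rule sum_ennreal) simp
  then show ?thesis unfolding phase_def using n_pos by (intro prob_space_point_measure) auto
qed

sublocale PO: pair_prob_space phase \<Omega>
proof -
  interpret prob_space phase by (rule prob_phase)
  show "pair_prob_space phase \<Omega>" by unfold_locales
qed

lemma phased_measurable: "phased \<in> measurable (phase \<Otimes>\<^sub>M \<Omega>) (restrict_space borel X)"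
proof -
  have "phased \<in> measurable (count_space {..<n} \<Otimes>\<^sub>M \<Omega>) (restrict_space borel X)"
    unfolding phased_def by (rule measurable_pair_measure_countable1) (simp_all add: orbit_measurable)
  moreover have "sets (phase \<Otimes>\<^sub>M \<Omega>) = sets (count_space {..<n} \<Otimes>\<^sub>M \<Omega>)"
    by (intro sets_pair_measure_cong) (simp_all add: phase_def sets_point_measure)
  ultimately show ?thesis by (simp cong: measurable_cong_sets)
qed

sublocale N: prob_space \<nu>
  unfolding \<nu>_def by (rule PO.prob_space_distr[OF phased_measurable])

lemma space_nu: "space \<nu> = X" and sets_nu: "sets \<nu> = sets (restrict_space borel X)"
  by (simp_all add: \<nu>_def space_restrict_space)

text \<open>The bound is asked only along shifted concatenations, which use finitely many letters; a
  Hoelder function may be unbounded on the whole space.\<close>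

lemma nu_integral:
  fixes h :: "(nat \<Rightarrow> nat) \<Rightarrow> real"
  assumes h: "h \<in> borel_measurable \<nu>" and b: "\<And>j x. x \<in> space \<Omega> \<Longrightarrow> \<bar>h ((shift ^^ j) (cat x))\<bar> \<le> b"
  shows "integrable \<nu> h" "real n * (\<integral>y. h y \<partial>\<nu>) = (\<Sum>j<n. \<integral>x. h ((shift ^^ j) (cat x)) \<partial>\<Omega>)"
    "integrable \<Omega> (\<lambda>x. h ((shift ^^ j) (cat x)))"
proof -
  have h': "h \<in> borel_measurable (restrict_space borel X)" using h by (simp add: \<nu>_def)
  have m: "(\<lambda>z. h (phased z)) \<in> borel_measurable (phase \<Otimes>\<^sub>M \<Omega>)"
    using measurable_compose[OF phased_measurable h'] .
  have int: "integrable (phase \<Otimes>\<^sub>M \<Omega>) (\<lambda>z. h (phased z))"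
    using b m by (intro PO.integrable_const_bound[where B = b]) (auto simp: phased_def space_pair_measure intro!: AE_I2)
  then show "integrable \<nu> h" unfolding \<nu>_def by (subst integrable_distr_eq[OF phased_measurable h'])
  show "integrable \<Omega> (\<lambda>x. h ((shift ^^ j) (cat x)))"
    using b measurable_compose[OF orbit_measurable h']
    by (intro O.integrable_const_bound[where B = b]) (auto intro!: AE_I2)
  have "(\<integral>y. h y \<partial>\<nu>) = (\<integral>z. h (phased z) \<partial>(phase \<Otimes>\<^sub>M \<Omega>))"
    unfolding \<nu>_def by (rule integral_distr[OF phased_measurable h'])
  also have "\<dots> = (\<integral>j. (\<integral>x. h (phased (j, x)) \<partial>\<Omega>) \<partial>phase)" by (rule PO.integral_fst'[OF int, symmetric])
  also have "\<dots> = (\<Sum>j<n. (1 / real n) *\<^sub>R (\<integral>x. h (phased (j, x)) \<partial>\<Omega>))"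
    unfolding phase_def by (rule lebesgue_integral_point_measure_finite) simp_all
  also have "\<dots> = (\<Sum>j<n. \<integral>x. h ((shift ^^ j) (cat x)) \<partial>\<Omega>) / real n"
    by (simp add: phased_def sum_divide_distrib)
  finally show "real n * (\<integral>y. h y \<partial>\<nu>) = (\<Sum>j<n. \<integral>x. h ((shift ^^ j) (cat x)) \<partial>\<Omega>)"
    using n_pos by simp
qed

definition phase_measure :: "nat \<Rightarrow> (nat \<Rightarrow> nat) set \<Rightarrow> real" where
  "phase_measure j B = measure \<Omega> {x \<in> space \<Omega>. (shift ^^ j) (cat x) \<in> B}"

lemma orbit_sets: "B \<in> sets \<nu> \<Longrightarrow> {x \<in> space \<Omega>. (shift ^^ j) (cat x) \<in> B} \<in> sets \<Omega>"
  using measurable_sets[OF orbit_measurable, of B j] by (simp add: sets_nu vimage_def Int_def conj_commute)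

lemma nu_measure:
  assumes B: "B \<in> sets \<nu>"
  shows "real n * measure \<nu> B = (\<Sum>j<n. phase_measure j B)"
proof -
  have "real n * (\<integral>y. indicator B y \<partial>\<nu>) = (\<Sum>j<n. \<integral>x. indicator B ((shift ^^ j) (cat x)) \<partial>\<Omega>)"
    using B by (intro nu_integral(2)[where b = 1]) (auto simp: indicator_def)
  moreover have "(\<integral>x. indicator B ((shift ^^ j) (cat x)) \<partial>\<Omega>) = phase_measure j B" for j
  proof -
    have "(\<integral>x. indicator B ((shift ^^ j) (cat x)) \<partial>\<Omega>) =
        (\<integral>x. indicat_real {x \<in> space \<Omega>. (shift ^^ j) (cat x) \<in> B} x \<partial>\<Omega>)"
      by (intro Bochner_Integration.integral_cong) (auto simp: indicator_def)
    then show ?thesis using orbit_sets[OF B, of j] by (simp add: phase_measure_def Int_absorb2)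
  qed
  moreover have "B \<inter> space \<nu> = B" using B sets.sets_into_space by blast
  ultimately show ?thesis by simp
qed

lemma Omega_shift:
  shows "(\<lambda>x k. x (Suc k)) \<in> measurable \<Omega> \<Omega>" "distr \<Omega> \<Omega> (\<lambda>x k. x (Suc k)) = \<Omega>"
proof -
  have "distr (PiM UNIV (\<lambda>_. coin)) (\<Pi>\<^sub>M i\<in>UNIV. coin) (\<lambda>\<omega>. \<lambda>i\<in>UNIV. \<omega> (Suc i)) = (\<Pi>\<^sub>M i\<in>UNIV. coin)"
    by (rule distr_PiM_reindex) (auto simp: prob_coin)
  then show "distr \<Omega> \<Omega> (\<lambda>x k. x (Suc k)) = \<Omega>" by (simp add: \<Omega>_def restrict_UNIV)
  show "(\<lambda>x k. x (Suc k)) \<in> measurable \<Omega> \<Omega>"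
    unfolding \<Omega>_def
    by (rule measurable_PiM_single')
      (use component_measurable in \<open>auto simp: \<Omega>_def space_PiM\<close>)
qed

text \<open>Shifting by \<open>n\<close> drops the first block, which preserves the product measure.
  This closes the cycle of phases in the proof of invariance.\<close>

lemma phase_measure_n:
  assumes B: "B \<in> sets \<nu>"
  shows "phase_measure n B = phase_measure 0 B"
proof -
  let ?E = "{x \<in> space \<Omega>. cat x \<in> B}"
  have E: "?E \<in> sets \<Omega>" using orbit_sets[OF B, of 0] by simp
  have "{x \<in> space \<Omega>. (shift ^^ n) (cat x) \<in> B} = (\<lambda>x k. x (Suc k)) -` ?E \<inter> space \<Omega>"
    by (auto simp: shift_cat space_Omega)
  then have "phase_measure n B = measure (distr \<Omega> \<Omega> (\<lambda>x k. x (Suc k))) ?E"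
    using E Omega_shift(1) by (simp add: phase_measure_def measure_distr)
  then show ?thesis by (simp add: Omega_shift(2) phase_measure_def)
qed

lemma orbit_X: "x \<in> space \<Omega> \<Longrightarrow> (shift ^^ j) (cat x) \<in> X"
  by (simp add: cat_X funpow_shift_shift_space)

lemma nu_invariant: "\<nu> \<in> invariant_measures I A"
  unfolding invariant_measures_def
proof (intro CollectI conjI ballI)
  show "space \<nu> = X" by (rule space_nu)
  show "sets \<nu> = borel_sets_of (shift_topology I A)" by (simp add: sets_nu borel_sets_of_shift_topology)
  show "emeasure \<nu> (space \<nu>) = 1" by (rule N.emeasure_space_1)
  fix B assume B: "B \<in> sets \<nu>"
  have SB: "shift -` B \<inter> space \<nu> \<in> sets \<nu>"
    using measurable_sets[OF shift_measurable_restrict[of 1], of B] B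
    by (simp add: sets_nu space_nu space_restrict_space)
  have "phase_measure j (shift -` B \<inter> space \<nu>) = phase_measure (Suc j) B" for j
    unfolding phase_measure_def using orbit_X by (intro arg_cong[where f = "measure \<Omega>"]) (auto simp: space_nu)
  then have "real n * measure \<nu> (shift -` B \<inter> space \<nu>) = (\<Sum>j<n. phase_measure (Suc j) B)"
    using nu_measure[OF SB] by simp
  also have "\<dots> = (\<Sum>j<n. phase_measure j B)"
    using sum.lessThan_Suc_shift[of "\<lambda>j. phase_measure j B" n] phase_measure_n[OF B] by simp
  also have "\<dots> = real n * measure \<nu> B" using nu_measure[OF B] by simp
  finally show "emeasure \<nu> (shift -` B \<inter> space \<nu>) = emeasure \<nu> B"
    using n_pos by (simp add: N.emeasure_eq_measure)
qed

section \<open>Ergodicity from the zero-one law\<close>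

lemma indep_coordinates:
  "O.indep_sets (\<lambda>i. sigma_sets (space \<Omega>) {(\<lambda>x. x i) -` S \<inter> space \<Omega> | S. S \<in> sets coin}) UNIV"
proof -
  have d: "distr \<Omega> coin (\<lambda>x. x i) = coin" for i
    unfolding \<Omega>_def using C.PiM_component[of i] by simp
  have "O.indep_vars (\<lambda>_. coin) (\<lambda>i x. x i) UNIV"
    by (subst O.indep_vars_iff_distr_eq_PiM') (simp_all add: component_measurable d restrict_UNIV, simp add: \<Omega>_def)
  then show ?thesis by (simp add: O.indep_vars_def)
qed

text \<open>Invariance describes \<open>E\<close> by the coordinates from \<open>m\<close> on, for
  every \<open>m\<close>. Thus \<open>E\<close> is a tail event of independent blocks and
  Kolmogorov's law applies.\<close>

lemma zero_one:
  assumes E: "E \<in> sets \<Omega>" and inv: "\<And>x. x \<in> space \<Omega> \<Longrightarrow> x \<in> E \<longleftrightarrow> (\<lambda>k. x (Suc k)) \<in> E"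
  shows "measure \<Omega> E = 0 \<or> measure \<Omega> E = 1"
proof -
  let ?A = "\<lambda>i. sigma_sets (space \<Omega>) {(\<lambda>x. x i) -` S \<inter> space \<Omega> | S. S \<in> sets coin}"
  have inv': "x \<in> E \<longleftrightarrow> (\<lambda>k. x (k + m)) \<in> E" if "x \<in> space \<Omega>" for x m
  proof (induction m)
    case (Suc m)
    have "(\<lambda>k. x (k + m)) \<in> space \<Omega>" using that by (simp add: space_Omega)
    from inv[OF this] Suc show ?case by simp
  qed simp
  have "E \<in> sigma_sets (space \<Omega>) (\<Union> (?A ` {m..}))" for m
  proof -
    let ?S = "sigma (space \<Omega>) (\<Union> (?A ` {m..}))"
    have sub: "\<Union> (?A ` {m..}) \<subseteq> Pow (space \<Omega>)"
      by (auto dest!: sigma_sets_into_sp[rotated])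
    have "(\<lambda>x k. x (k + m)) \<in> measurable ?S \<Omega>"
      unfolding \<Omega>_def
    proof (rule measurable_PiM_single')
      fix i
      show "(\<lambda>x. x (i + m)) \<in> measurable (sigma (space (PiM UNIV (\<lambda>_. coin)))
          (\<Union> ((\<lambda>i. sigma_sets (space (PiM UNIV (\<lambda>_. coin))) {(\<lambda>x. x i) -` S \<inter> space (PiM UNIV (\<lambda>_. coin)) | S. S \<in> sets coin}) ` {m..}))) coin"
        unfolding \<Omega>_def[symmetric]
      proof (rule measurableI)
        fix S assume S: "S \<in> sets coin"
        have "(\<lambda>x. x (i + m)) -` S \<inter> space \<Omega> \<in> ?A (i + m)" using S by (intro sigma_sets.Basic) blast
        then have "(\<lambda>x. x (i + m)) -` S \<inter> space \<Omega> \<in> \<Union> (?A ` {m..})" by (rule UN_I[rotated]) simp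
        then show "(\<lambda>x. x (i + m)) -` S \<inter> space ?S \<in> sets ?S"
          using sub by (simp add: sigma_sets.Basic)
      qed (simp add: space_coin space_Omega space_measure_of_conv)
    qed (auto simp: space_PiM space_measure_of_conv)
    from measurable_sets[OF this E] have "(\<lambda>x k. x (k + m)) -` E \<inter> space \<Omega> \<in> sets ?S"
      by (simp only: space_measure_of_conv)
    moreover have "(\<lambda>x k. x (k + m)) -` E \<inter> space \<Omega> = E"
      using inv' sets.sets_into_space[OF E] by blast
    ultimately show ?thesis using sub by simp
  qed
  then have "E \<in> O.tail_events ?A" by (simp add: O.tail_events_def)
  moreover have "sigma_algebra (space \<Omega>) (?A i)" for i by (intro sigma_algebra_sigma_sets) auto
  ultimately show ?thesis using O.kolmogorov_0_1_law[of ?A E] indep_coordinates by blast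
qed

text \<open>An invariant set has the same measure at every phase, so its measure is the probability
  that the concatenation itself lies in it. That event is unchanged by dropping a block.\<close>

lemma nu_ergodic: "ergodic \<nu> shift"
  unfolding ergodic_def
proof (intro ballI impI)
  fix B assume B: "B \<in> sets \<nu>" "shift -` B \<inter> space \<nu> = B"
  have inv: "(shift ^^ j) y \<in> B \<longleftrightarrow> y \<in> B" if "y \<in> X" for y j
  proof (induction j)
    case (Suc j)
    have "(shift ^^ j) y \<in> space \<nu>" using that by (simp add: space_nu funpow_shift_shift_space)
    then show ?case using B(2) Suc by auto
  qed simp
  have "phase_measure j B = phase_measure 0 B" for j
    unfolding phase_measure_def using inv cat_X by (intro arg_cong[where f = "measure \<Omega>"]) auto
  then have "(\<Sum>j<n. phase_measure j B) = (\<Sum>j<n. phase_measure 0 B)" by (rule sum.cong[OF refl])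
  then have "measure \<nu> B = phase_measure 0 B" using nu_measure[OF B(1)] n_pos by simp
  moreover have "phase_measure 0 B = 0 \<or> phase_measure 0 B = 1"
    unfolding phase_measure_def
  proof (rule zero_one[OF orbit_sets[OF B(1)]])
    fix x assume x: "x \<in> space \<Omega>"
    have "cat x \<in> B \<longleftrightarrow> cat (\<lambda>k. x (Suc k)) \<in> B" using inv[OF cat_X[OF x], of n] by (simp add: shift_cat)
    then show "x \<in> {x \<in> space \<Omega>. (shift ^^ 0) (cat x) \<in> B} \<longleftrightarrow>
        (\<lambda>k. x (Suc k)) \<in> {x \<in> space \<Omega>. (shift ^^ 0) (cat x) \<in> B}"
      using x by (auto simp: space_Omega)
  qed
  ultimately show "emeasure \<nu> B = 0 \<or> emeasure \<nu> (space \<nu> - B) = 0"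
    using B(1) by (auto simp: N.emeasure_eq_measure N.prob_compl)
qed

section \<open>Compact support\<close>

definition Y :: "(nat \<Rightarrow> nat) set" where
  "Y = {x \<in> X. \<forall>k. x k \<in> letters}"

lemma orbit_Y: "x \<in> space \<Omega> \<Longrightarrow> (shift ^^ j) (cat x) \<in> Y"
  using orbit_X cat_letters by (auto simp: Y_def funpow_shift)

lemma compact_Y: "compact Y"
proof -
  have "compactin (product_topology (\<lambda>_. euclidean) UNIV) (\<Pi>\<^sub>E k\<in>UNIV. letters)"
    unfolding compactin_PiE using finite_letters by (simp add: finite_imp_compact)
  then have "compact (\<Pi>\<^sub>E k\<in>(UNIV :: nat set). letters)" by (simp add: euclidean_product_topology)
  moreover have "Y = X \<inter> (\<Pi>\<^sub>E k\<in>UNIV. letters)" by (auto simp: Y_def PiE_iff)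
  ultimately show ?thesis by (simp add: closed_shift_space closed_Int_compact)
qed

lemma closed_Y: "closed Y"
proof -
  have "closed (\<Inter>k. (\<lambda>x :: nat \<Rightarrow> nat. x k) -` letters)"
    by (intro closed_INT ballI closed_vimage continuous_on_product_coordinates) (simp add: finite_imp_closed finite_letters)
  moreover have "Y = X \<inter> (\<Inter>k. (\<lambda>x. x k) -` letters)" by (auto simp: Y_def)
  ultimately show ?thesis using closed_shift_space by auto
qed

text \<open>All shifted concatenations stay in the compact set \<open>Y\<close> of points over the
  finitely many letters used, and the support is a closed subset of it.\<close>

lemma nu_compact: "compactin (shift_topology I A) (measure_support (shift_topology I A) \<nu>)"
proof -
  let ?S = "measure_support (shift_topology I A) \<nu>"
  have SX: "?S \<subseteq> X" by (auto simp: measure_support_def shift_topology_eq)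
  have "?S \<subseteq> Y"
  proof
    fix x assume x: "x \<in> ?S"
    let ?U = "X - Y"
    have "Y \<subseteq> X" by (auto simp: Y_def)
    then have "closedin (top_of_set X) Y"
      using closed_Y by (rule closed_subset)
    then have U: "openin (top_of_set X) ?U" by (intro openin_diff) simp_all
    have "emeasure \<nu> ?U = 0"
    proof -
      have "X - Y = X \<inter> - Y" by blast
      then have "?U \<in> sets \<nu>"
        using closed_Y by (auto simp: sets_nu sets_restrict_space)
      from nu_measure[OF this] have "real n * measure \<nu> ?U = 0"
      proof -
        have "{x \<in> space \<Omega>. (shift ^^ j) (cat x) \<in> ?U} = {}" for j using orbit_Y by blast
        then show "real n * measure \<nu> ?U = (\<Sum>j<n. phase_measure j ?U) \<Longrightarrow> real n * measure \<nu> ?U = 0"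
          by (simp only: phase_measure_def measure_empty sum.neutral_const)
      qed
      then show ?thesis using n_pos by (simp add: N.emeasure_eq_measure)
    qed
    then show "x \<in> Y" using x U SX by (auto simp: measure_support_def shift_topology_eq)
  qed
  moreover have "closed ?S"
  proof -
    have "X - ?S = \<Union> {U. openin (top_of_set X) U \<and> emeasure \<nu> U = 0}"
    proof -
      have "x \<in> X - ?S \<longleftrightarrow> (\<exists>U. openin (top_of_set X) U \<and> emeasure \<nu> U = 0 \<and> x \<in> U)" for x
        using openin_imp_subset
        unfolding measure_support_def shift_topology_eq topspace_euclidean_subtopology zero_less_iff_neq_zero
        by blast
      then show ?thesis by blast
    qed
    moreover have "openin (top_of_set X) (\<Union> {U. openin (top_of_set X) U \<and> emeasure \<nu> U = 0})"
      by (rule openin_Union) blast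
    ultimately have "closedin (top_of_set X) ?S" using SX by (simp add: closedin_def)
    then show ?thesis using closed_shift_space by (rule closedin_closed_trans)
  qed
  ultimately have "compact ?S" using compact_Y by (metis Int_absorb1 compact_Int_closed)
  then show ?thesis using SX by (simp add: shift_topology_eq compactin_subtopology)
qed

lemma nu_ergodic_compact: "\<nu> \<in> ergodic_compact_measures I A"
  using nu_invariant nu_ergodic nu_compact by (simp add: ergodic_compact_measures_def)

sublocale S: shift_measure I A \<nu>
  by unfold_locales (rule nu_invariant)

section \<open>Integrals and entropy of the Bernoulli measure\<close>

lemma expectation_component: 
  fixes g :: "nat list \<Rightarrow> real"
  shows "integrable \<Omega> (\<lambda>x. g (x k))" "(\<integral>x. g (x k) \<partial>\<Omega>) = (\<Sum>w\<in>G. p w * g w)"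
proof -
  have d: "distr \<Omega> coin (\<lambda>x. x k) = coin"
    unfolding \<Omega>_def using C.PiM_component[of k] by simp
  have g: "g \<in> borel_measurable coin" by (rule coin_measurable) simp
  have "integrable coin g" unfolding coin_def by (rule integrable_point_measure_finite[OF fin_G])
  then show "integrable \<Omega> (\<lambda>x. g (x k))"
    using integrable_distr[OF component_measurable[of k], of g] by (simp add: d)
  have "(\<integral>x. g (x k) \<partial>\<Omega>) = (\<integral>w. g w \<partial>coin)"
    using integral_distr[OF component_measurable[of k] g] by (simp add: d)
  then show "(\<integral>x. g (x k) \<partial>\<Omega>) = (\<Sum>w\<in>G. p w * g w)"
    unfolding coin_def using fin_G p_pos by (subst (asm) lebesgue_integral_point_measure_finite) (auto intro: less_imp_le)
qed

text \<open>Averaging over phases turns \<open>n\<close> times the integral into the expected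
  Birkhoff sum over the first block, and the concatenation lies in the cylinder of that block, where
  \<open>s\<close> is accurate up to \<open>K\<close>.\<close>

lemma birkhoff_integral:
  assumes f: "continuous_on X f" "bounded_distortion I A f K"
    and s: "\<And>w y. w \<in> G \<Longrightarrow> y \<in> cyl w \<Longrightarrow> \<bar>birkhoff_sum f n y - s w\<bar> \<le> K"
  shows "integrable \<nu> f" "\<bar>real n * (\<integral>y. f y \<partial>\<nu>) - (\<Sum>w\<in>G. p w * s w)\<bar> \<le> K"
proof -
  \<comment> \<open>Distortion over words of a single letter bounds \<open>f\<close> on each
    cylinder of length one, hence along all sequences over finitely many letters.\<close>
  have "\<exists>b. \<forall>x\<in>cyl [c]. \<bar>f x\<bar> \<le> b" for c
  proof (cases "cyl [c] = {}")
    case False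
    then obtain y where y: "y \<in> cyl [c]" by blast
    have "\<bar>f x\<bar> \<le> \<bar>f y\<bar> + K" if "x \<in> cyl [c]" for x
      using bounded_distortionD[OF f(2) that y] by (simp add: birkhoff_sum_def)
    then show ?thesis by blast
  qed simp
  then obtain b where b: "\<And>c x. x \<in> cyl [c] \<Longrightarrow> \<bar>f x\<bar> \<le> b c" by metis
  have bd: "\<bar>f ((shift ^^ j) (cat x))\<bar> \<le> (\<Sum>c\<in>letters. \<bar>b c\<bar>)" if x: "x \<in> space \<Omega>" for j x
  proof -
    let ?y = "(shift ^^ j) (cat x)"
    have "?y \<in> cyl [?y 0]" using orbit_X[OF x] by (simp add: cylinder_def)
    then have "\<bar>f ?y\<bar> \<le> \<bar>b (?y 0)\<bar>" using b by fastforce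
    also have "\<dots> \<le> (\<Sum>c\<in>letters. \<bar>b c\<bar>)"
      using orbit_Y[OF x] finite_letters by (intro member_le_sum) (auto simp: Y_def)
    finally show ?thesis .
  qed
  note ni = nu_integral[OF S.continuous_on_measurable[OF f(1)] bd]
  show "integrable \<nu> f" using ni(1) .
  have "real n * (\<integral>y. f y \<partial>\<nu>) = (\<integral>x. birkhoff_sum f n (cat x) \<partial>\<Omega>)"
    unfolding birkhoff_sum_def using ni(2,3) by (subst Bochner_Integration.integral_sum) auto
  moreover have "integrable \<Omega> (\<lambda>x. birkhoff_sum f n (cat x))"
    unfolding birkhoff_sum_def by (intro Bochner_Integration.integrable_sum ni(3))
  ultimately have "real n * (\<integral>y. f y \<partial>\<nu>) - (\<Sum>w\<in>G. p w * s w) =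
      (\<integral>x. birkhoff_sum f n (cat x) - s (x 0) \<partial>\<Omega>)"
    and int: "integrable \<Omega> (\<lambda>x. birkhoff_sum f n (cat x) - s (x 0))"
    using expectation_component[of s 0] by (auto simp: Bochner_Integration.integral_diff)
  moreover have "\<bar>\<integral>x. birkhoff_sum f n (cat x) - s (x 0) \<partial>\<Omega>\<bar> \<le> (\<integral>x. K \<partial>\<Omega>)"
  proof (rule order_trans[OF integral_abs_bound integral_mono])
    fix x assume x: "x \<in> space \<Omega>"
    then show "\<bar>birkhoff_sum f n (cat x) - s (x 0)\<bar> \<le> K"
      using s[OF _ cat_cylinder[OF x]] by (simp add: space_Omega)
  qed (use int in auto)
  ultimately show "\<bar>real n * (\<integral>y. f y \<partial>\<nu>) - (\<Sum>w\<in>G. p w * s w)\<bar> \<le> K" by (simp add: O.prob_space)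
qed

text \<open>The remainder cell collects the points whose first letter occurs in no block; it is null
  for \<nu>. Empty cells are discarded because a partition must not contain the empty set.\<close>

definition letter_partition :: "(nat \<Rightarrow> nat) set set" where
  "letter_partition = insert (X - (\<Union>c\<in>letters. cyl [c])) ((\<lambda>c. cyl [c]) ` letters) - {{}}"

lemma letter_partition:
  "finite letter_partition" "partition_on (space \<nu>) letter_partition" "letter_partition \<subseteq> sets \<nu>"
proof -
  show "finite letter_partition" using finite_letters by (simp add: letter_partition_def)
  show "partition_on (space \<nu>) letter_partition"
  proof (rule partition_onI)
    have "\<Union> letter_partition = (X - (\<Union>c\<in>letters. cyl [c])) \<union> (\<Union>c\<in>letters. cyl [c])"
      unfolding letter_partition_def by blast
    then show "\<Union> letter_partition = space \<nu>" using cylinder_shift_space by (fastforce simp: space_nu)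
    have d: "cyl [c] = cyl [d]" if "x \<in> cyl [c]" "x \<in> cyl [d]" for x c d
      using that by (simp add: cylinder_def)
    fix B C assume "B \<in> letter_partition" "C \<in> letter_partition" "B \<noteq> C"
    then show "disjnt B C" unfolding letter_partition_def disjnt_def using d by blast
  qed (simp add: letter_partition_def)
  have "(\<Union>c\<in>letters. cyl [c]) \<in> sets \<nu>" by (intro sets.finite_UN finite_letters S.cylinder_sets)
  then have "space \<nu> - (\<Union>c\<in>letters. cyl [c]) \<in> sets \<nu>" by (rule sets.compl_sets)
  then show "letter_partition \<subseteq> sets \<nu>" using S.cylinder_sets by (auto simp: letter_partition_def space_nu)
qed

definition block_entropy :: real where
  "block_entropy = - (\<Sum>w\<in>G. p w * ln (p w))"

lemma p_le_1: "w \<in> G \<Longrightarrow> p w \<le> 1"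
  unfolding p_sum[symmetric] using fin_G p_pos by (intro member_le_sum) (auto intro: less_imp_le)

lemma block_entropy_nonneg: "block_entropy \<ge> 0"
  unfolding block_entropy_def sum_negf[symmetric]
  using p_pos p_le_1 by (intro sum_nonneg) (auto intro!: mult_nonneg_nonpos less_imp_le[OF p_pos] simp: ln_le_zero_iff)

text \<open>With the phase fixed, \<open>m\<close> steps of the itinerary reveal \<open>m\<close>
  letters and so every block lying completely within them. A cell has at most the probability of the
  blocks it reveals; integrating minus the logarithm gives one block entropy for each of
  them.\<close>

lemma phase_entropy:
  assumes m: "m > 0" and j: "j < n"
  shows "real (m div n - 1) * block_entropy \<le>
    (\<Sum>B\<in>iterated_partition \<nu> shift letter_partition m. - (phase_measure j B * ln (phase_measure j B)))"
proof -
  define Q where "Q = iterated_partition \<nu> shift letter_partition m"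
  note Qfin = finite_iterated_partition[OF S.shift_measurable letter_partition m, folded Q_def]
  note Qon = iterated_partition_on[OF S.shift_measurable letter_partition m, folded Q_def]
  note Qsets = iterated_partition_sets[OF S.shift_measurable letter_partition m, folded Q_def]
  note itin = iterated_partition_itinerary[OF S.shift_measurable letter_partition m, folded Q_def]
  \<comment> \<open>Block 0 may be cut by the phase. Blocks 1 to \<open>q\<close> begin after every
    phase \<open>j < n\<close> and end before position \<open>m\<close> of the concatenation, so all
    their letters are revealed.\<close>
  define q where "q = m div n - 1"
  define E where "E = (\<lambda>B. {x \<in> space \<Omega>. (shift ^^ j) (cat x) \<in> B})"
  have E: "E B \<in> sets \<Omega>" if "B \<in> Q" for B unfolding E_def by (rule orbit_sets[OF Qsets[OF that]])
  define h where "h = (\<lambda>x :: nat \<Rightarrow> nat list. \<Sum>i\<in>{1..q}. - ln (p (x i)))"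
  have agree: "y i = x i" if B: "B \<in> Q" "x \<in> E B" "y \<in> E B" and i: "i \<in> {1..q}" for B x y i
  proof -
    let ?x = "(shift ^^ j) (cat x)" and ?y = "(shift ^^ j) (cat y)"
    have xy: "x \<in> space \<Omega>" "y \<in> space \<Omega>" "?x \<in> B" "?y \<in> B" using B by (auto simp: E_def)
    have same: "?y k = ?x k" if k: "k < m" for k
    proof -
      have z: "(shift ^^ k) z \<in> cyl [c] \<longleftrightarrow> z k = c" if "z \<in> X" for z c
        using funpow_shift_shift_space[OF that, of k] by (simp add: cylinder_def) (simp add: funpow_shift)
      have c: "?x k \<in> letters" using cat_letters[OF xy(1)] by (simp add: funpow_shift)
      have xc: "(shift ^^ k) ?x \<in> cyl [?x k]" using z[OF orbit_X[OF xy(1)]] by simp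
      then have "cyl [?x k] \<in> letter_partition" using c by (auto simp: letter_partition_def)
      moreover have "?y \<in> space \<nu>" using orbit_X[OF xy(2)] by (simp add: space_nu)
      ultimately have "(shift ^^ k) ?y \<in> cyl [?x k]"
        using itin[OF B(1) xy(3)] xy(4) k xc by blast
      then show ?thesis using z[OF orbit_X[OF xy(2)]] by simp
    qed
    show "y i = x i"
    proof (rule nth_equalityI)
      show "length (y i) = length (x i)" using xy G_len by (simp add: space_Omega)
      fix l assume "l < length (y i)"
      then have l: "l < n" using xy G_len by (simp add: space_Omega)
      have "j \<le> 1 * n + l" using j by simp
      also have "\<dots> \<le> i * n + l" using i by (intro add_right_mono mult_right_mono) auto
      finally have ge: "j \<le> i * n + l" .
      have "i * n + l < (i + 1) * n" using l by simp
      also have "\<dots> \<le> (m div n) * n" using i by (intro mult_right_mono) (auto simp: q_def)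
      also have "\<dots> \<le> m" by simp
      finally have lt: "i * n + l - j < m" by simp
      show "y i ! l = x i ! l"
        using same[OF lt] ge cat_block[OF xy(1) l, of i] cat_block[OF xy(2) l, of i]
        by (simp add: funpow_shift)
    qed
  qed
  have pm: "phase_measure j B \<le> exp (- h x)" if B: "B \<in> Q" "x \<in> E B" for B x
  proof -
    have x: "\<And>i. x i \<in> G" using B by (simp add: E_def space_Omega)
    let ?C = "{y \<in> space \<Omega>. \<forall>i\<in>{1..q}. y i \<in> {x i}}"
    have "{y \<in> space \<Omega>. y i \<in> {x i}} \<in> sets \<Omega>" for i
    proof -
      have "(\<lambda>y. y i) -` {x i} \<inter> space \<Omega> \<in> sets \<Omega>"
        by (rule measurable_sets[OF component_measurable]) (simp add: sets_coin x)
      then show ?thesis by (simp add: vimage_def Int_def conj_commute)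
    qed
    then have "?C \<in> sets \<Omega>" by (intro sets.sets_Collect_finite_All) auto
    then have "phase_measure j B \<le> measure \<Omega> ?C"
      unfolding phase_measure_def E_def[symmetric] using agree[OF B] by (intro O.finite_measure_mono) (auto simp: E_def)
    also have "measure \<Omega> ?C = (\<Prod>i\<in>{1..q}. p (x i))"
    proof -
      have "emeasure \<Omega> ?C = (\<Prod>i\<in>{1..q}. emeasure coin {x i})"
        unfolding \<Omega>_def using x by (intro C.emeasure_PiM_Collect) (auto simp: sets_coin)
      also have "\<dots> = (\<Prod>i\<in>{1..q}. ennreal (p (x i)))"
        using x fin_G by (intro prod.cong refl) (simp add: coin_def emeasure_point_measure_finite)
      also have "\<dots> = ennreal (\<Prod>i\<in>{1..q}. p (x i))" using x p_pos by (intro prod_ennreal) (auto intro: less_imp_le)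
      finally show ?thesis using x p_pos by (simp add: measure_def prod_nonneg less_imp_le)
    qed
    also have "\<dots> = exp (- h x)" using x p_pos by (simp add: h_def sum_negf exp_sum)
    finally show ?thesis .
  qed
  \<comment> \<open>Cells of phase measure 0 are avoided almost surely; for them the logarithm
    carries no information.\<close>
  have "AE x in \<Omega>. h x \<le> (\<Sum>B\<in>Q. - ln (phase_measure j B) * indicator (E B) x)"
  proof -
    have "AE x in \<Omega>. \<forall>B\<in>Q. phase_measure j B = 0 \<longrightarrow> x \<notin> E B"
    proof (rule AE_finite_allI[OF Qfin])
      fix B assume B: "B \<in> Q"
      show "AE x in \<Omega>. phase_measure j B = 0 \<longrightarrow> x \<notin> E B"
      proof (cases "phase_measure j B = 0")
        case True
        then have "E B \<in> null_sets \<Omega>"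
          using E[OF B] by (simp add: phase_measure_def E_def null_sets_def O.emeasure_eq_measure)
        from AE_not_in[OF this] show ?thesis by eventually_elim simp
      qed simp
    qed
    moreover have "AE x in \<Omega>. x \<in> space \<Omega>" by simp
    ultimately show ?thesis
    proof eventually_elim
      case (elim x)
      have "(shift ^^ j) (cat x) \<in> \<Union> Q" using Qon orbit_X[OF elim(2)] by (simp add: partition_on_def space_nu)
      then obtain B where B: "B \<in> Q" "x \<in> E B" using elim(2) by (auto simp: E_def)
      have "x \<in> E C \<longleftrightarrow> C = B" if "C \<in> Q" for C
        using that B Qon by (auto simp: E_def partition_on_def disjoint_def)
      then have "(\<Sum>C\<in>Q. - ln (phase_measure j C) * indicator (E C) x) =
          (\<Sum>C\<in>Q. if C = B then - ln (phase_measure j B) else 0)"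
        by (intro sum.cong) (auto simp: indicator_def)
      also have "\<dots> = - ln (phase_measure j B)" using B Qfin by simp
      finally have eq: "(\<Sum>C\<in>Q. - ln (phase_measure j C) * indicator (E C) x) = - ln (phase_measure j B)" .
      have "phase_measure j B > 0"
        using elim(1) B by (auto simp: phase_measure_def zero_less_measure_iff)
      then have "ln (phase_measure j B) \<le> ln (exp (- h x))" using pm[OF B] by (intro ln_mono)
      then show ?case unfolding eq by simp
    qed
  qed
  moreover have "integrable \<Omega> h" unfolding h_def
    by (intro Bochner_Integration.integrable_sum expectation_component)
  moreover have "integrable \<Omega> (\<lambda>x. \<Sum>B\<in>Q. - ln (phase_measure j B) * indicator (E B) x)"
    using E by (intro Bochner_Integration.integrable_sum integrable_mult_right integrable_real_indicator)
      (auto simp: O.emeasure_eq_measure)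
  ultimately have "(\<integral>x. h x \<partial>\<Omega>) \<le> (\<integral>x. (\<Sum>B\<in>Q. - ln (phase_measure j B) * indicator (E B) x) \<partial>\<Omega>)"
    by (intro integral_mono_AE)
  also have "\<dots> = (\<Sum>B\<in>Q. - ln (phase_measure j B) * measure \<Omega> (E B))"
  proof -
    have i1: "integrable \<Omega> (\<lambda>x. - ln (phase_measure j B) * indicator (E B) x)" if "B \<in> Q" for B
      using E[OF that] by (intro integrable_mult_right integrable_real_indicator) (auto simp: O.emeasure_eq_measure)
    have i2: "(\<integral>x. - ln (phase_measure j B) * indicator (E B) x \<partial>\<Omega>) = - ln (phase_measure j B) * measure \<Omega> (E B)"
      if "B \<in> Q" for B
      using E[OF that] by (simp add: Int_absorb2 sets.sets_into_space)
    show ?thesis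
      by (subst Bochner_Integration.integral_sum[OF i1], assumption) (rule sum.cong[OF refl i2])
  qed
  also have "\<dots> = (\<Sum>B\<in>Q. - (phase_measure j B * ln (phase_measure j B)))"
    by (simp add: phase_measure_def E_def mult.commute)
  also have "(\<integral>x. h x \<partial>\<Omega>) = real q * block_entropy"
    unfolding h_def using expectation_component[of "\<lambda>w. - ln (p w)"]
    by (subst Bochner_Integration.integral_sum) (auto simp: block_entropy_def sum_negf)
  finally show ?thesis by (simp add: q_def Q_def)
qed

text \<open>Concavity of \<open>- t * ln t\<close>, in the form of the tangent line at the average
  \<open>measure \<nu> B\<close>: averaging over phases does not lower the entropy.\<close>

lemma phase_measure_concave:
  assumes B: "B \<in> sets \<nu>"
  shows "(\<Sum>j<n. - (phase_measure j B * ln (phase_measure j B))) \<le> real n * - (measure \<nu> B * ln (measure \<nu> B))"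
proof -
  let ?v = "measure \<nu> B"
  have nn: "phase_measure j B \<ge> 0" for j by (simp add: phase_measure_def)
  have "- (phase_measure j B * ln (phase_measure j B)) \<le> - (phase_measure j B * ln ?v) + (?v - phase_measure j B)"
    if j: "j < n" for j
  proof (cases "phase_measure j B = 0")
    case False
    then have p: "phase_measure j B > 0" using nn[of j] by simp
    have "phase_measure j B \<le> (\<Sum>j<n. phase_measure j B)" using j nn by (intro member_le_sum) auto
    then have "0 < real n * ?v" using p nu_measure[OF B] by simp
    then have v: "?v > 0" by (simp add: zero_less_mult_iff)
    have "ln (?v / phase_measure j B) \<le> ?v / phase_measure j B - 1"
      using p v by (intro ln_le_minus_one) simp
    then have "phase_measure j B * ln (?v / phase_measure j B) \<le> phase_measure j B * (?v / phase_measure j B - 1)"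
      using p by (intro mult_left_mono) auto
    also have "\<dots> = ?v - phase_measure j B" using p by (simp add: field_simps)
    finally show ?thesis using p v by (simp add: ln_div algebra_simps)
  qed simp
  then have "(\<Sum>j<n. - (phase_measure j B * ln (phase_measure j B)))
      \<le> (\<Sum>j<n. - (phase_measure j B * ln ?v) + (?v - phase_measure j B))"
    by (intro sum_mono) auto
  also have "\<dots> = - (\<Sum>j<n. phase_measure j B) * ln ?v + (real n * ?v - (\<Sum>j<n. phase_measure j B))"
    by (simp add: sum.distrib sum_subtractf sum_distrib_right sum_negf)
  also have "\<dots> = real n * - (?v * ln ?v)" by (simp flip: nu_measure[OF B])
  finally show ?thesis .
qed

lemma nu_entropy: "measure_entropy \<nu> shift \<ge> ereal (block_entropy / real n)"
proof -
  have lower: "real (m div n - 1) * block_entropy \<le> partition_entropy \<nu> (iterated_partition \<nu> shift letter_partition m)"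
    if m: "m > 0" for m
  proof -
    define Q where "Q = iterated_partition \<nu> shift letter_partition m"
    have "real n * (real (m div n - 1) * block_entropy)
        \<le> (\<Sum>j<n. \<Sum>B\<in>Q. - (phase_measure j B * ln (phase_measure j B)))"
      using sum_mono[of "{..<n}" "\<lambda>_. real (m div n - 1) * block_entropy"] phase_entropy[OF m]
      by (simp add: Q_def)
    also have "\<dots> = (\<Sum>B\<in>Q. \<Sum>j<n. - (phase_measure j B * ln (phase_measure j B)))" by (rule sum.swap)
    also have "\<dots> \<le> (\<Sum>B\<in>Q. real n * - (measure \<nu> B * ln (measure \<nu> B)))"
      using iterated_partition_sets[OF S.shift_measurable letter_partition m]
      by (intro sum_mono phase_measure_concave) (simp add: Q_def)
    also have "\<dots> = real n * partition_entropy \<nu> Q"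
      by (simp add: partition_entropy_def sum_distrib_left sum_negf)
    finally show ?thesis using n_pos by (simp add: Q_def)
  qed
  have "\<forall>\<^sub>F m in sequentially. ereal (block_entropy / real n - 2 * block_entropy * (1 / real m))
      \<le> ereal (partition_entropy \<nu> (iterated_partition \<nu> shift letter_partition m) / real m)"
    using eventually_gt_at_top[of 0]
  proof eventually_elim
    case (elim m)
    have "real m / real n < real (m div n) + 1"
    proof -
      have "m < n * (m div n) + n"
        using n_pos by (metis mod_less_divisor mult_div_mod_eq add_less_cancel_left)
      then have "real m < real (n * (m div n) + n)" by linarith
      then show ?thesis using n_pos by (simp add: field_simps)
    qed
    \<comment> \<open>Rounding and the cut block cost at most two blocks, which vanish after
      division by \<open>m\<close>.\<close>
    then have "real m / real n - 2 \<le> real (m div n - 1)" by linarith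
    then have "(real m / real n - 2) * block_entropy \<le> real (m div n - 1) * block_entropy"
      using block_entropy_nonneg by (intro mult_right_mono)
    also have "\<dots> \<le> partition_entropy \<nu> (iterated_partition \<nu> shift letter_partition m)" by (rule lower[OF elim])
    finally have "(real m / real n - 2) * block_entropy / real m
        \<le> partition_entropy \<nu> (iterated_partition \<nu> shift letter_partition m) / real m"
      by (rule divide_right_mono) simp
    moreover have "(real m / real n - 2) * block_entropy / real m = block_entropy / real n - 2 * block_entropy * (1 / real m)"
      using elim by (simp add: field_simps)
    ultimately show ?case by simp
  qed
  then have "limsup (\<lambda>m. ereal (block_entropy / real n - 2 * block_entropy * (1 / real m)))
      \<le> entropy_wrt_partition \<nu> shift letter_partition"
    unfolding entropy_wrt_partition_def by (rule Limsup_mono)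
  moreover have "limsup (\<lambda>m. ereal (block_entropy / real n - 2 * block_entropy * (1 / real m))) = ereal (block_entropy / real n)"
  proof (rule lim_imp_Limsup)
    have "(\<lambda>m. block_entropy / real n - 2 * block_entropy * (1 / real m)) \<longlonglongrightarrow> block_entropy / real n - 2 * block_entropy * 0"
      by (intro tendsto_diff tendsto_mult tendsto_const lim_1_over_n)
    then show "(\<lambda>m. ereal (block_entropy / real n - 2 * block_entropy * (1 / real m))) \<longlonglongrightarrow> ereal (block_entropy / real n)"
      by simp
  qed simp
  moreover have "entropy_wrt_partition \<nu> shift letter_partition \<le> measure_entropy \<nu> shift"
    unfolding measure_entropy_def using letter_partition by (intro SUP_upper) auto
  ultimately show ?thesis by simp
qed

end

section \<open>Weights of uniquely decodable sets of periodic words\<close>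

lemma sum_prod_lists:
  fixes W :: "'a \<Rightarrow> real"
  assumes "finite G"
  shows "(\<Sum>ls\<in>{ls. set ls \<subseteq> G \<and> length ls = j}. prod_list (map W ls)) = (\<Sum>w\<in>G. W w) ^ j"
proof (induction j)
  case 0
  have "{ls. set ls \<subseteq> G \<and> length ls = 0} = {[]}" by auto
  then show ?case by simp
next
  case (Suc j)
  let ?T = "\<lambda>j. {ls. set ls \<subseteq> G \<and> length ls = j}"
  have "?T (Suc j) = (\<lambda>(w, ls). w # ls) ` (G \<times> ?T j)"
    by (auto simp: image_iff length_Suc_conv)
  then have "(\<Sum>ls\<in>?T (Suc j). prod_list (map W ls)) = (\<Sum>(w, ls)\<in>G \<times> ?T j. W w * prod_list (map W ls))"
    by (simp only:, subst sum.reindex) (auto simp: inj_on_def intro!: sum.cong)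
  also have "\<dots> = (\<Sum>w\<in>G. W w) * (\<Sum>ls\<in>?T j. prod_list (map W ls))"
    by (simp add: sum_product sum.cartesian_product)
  finally show ?case by (simp add: Suc.IH)
qed

lemma not_linear_bound:
  fixes r :: real
  assumes "r > 1"
  shows "\<exists>m>0. r ^ m > real (m * N + 1)"
proof -
  have x: "norm (1 / r) < 1" using assms by simp
  have "(\<lambda>m. real N * (real m * (1 / r) ^ m) + (1 / r) ^ m) \<longlonglongrightarrow> real N * 0 + 0"
    by (intro tendsto_add tendsto_mult tendsto_const powser_times_n_limit_0[OF x] LIMSEQ_power_zero[OF x])
  then have "(\<lambda>m. real N * (real m * (1 / r) ^ m) + (1 / r) ^ m) \<longlonglongrightarrow> 0" by simp
  then have "\<forall>\<^sub>F m in sequentially. real N * (real m * (1 / r) ^ m) + (1 / r) ^ m < 1"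
    by (rule order_tendstoD(2)) simp
  then have "\<forall>\<^sub>F m in sequentially. real N * (real m * (1 / r) ^ m) + (1 / r) ^ m < 1 \<and> m > 0"
    using eventually_gt_at_top[of 0] by (rule eventually_conj)
  then obtain m where m: "real N * (real m * (1 / r) ^ m) + (1 / r) ^ m < 1" "m > 0"
    unfolding eventually_sequentially by blast
  have "(real (m * N + 1)) * (1 / r) ^ m < 1" using m(1) by (simp add: algebra_simps)
  then have "real (m * N + 1) < r ^ m" using assms by (simp add: power_divide field_simps)
  with m(2) show ?thesis by blast
qed

context induced_system
begin

definition ratio_bound :: "real \<Rightarrow> bool" where
  "ratio_bound b \<longleftrightarrow> (\<forall>\<nu>\<in>ergodic_compact_measures I A.
     measure_entropy \<nu> shift / ereal (\<integral>x. \<psi> x \<partial>\<nu>) + ereal ((\<integral>x. \<phi> x \<partial>\<nu>) / (\<integral>x. \<psi> x \<partial>\<nu>)) \<le> ereal b)"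

text \<open>For probabilities proportional to the weights, block entropy plus mean logarithmic
  weight is exactly \<open>ln Z\<close>. The ratio bound for the Bernoulli measure of these blocks,
  multiplied out, leaves only the errors made in replacing mean values of \<Phi> and \<Psi> by
  integrals.\<close>

lemma weight_sum_fixed_length:
  assumes b: "ratio_bound b" and G: "finite G" "G \<subseteq> per" "\<And>w. w \<in> G \<Longrightarrow> length w = n"
  shows "sum (weight b) G \<le> exp (dist_const b)"
proof (cases "G = {}")
  case False
  define Z where "Z = sum (weight b) G"
  have Z: "Z > 0" unfolding Z_def using G False weight_pos by (intro sum_pos) auto
  define p where "p = (\<lambda>w. weight b w / Z)"
  interpret B: block_system I A a G n p
  proof
    show "(\<Sum>w\<in>G. p w) = 1" using Z by (simp add: p_def Z_def flip: sum_divide_distrib)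
  qed (use G Z weight_pos in \<open>auto simp: p_def\<close>)
  have s: "\<bar>birkhoff_sum f n y - sup_sum I A f w\<bar> \<le> K"
    if f: "bounded_distortion I A f K" and "w \<in> G" "y \<in> cyl w" for f w y
    using sup_sum_bounds(1,2)[OF f that(3)] G(3)[OF that(2)] K_nonneg by (simp add: abs_le_iff)
  note phi = B.birkhoff_integral[OF hoelder_continuous_on[OF hoelder(1)] distortion(1) s[OF distortion(1)]]
  note psi = B.birkhoff_integral[OF hoelder_continuous_on[OF hoelder(2)] distortion(2) s[OF distortion(2)]]
  define x where "x = (\<integral>y. \<phi> y \<partial>B.\<nu>)"
  define y where "y = (\<integral>y. \<psi> y \<partial>B.\<nu>)"
  have y: "y > 0" unfolding y_def
    by (intro B.N.expectation_greater psi(1) AE_I2) (simp_all add: psi_pos B.space_nu)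
  have n: "real n > 0" using B.n_pos by simp
  have "ereal (B.block_entropy / real n) / ereal y \<le> measure_entropy B.\<nu> shift / ereal y"
    using y B.nu_entropy by (intro ereal_divide_right_mono) auto
  then have "ereal (B.block_entropy / real n) / ereal y + ereal (x / y)
      \<le> measure_entropy B.\<nu> shift / ereal y + ereal (x / y)" by (rule add_right_mono)
  also have "\<dots> \<le> ereal b" using b B.nu_ergodic_compact unfolding ratio_bound_def x_def y_def by blast
  finally have "B.block_entropy / real n / y + x / y \<le> b" using y by simp
  then have le: "B.block_entropy \<le> b * (real n * y) - real n * x" using y n by (simp add: field_simps)
  have "B.block_entropy = - (\<Sum>w\<in>G. p w * ((\<Phi> w - b * \<Psi> w) - ln Z))"
    unfolding B.block_entropy_def using Z by (simp add: p_def weight_def ln_div)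
  also have "\<dots> = (\<Sum>w\<in>G. p w) * ln Z - (\<Sum>w\<in>G. p w * \<Phi> w) + b * (\<Sum>w\<in>G. p w * \<Psi> w)"
    by (simp add: algebra_simps sum_subtractf sum.distrib sum_distrib_left sum_distrib_right)
  finally have "ln Z = B.block_entropy + (\<Sum>w\<in>G. p w * \<Phi> w) - b * (\<Sum>w\<in>G. p w * \<Psi> w)"
    by (simp add: B.p_sum)
  also have "\<dots> \<le> ((\<Sum>w\<in>G. p w * \<Phi> w) - real n * x) + b * (real n * y - (\<Sum>w\<in>G. p w * \<Psi> w))"
    using le by (simp add: algebra_simps)
  also have "\<dots> \<le> K + \<bar>b\<bar> * K"
    using phi(2) psi(2) unfolding x_def y_def by (intro add_mono mult_le_abs_mult) (simp_all add: abs_le_iff)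
  also have "\<dots> \<le> dist_const b" using K_nonneg by (simp add: dist_const_def algebra_simps)
  finally have "exp (ln Z) \<le> exp (dist_const b)" by (simp only: exp_le_cancel_iff)
  then show ?thesis using Z by (simp only: exp_ln Z_def)
qed simp

lemma concat_per: "ls \<noteq> [] \<Longrightarrow> set ls \<subseteq> per \<Longrightarrow> concat ls \<in> per"
proof (induction ls)
  case (Cons w ls)
  then show ?case using per_append by (cases "ls = []") auto
qed simp

text \<open>Each of the \<open>length ls - 1\<close> junctions costs one distortion factor.\<close>

lemma prod_list_weight_le:
  "ls \<noteq> [] \<Longrightarrow> set ls \<subseteq> per \<Longrightarrow>
    prod_list (map (weight b) ls) \<le> exp (dist_const b) ^ (length ls - 1) * weight b (concat ls)"
proof (induction ls)
  case (Cons w ls)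
  show ?case
  proof (cases "ls = []")
    case False
    then have ls: "concat ls \<in> per" "w \<in> per" using Cons.prems concat_per by auto
    then have "w @ concat ls \<in> words I A" using per_append by (auto simp: periodic_words_iff)
    have "prod_list (map (weight b) (w # ls)) \<le> weight b w * (exp (dist_const b) ^ (length ls - 1) * weight b (concat ls))"
      using Cons False weight_pos[of b w] by (simp add: mult_left_mono)
    also have "\<dots> = exp (dist_const b) ^ (length ls - 1) * (weight b w * weight b (concat ls))" by simp
    also have "\<dots> \<le> exp (dist_const b) ^ (length ls - 1) * (exp (dist_const b) * weight b (w @ concat ls))"
      by (intro mult_left_mono weight_append(2) \<open>w @ concat ls \<in> words I A\<close>) simp
    also have "\<dots> = exp (dist_const b) ^ length ls * weight b (w @ concat ls)"
      using False by (cases ls) (simp_all add: mult_ac)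
    finally show ?thesis by simp
  qed simp
qed simp

text \<open>The power \<open>Z ^ m\<close> expands over lists of \<open>m\<close> words. By unique
  decodability their concatenations are distinct periodic words with at most
  \<open>m * N + 1\<close> different lengths, and each length class is bounded by \<open>D\<close>.
  Together with the \<open>m - 1\<close> junctions this gives
  \<open>(Z / D) ^ m \<le> m * N + 1\<close> for all \<open>m\<close>, which rules out
  \<open>Z > D\<close>.\<close>

lemma weight_sum_decodable:
  assumes b: "ratio_bound b" and G: "finite G" "G \<subseteq> per"
    and inj: "\<And>j. inj_on concat {ls. set ls \<subseteq> G \<and> length ls = j}"
  shows "sum (weight b) G \<le> exp (dist_const b)"
proof (rule ccontr)
  assume neg: "\<not> (sum (weight b) G) \<le> exp (dist_const b)"
  define D where "D = exp (dist_const b)"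
  have D: "D \<ge> 1" using dist_const_nonneg by (simp add: D_def)
  define Z where "Z = sum (weight b) G"
  have r: "Z / D > 1" using neg D by (simp add: Z_def D_def)
  define N where "N = (\<Sum>w\<in>G. length w)"
  have N: "length w \<le> N" if "w \<in> G" for w unfolding N_def using that G(1) by (intro member_le_sum) auto
  obtain m where m: "m > 0" "(Z / D) ^ m > real (m * N + 1)" using not_linear_bound[OF r] by blast
  let ?T = "{ls. set ls \<subseteq> G \<and> length ls = m}"
  have finT: "finite ?T" using G(1) by (rule finite_lists_length_eq)
  have len: "length (concat ls) \<le> m * N" if "ls \<in> ?T" for ls
  proof -
    have "length (concat ls) \<le> (\<Sum>w\<leftarrow>ls. N)"
      using that N unfolding length_concat by (intro sum_list_mono) auto
    then show ?thesis using that by (simp add: sum_list_triv)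
  qed
  have Tper: "concat ls \<in> per" if "ls \<in> ?T" for ls
    using that G(2) m(1) by (intro concat_per) auto
  have "Z ^ m = (\<Sum>ls\<in>?T. prod_list (map (weight b) ls))" unfolding Z_def by (rule sum_prod_lists[OF G(1), symmetric])
  also have "\<dots> \<le> (\<Sum>ls\<in>?T. D ^ (m - 1) * weight b (concat ls))"
  proof (rule sum_mono)
    fix ls assume "ls \<in> ?T"
    then have "ls \<noteq> []" "set ls \<subseteq> per" "length ls = m" using m(1) G(2) by auto
    then show "prod_list (map (weight b) ls) \<le> D ^ (m - 1) * weight b (concat ls)"
      using prod_list_weight_le[of ls b] by (simp add: D_def)
  qed
  also have "\<dots> = D ^ (m - 1) * (\<Sum>w\<in>concat ` ?T. weight b w)"
    by (simp add: sum_distrib_left sum.reindex[OF inj])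
  also have "(\<Sum>w\<in>concat ` ?T. weight b w) = (\<Sum>l\<le>m * N. \<Sum>w\<in>{w \<in> concat ` ?T. length w = l}. weight b w)"
    using finT len by (intro sum.group[symmetric]) auto
  also have "\<dots> \<le> (\<Sum>l\<le>m * N. D)"
    unfolding D_def using finT Tper by (intro sum_mono weight_sum_fixed_length[OF b]) auto
  also have "\<dots> = real (m * N + 1) * D" by simp
  finally have "Z ^ m \<le> D ^ (m - 1) * (real (m * N + 1) * D)" using D by (simp add: mult_left_mono)
  also have "\<dots> = real (m * N + 1) * D ^ m" using m(1) by (cases m) simp_all
  finally have "(Z / D) ^ m \<le> real (m * N + 1)" using D by (simp add: power_divide divide_le_eq)
  with m(2) show False by simp
qed

section \<open>First-return loops\<close>

definition loops :: "nat list set" where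
  "loops = {w \<in> per. a \<notin> set (tl w)}"

definition loop_lists :: "nat \<Rightarrow> nat list list set" where
  "loop_lists k = {ls. set ls \<subseteq> loops \<and> length ls = k}"

lemma loops_Cons: "w \<in> loops \<Longrightarrow> \<exists>u. w = a # u \<and> a \<notin> set u"
  using words_hd_last by (cases w) (auto simp: loops_def periodic_words_iff)

text \<open>The letter \<open>a\<close> stands at the beginning of every loop and nowhere else, so
  it marks the cuts.\<close>

lemma loops_decode: "set ls \<subseteq> loops \<Longrightarrow> set ls' \<subseteq> loops \<Longrightarrow> concat ls = concat ls' \<Longrightarrow> ls = ls'"
proof (induction ls arbitrary: ls')
  case Nil
  then show ?case using loops_Cons by (cases ls') auto
next
  case (Cons w ls)
  obtain u where u: "w = a # u" "a \<notin> set u" using loops_Cons Cons.prems by auto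
  then obtain w' ls2 where ls': "ls' = w' # ls2" using Cons.prems by (cases ls') auto
  then obtain u' where u': "w' = a # u'" "a \<notin> set u'" using loops_Cons Cons.prems by auto
  have tw: "takeWhile (\<lambda>c. c \<noteq> a) (v @ concat l) = v" if v0: "a \<notin> set v" and l0: "set l \<subseteq> loops" for v l
  proof -
    have v: "\<And>c. c \<in> set v \<Longrightarrow> c \<noteq> a" using v0 by metis
    show ?thesis
    proof (cases l)
      case Nil
      then show ?thesis using v by (simp add: takeWhile_eq_all_conv)
    next
      case (Cons z zs)
      then obtain t where "z = a # t" using loops_Cons[of z] l0 Cons by auto
      then show ?thesis using v Cons by (simp add: takeWhile_append2)
    qed
  qed
  have "u @ concat ls = u' @ concat ls2" using Cons.prems u u' ls' by simp
  moreover from this have "u = u'"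
    using tw[OF u(2), of ls] tw[OF u'(2), of ls2] Cons.prems ls' by simp
  ultimately show ?case using Cons u u' ls' by simp
qed

text \<open>Cutting before the second occurrence of \<open>a\<close> leaves a loop and a shorter
  periodic word.\<close>

lemma per_decompose: "w \<in> per \<Longrightarrow> \<exists>ls. set ls \<subseteq> loops \<and> concat ls = w"
proof (induction "length w" arbitrary: w rule: less_induct)
  case less
  obtain u where u: "w = a # u" using less.prems words_hd_last by (cases w) (auto simp: periodic_words_iff)
  define u1 u2 where "u1 = takeWhile (\<lambda>c. c \<noteq> a) u" and "u2 = dropWhile (\<lambda>c. c \<noteq> a) u"
  have uu: "u = u1 @ u2" by (simp add: u1_def u2_def)
  have u1: "a \<notin> set u1" by (auto simp: u1_def dest: set_takeWhileD)
  show ?case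
  proof (cases "u2 = []")
    case True
    then have "w \<in> loops" using less.prems u u1 uu by (simp add: loops_def)
    then show ?thesis by (intro exI[of _ "[w]"]) simp
  next
    case False
    then have hd: "hd u2 = a" unfolding u2_def using hd_dropWhile[of "\<lambda>c. c \<noteq> a" u] by simp
    have "(a # u1) @ u2 \<in> words I A" using less.prems u uu by (simp add: periodic_words_iff)
    then have w: "a # u1 \<in> words I A" "u2 \<in> words I A" "A (last (a # u1)) a = 1"
      using words_append_iff[of "a # u1" u2 I A] False hd by auto
    have "u2 \<in> per" using w hd less.prems u uu False by (simp add: periodic_words_iff)
    moreover have "length u2 < length w" using u uu by simp
    ultimately obtain ls where ls: "set ls \<subseteq> loops" "concat ls = u2" using less.hyps by blast
    have "a # u1 \<in> loops" using w u1 by (simp add: loops_def periodic_words_iff)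
    then show ?thesis using ls u uu by (intro exI[of _ "(a # u1) # ls"]) simp
  qed
qed

lemma loops_per: "loops \<subseteq> per"
  by (auto simp: loops_def)

text \<open>Concatenations of exactly \<open>k\<close> loops are uniquely decodable: decode into
  loops, then group them by \<open>k\<close>. The bound is the same for all \<open>k\<close>, as the
  interpolation below requires.\<close>

lemma weight_sum_loop_lists:
  assumes b: "ratio_bound b" and F: "finite F" "F \<subseteq> loop_lists k" and k: "k > 0"
  shows "(\<Sum>ls\<in>F. weight b (concat ls)) \<le> exp (dist_const b)"
proof -
  have inj: "inj_on concat F"
  proof (rule inj_onI)
    fix x y assume xy: "x \<in> F" "y \<in> F" "concat x = concat y"
    then have "set x \<subseteq> loops" "set y \<subseteq> loops" using F(2) by (auto simp: loop_lists_def)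
    then show "x = y" using xy(3) by (rule loops_decode)
  qed
  define G where "G = concat ` F"
  define dec where "dec = the_inv_into F concat"
  have dec: "dec g \<in> F" "concat (dec g) = g" if "g \<in> G" for g
    using that inj unfolding dec_def G_def by (auto simp: the_inv_into_into f_the_inv_into_f)
  have "(\<Sum>ls\<in>F. weight b (concat ls)) = sum (weight b) G"
    unfolding G_def by (simp add: sum.reindex[OF inj])
  also have "\<dots> \<le> exp (dist_const b)"
  proof (rule weight_sum_decodable[OF b])
    show "finite G" using F by (simp add: G_def)
    show "G \<subseteq> per"
    proof
      fix g assume "g \<in> G"
      then obtain ls where "ls \<in> F" "g = concat ls" by (auto simp: G_def)
      moreover from this have "ls \<in> loop_lists k" using F(2) by blast
      then have "set ls \<subseteq> per" "ls \<noteq> []" using k loops_per by (auto simp: loop_lists_def)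
      ultimately show "g \<in> per" using concat_per by simp
    qed
    fix j
    show "inj_on concat {gs. set gs \<subseteq> G \<and> length gs = j}"
    proof (rule inj_onI)
      fix gs gs' assume gs: "gs \<in> {gs. set gs \<subseteq> G \<and> length gs = j}" "gs' \<in> {gs. set gs \<subseteq> G \<and> length gs = j}"
        "concat gs = concat gs'"
      have c: "concat (concat (map dec l)) = concat l" "set (concat (map dec l)) \<subseteq> loops" "map concat (map dec l) = l"
        if "set l \<subseteq> G" for l
      proof -
        show "map concat (map dec l) = l" using that dec(2) by (induction l) auto
        moreover have "concat (concat xss) = concat (map concat xss)" for xss :: "nat list list list"
          by (induction xss) auto
        ultimately show "concat (concat (map dec l)) = concat l" by metis
        show "set (concat (map dec l)) \<subseteq> loops" using that dec(1) F(2) by (fastforce simp: loop_lists_def)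
      qed
      have "concat (map dec gs) = concat (map dec gs')"
        using gs c by (intro loops_decode) auto
      moreover have "length (dec g) = k" if "g \<in> G" for g using dec(1)[OF that] F(2) by (auto simp: loop_lists_def)
      \<comment> \<open>All groups have the same size \<open>k\<close>, so their boundaries within
        the list of loops are forced.\<close>
      ultimately have "map dec gs = map dec gs'"
        using gs by (intro concat_injective) (auto simp: in_set_zip subset_eq)
      then show "gs = gs'" using gs c(3) by (metis (no_types, lifting) mem_Collect_eq)
    qed
  qed
  finally show ?thesis .
qed

end

section \<open>Exponential decay of the weights of long lists of loops\<close>

lemma finite_tail:
  fixes W :: "'a \<Rightarrow> real"
  assumes W: "\<And>x. x \<in> S \<Longrightarrow> W x \<ge> 0" and B: "\<And>F. finite F \<Longrightarrow> F \<subseteq> S \<Longrightarrow> sum W F \<le> B" and e: "e > 0"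
  shows "\<exists>L. finite L \<and> L \<subseteq> S \<and> (\<forall>F. finite F \<longrightarrow> F \<subseteq> S - L \<longrightarrow> sum W F \<le> e)"
proof -
  let ?\<F> = "{F. finite F \<and> F \<subseteq> S}"
  have ne: "?\<F> \<noteq> {}" by blast
  have bdd: "bdd_above (sum W ` ?\<F>)" using B by (auto simp: bdd_above_def)
  have "(SUP F\<in>?\<F>. sum W F) - e < (SUP F\<in>?\<F>. sum W F)" using e by simp
  then obtain L where L: "finite L" "L \<subseteq> S" "(SUP F\<in>?\<F>. sum W F) - e < sum W L"
    using less_cSUP_iff[OF ne bdd] by blast
  have "sum W F \<le> e" if F: "finite F" "F \<subseteq> S - L" for F
  proof -
    have "sum W (F \<union> L) \<le> (SUP F\<in>?\<F>. sum W F)"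
      using F L by (intro cSUP_upper[OF _ bdd]) auto
    moreover have "sum W (F \<union> L) = sum W F + sum W L" using F L by (intro sum.union_disjoint) auto
    ultimately show ?thesis using L(3) by linarith
  qed
  with L show ?thesis by blast
qed

context induced_system
begin

section \<open>Weights that are exactly submultiplicative\<close>

definition inf_sum :: "nat list \<Rightarrow> real" where
  "inf_sum w = (INF x\<in>cyl w. birkhoff_sum \<psi> (length w) x)"

text \<open>Taking the infimum for \<psi> and the supremum for \<phi> gives exact
  submultiplicativity when \<open>b \<ge> 0\<close>. Distortion is paid once, in the comparison with
  \<open>weight\<close>, and not at every junction, where it could outweigh a contraction.\<close>

definition upper_weight :: "real \<Rightarrow> nat list list \<Rightarrow> real" where
  "upper_weight b ls = exp (\<Phi> (concat ls) - b * inf_sum (concat ls))"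

lemma inf_sum_le: "x \<in> cyl w \<Longrightarrow> inf_sum w \<le> birkhoff_sum \<psi> (length w) x"
  unfolding inf_sum_def
  by (intro cINF_lower bdd_belowI2[where m = 0]) (auto intro: birkhoff_sum_psi_nonneg cylinder_shift_space)

lemma inf_sum_ge: "cyl w \<noteq> {} \<Longrightarrow> (\<And>x. x \<in> cyl w \<Longrightarrow> c \<le> birkhoff_sum \<psi> (length w) x) \<Longrightarrow> c \<le> inf_sum w"
  unfolding inf_sum_def by (rule cINF_greatest)

lemma inf_sum_nonneg: "cyl w \<noteq> {} \<Longrightarrow> 0 \<le> inf_sum w"
  by (rule inf_sum_ge) (auto intro: birkhoff_sum_psi_nonneg cylinder_shift_space)

lemma inf_sum_sup_sum:
  assumes "cyl w \<noteq> {}"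
  shows "inf_sum w \<le> \<Psi> w" "\<Psi> w - K \<le> inf_sum w"
proof -
  obtain x where x: "x \<in> cyl w" using assms by blast
  show "inf_sum w \<le> \<Psi> w"
    using inf_sum_le[OF x] sup_sum_bounds(1)[OF distortion(2) x] by linarith
  show "\<Psi> w - K \<le> inf_sum w"
  proof (rule inf_sum_ge[OF assms])
    fix y assume "y \<in> cyl w"
    from sup_sum_bounds(2)[OF distortion(2) this] show "\<Psi> w - K \<le> birkhoff_sum \<psi> (length w) y" by linarith
  qed
qed

lemma inf_sum_append:
  assumes "cyl (u @ v) \<noteq> {}"
  shows "inf_sum u + inf_sum v \<le> inf_sum (u @ v)"
proof (rule inf_sum_ge[OF assms])
  fix x assume "x \<in> cyl (u @ v)"
  then have "x \<in> cyl u" "(shift ^^ length u) x \<in> cyl v" by (auto simp: cylinder_append)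
  from this[THEN inf_sum_le] show "inf_sum u + inf_sum v \<le> birkhoff_sum \<psi> (length (u @ v)) x"
    by (simp add: birkhoff_sum_add)
qed

lemma sup_sum_phi_append:
  assumes "cyl (u @ v) \<noteq> {}"
  shows "\<Phi> (u @ v) \<le> \<Phi> u + \<Phi> v"
  unfolding sup_sum_def[of I A \<phi> "u @ v"]
proof (rule cSUP_least[OF assms])
  fix x assume "x \<in> cyl (u @ v)"
  then have "x \<in> cyl u" "(shift ^^ length u) x \<in> cyl v" by (auto simp: cylinder_append)
  from this[THEN sup_sum_bounds(1)[OF distortion(1)]]
  show "birkhoff_sum \<phi> (length (u @ v)) x \<le> \<Phi> u + \<Phi> v"
    by (simp add: birkhoff_sum_add)
qed

lemma loops_cylinder: "set ls \<subseteq> loops \<Longrightarrow> cyl (concat ls) \<noteq> {}"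
proof (cases "ls = []")
  case True
  obtain x where "x \<in> X" using point_from[OF a_in] .
  then show ?thesis using True by (auto simp: cylinder_def)
next
  case False
  assume "set ls \<subseteq> loops"
  then have "concat ls \<in> words I A"
    using concat_per[OF False] loops_per by (simp add: periodic_words_iff subset_iff)
  then show ?thesis using cylinder_nonempty by blast
qed

lemma upper_weight_nonneg [simp]: "upper_weight b ls \<ge> 0"
  by (simp add: upper_weight_def)

lemma upper_weight_Nil: "upper_weight b [] = 1"
proof -
  have "cyl [] \<noteq> {}" using loops_cylinder[of "[]"] by simp
  then show ?thesis by (simp add: upper_weight_def sup_sum_def inf_sum_def)
qed

lemma upper_weight_append:
  assumes ls: "set (ls @ ls') \<subseteq> loops" and b: "b \<ge> 0"
  shows "upper_weight b (ls @ ls') \<le> upper_weight b ls * upper_weight b ls'"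
proof -
  have ne: "cyl (concat ls @ concat ls') \<noteq> {}" using loops_cylinder[OF ls] by simp
  have "b * (inf_sum (concat ls) + inf_sum (concat ls')) \<le> b * inf_sum (concat ls @ concat ls')"
    using b inf_sum_append[OF ne] by (rule mult_left_mono[rotated])
  then show ?thesis
    unfolding upper_weight_def exp_add[symmetric] using sup_sum_phi_append[OF ne]
    by (simp add: algebra_simps)
qed

lemma upper_weight_antimono:
  "set ls \<subseteq> loops \<Longrightarrow> b \<le> b' \<Longrightarrow> upper_weight b' ls \<le> upper_weight b ls"
  unfolding upper_weight_def using inf_sum_nonneg[OF loops_cylinder] by (simp add: mult_right_mono)

lemma weight_le_upper_weight:
  "set ls \<subseteq> loops \<Longrightarrow> b \<ge> 0 \<Longrightarrow> weight b (concat ls) \<le> upper_weight b ls"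
  unfolding upper_weight_def weight_def
  using inf_sum_sup_sum(1)[OF loops_cylinder] by (simp add: mult_left_mono)

text \<open>The factor is the cost of passing from the infimum to the supremum of \<psi>. Raising a
  possibly negative \<open>b\<close> to \<open>b0\<close> only lowers weights, because \<Psi> is
  nonnegative.\<close>

lemma upper_weight_le_weight:
  assumes ls: "set ls \<subseteq> loops" "ls \<noteq> []" and b: "b \<le> b0" "b0 \<ge> 0"
  shows "upper_weight b0 ls \<le> exp (b0 * K) * weight b (concat ls)"
proof -
  have "concat ls \<in> per" using concat_per[OF ls(2)] ls(1) loops_per by blast
  then have "0 \<le> \<Psi> (concat ls)" by (simp add: sup_sum_psi_nonneg periodic_words_iff)
  then have "b * \<Psi> (concat ls) \<le> b0 * \<Psi> (concat ls)"
    using b(1) by (intro mult_right_mono)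
  moreover have "b0 * (\<Psi> (concat ls) - K) \<le> b0 * inf_sum (concat ls)"
    using inf_sum_sup_sum(2)[OF loops_cylinder[OF ls(1)]] b(2) by (rule mult_left_mono)
  ultimately show ?thesis
    unfolding upper_weight_def weight_def exp_add[symmetric] by (simp add: algebra_simps)
qed

text \<open>
  A compactness argument: along an infinite concatenation \<open>y\<close> of loops the infima over the
  cylinders cannot all vanish, since \<open>\<psi>\<close> is bounded below near \<open>y\<close> by \<open>\<psi> y / 2 > 0\<close>.
\<close>

lemma inf_sum_pos_eventually:
  assumes L: "\<And>i. finite (L i)" "\<And>i. L i \<subseteq> loops"
  shows "\<exists>q. \<forall>ls. length ls = q \<and> (\<forall>i<q. ls ! i \<in> L i) \<longrightarrow> inf_sum (concat ls) > 0"
proof (rule ccontr)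
  assume neg: "\<not> ?thesis"
  define tr where "tr = (\<lambda>ls. \<forall>i<length ls. ls ! i \<in> L i)"
  define bad where "bad = (\<lambda>ls. tr ls \<and> inf_sum (concat ls) \<le> 0)"
  have tr_loops: "set ls \<subseteq> loops" if "tr ls" for ls
    using that L(2) by (fastforce simp: tr_def in_set_conv_nth)
  have tr_prefix: "tr ls" if "tr (ls @ ls')" for ls ls'
    unfolding tr_def
  proof (intro allI impI)
    fix i assume i: "i < length ls"
    then have "(ls @ ls') ! i \<in> L i" using that unfolding tr_def by simp
    then show "ls ! i \<in> L i" using i by (simp add: nth_append)
  qed
  have bad_prefix: "bad ls" if "bad (ls @ ls')" for ls ls'
  proof -
    have t: "tr (ls @ ls')" "tr ls" using that tr_prefix by (auto simp: bad_def)
    have "set (ls @ ls') \<subseteq> loops" by (rule tr_loops[OF t(1)])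
    then have "set ls' \<subseteq> loops" by simp
    then have "inf_sum (concat ls) \<le> inf_sum (concat (ls @ ls'))"
      using inf_sum_append[of "concat ls" "concat ls'"] inf_sum_nonneg[OF loops_cylinder, of ls']
        loops_cylinder[OF tr_loops[OF t(1)]] by simp
    then show ?thesis using that t by (simp add: bad_def)
  qed
  \<comment> \<open>Koenig's lemma: a list is kept while it has bad extensions of every length, and
    since each \<open>L i\<close> is finite, such a list can always be prolonged by one
    loop.\<close>
  define ext where "ext = (\<lambda>u. \<forall>n. \<exists>v. length v = n \<and> bad (u @ v))"
  have ext0: "ext []"
    using neg unfolding ext_def bad_def tr_def by (metis append_Nil not_less)
  have step: "\<exists>l. l \<in> L (length u) \<and> ext (u @ [l])" if ext_u: "ext u" for u
  proof (rule ccontr)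
    assume "\<not> ?thesis"
    then have "\<forall>l\<in>L (length u). \<exists>n. \<forall>v. length v = n \<longrightarrow> \<not> bad ((u @ [l]) @ v)" unfolding ext_def by blast
    from bchoice[OF this] obtain n where n: "\<And>l v. l \<in> L (length u) \<Longrightarrow> length v = n l \<Longrightarrow> \<not> bad ((u @ [l]) @ v)"
      by blast
    \<comment> \<open>This exceeds or equals every \<open>n l\<close>, so a bad extension of length
      \<open>Suc m\<close> can be truncated to length \<open>n l\<close> after its first loop
      \<open>l\<close>; bad lists are closed under prefixes.\<close>
    define m where "m = (\<Sum>l\<in>L (length u). n l)"
    obtain v where v: "length v = Suc m" "bad (u @ v)" using ext_u unfolding ext_def by blast
    obtain l v' where lv: "v = l # v'" "length v' = m" using v(1) by (cases v) auto
    have "tr (u @ l # v')" using v(2) lv(1) by (simp add: bad_def)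
    then have l: "l \<in> L (length u)" unfolding tr_def by (metis append_Cons length_append length_Cons less_add_Suc1 nth_append_length add_Suc_right)
    then have "n l \<le> m" unfolding m_def using L(1) by (intro member_le_sum) auto
    then have len: "length (take (n l) v') = n l" using lv by simp
    have "((u @ [l]) @ take (n l) v') @ drop (n l) v' = u @ v" using lv by simp
    then have "bad ((u @ [l]) @ take (n l) v')" using v(2) bad_prefix by metis
    then show False using n[OF l len] by blast
  qed
  have "\<exists>U. \<forall>n. ext (U n) \<and> (\<exists>l. U (Suc n) = U n @ [l])"
  proof -
    have "\<exists>U. \<forall>n. ext (U n) \<and> (\<exists>l. U (Suc n) = U n @ [l])"
      by (rule dependent_nat_choice) (use ext0 step in blast)+
    then show ?thesis .
  qed
  then obtain U where U: "\<And>n. ext (U n)" "\<And>n. \<exists>l. U (Suc n) = U n @ [l]" by blast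
  have U_bad: "bad (U n)" for n using U(1)[of n] unfolding ext_def by (metis append_Nil2 length_0_conv)
  have U_loops: "set (U n) \<subseteq> loops" for n using U_bad tr_loops by (auto simp: bad_def)
  define w where "w = (\<lambda>n. concat (U n))"
  have w_Suc: "\<exists>l. l \<noteq> [] \<and> w (Suc n) = w n @ l" for n
  proof -
    obtain l where l: "U (Suc n) = U n @ [l]" using U(2) by blast
    then have "l \<in> loops" using U_loops[of "Suc n"] by simp
    then show ?thesis using l loops_Cons[of l] by (auto simp: w_def)
  qed
  have w_len: "length (w n) \<ge> n" for n
  proof (induction n)
    case (Suc n)
    obtain l where "l \<noteq> []" "w (Suc n) = w n @ l" using w_Suc by blast
    then show ?case using Suc by (cases l) auto
  qed simp
  have w_prefix: "\<exists>v. w (n + m) = w n @ v" for n m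
  proof (induction m)
    case (Suc m)
    then show ?case using w_Suc[of "n + m"] by auto
  qed simp
  \<comment> \<open>The word \<open>w (Suc k)\<close> has more than \<open>k\<close> letters, and
    all later words agree with it there.\<close>
  define y where "y = (\<lambda>k. w (Suc k) ! k)"
  have y: "w n ! k = y k" if k: "k < length (w n)" for n k
  proof -
    have k': "k < length (w (Suc k))" using w_len[of "Suc k"] by simp
    have "w n ! k = w (n + Suc k) ! k" using w_prefix[of n "Suc k"] k by (auto simp: nth_append)
    also have "\<dots> = w (Suc k + n) ! k" by (simp add: add.commute)
    also have "\<dots> = w (Suc k) ! k" using w_prefix[of "Suc k" n] k' by (auto simp: nth_append)
    finally show ?thesis by (simp add: y_def)
  qed
  have yX: "y \<in> X"
    unfolding shift_space_def
  proof (intro CollectI allI)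
    fix k
    let ?n = "Suc (Suc k)"
    have len: "Suc k < length (w ?n)" using w_len[of ?n] by simp
    obtain x where x: "x \<in> cyl (w ?n)" using loops_cylinder[OF U_loops[of ?n]] by (auto simp: w_def)
    then have "x k = y k" "x (Suc k) = y (Suc k)"
      using len y[of k ?n] y[of "Suc k" ?n] by (auto simp: cylinder_def)
    then show "y k \<in> I \<and> A (y k) (y (Suc k)) = 1"
      using cylinder_shift_space[OF x] by (metis (mono_tags, lifting) mem_Collect_eq shift_space_def)
  qed
  have py: "\<psi> y > 0" by (rule psi_pos[OF yX])
  then obtain m where m: "m > 0" "\<And>z. z \<in> X \<Longrightarrow> (\<And>k. k < m \<Longrightarrow> z k = y k) \<Longrightarrow> \<bar>\<psi> z - \<psi> y\<bar> < \<psi> y / 2"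
    using hoelder_continuous_near[OF hoelder(2), of "\<psi> y / 2"] yX by (metis half_gt_zero)
  define n where "n = length (w m)"
  have n: "n \<ge> m" using w_len by (simp add: n_def)
  have "\<psi> y / 2 \<le> inf_sum (w m)"
  proof (rule inf_sum_ge)
    show "cyl (w m) \<noteq> {}" using loops_cylinder[OF U_loops] by (simp add: w_def)
    fix z assume z: "z \<in> cyl (w m)"
    then have zX: "z \<in> X" by (rule cylinder_shift_space)
    have "\<bar>\<psi> z - \<psi> y\<bar> < \<psi> y / 2"
      using z y[of _ m] n by (intro m(2) zX) (auto simp: cylinder_def n_def)
    then have "\<psi> y / 2 \<le> \<psi> z" by linarith
    also have "\<psi> z = birkhoff_sum \<psi> 1 z" by (simp add: birkhoff_sum_def)
    also have "\<dots> \<le> birkhoff_sum \<psi> (1 + (n - 1)) z"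
      unfolding birkhoff_sum_add using birkhoff_sum_psi_nonneg[OF shift_shift_space[OF zX]] by simp
    also have "1 + (n - 1) = length (w m)" using n m(1) by (simp add: n_def)
    finally show "\<psi> y / 2 \<le> birkhoff_sum \<psi> (length (w m)) z" .
  qed
  moreover have "inf_sum (w m) \<le> 0" using U_bad by (simp add: bad_def w_def)
  ultimately show False using py by linarith
qed

section \<open>From uniform bounds to a contraction\<close>

lemma loop_lists_split:
  assumes F: "finite F" "F \<subseteq> loop_lists (j + k)" and b: "b \<ge> 0"
    and B: "\<And>F. finite F \<Longrightarrow> F \<subseteq> loop_lists j \<Longrightarrow> (sum (upper_weight b) F) \<le> B"
    and C: "\<And>F. finite F \<Longrightarrow> F \<subseteq> loop_lists k \<Longrightarrow> (sum (upper_weight b) F) \<le> C"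
  shows "sum (upper_weight b) F \<le> B * C"
proof -
  let ?u = "upper_weight b"
  have "(\<Sum>ls\<in>F. ?u ls) \<le> (\<Sum>ls\<in>F. ?u (take j ls) * ?u (drop j ls))"
  proof (rule sum_mono)
    fix ls assume "ls \<in> F"
    then have "set (take j ls @ drop j ls) \<subseteq> loops" using F by (auto simp: loop_lists_def)
    from upper_weight_append[OF this b] show "?u ls \<le> ?u (take j ls) * ?u (drop j ls)" by simp
  qed
  also have "\<dots> = (\<Sum>(x, y)\<in>(\<lambda>ls. (take j ls, drop j ls)) ` F. ?u x * ?u y)"
    by (subst sum.reindex) (auto simp: inj_on_def, metis append_take_drop_id)
  also have "\<dots> \<le> (\<Sum>(x, y)\<in>take j ` F \<times> drop j ` F. ?u x * ?u y)"
    using F by (intro sum_mono2) auto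
  also have "\<dots> = (\<Sum>x\<in>take j ` F. ?u x) * (\<Sum>y\<in>drop j ` F. ?u y)"
    by (simp add: sum_product sum.cartesian_product)
  also have "\<dots> \<le> B * C"
  proof (rule mult_mono)
    show "(\<Sum>x\<in>take j ` F. ?u x) \<le> B"
      using F by (intro B) (force simp: loop_lists_def dest: in_set_takeD)+
    show "(\<Sum>y\<in>drop j ` F. ?u y) \<le> C"
      using F by (intro C) (force simp: loop_lists_def dest: in_set_dropD)+
    show "0 \<le> B" using B[of "{}"] by simp
    show "0 \<le> (\<Sum>y\<in>drop j ` F. ?u y)" by (simp add: sum_nonneg)
  qed
  finally show ?thesis .
qed

lemma upper_weight_sum_bounded:
  assumes b: "ratio_bound b" and F: "finite F" "F \<subseteq> loop_lists k"
  shows "sum (upper_weight (max b 0)) F \<le> exp (dist_const b + max b 0 * K)"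
proof (cases "k = 0")
  case True
  then have "F \<subseteq> {[]}" using F by (auto simp: loop_lists_def)
  then have "sum (upper_weight (max b 0)) F \<le> (\<Sum>ls\<in>{[]}. upper_weight (max b 0) ls)"
    by (intro sum_mono2) auto
  also have "\<dots> = 1" by (simp add: upper_weight_Nil)
  also have "\<dots> \<le> exp (dist_const b + max b 0 * K)" using dist_const_nonneg K_nonneg by simp
  finally show ?thesis .
next
  case False
  have "sum (upper_weight (max b 0)) F \<le> (\<Sum>ls\<in>F. exp (max b 0 * K) * weight b (concat ls))"
  proof (rule sum_mono)
    fix ls assume "ls \<in> F"
    then have "ls \<in> loop_lists k" using F by blast
    then show "upper_weight (max b 0) ls \<le> exp (max b 0 * K) * weight b (concat ls)"
      using False by (intro upper_weight_le_weight) (auto simp: loop_lists_def)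
  qed
  also have "\<dots> = exp (max b 0 * K) * (\<Sum>ls\<in>F. weight b (concat ls))" by (simp add: sum_distrib_left)
  also have "\<dots> \<le> exp (max b 0 * K) * exp (dist_const b)"
    using False by (intro mult_left_mono weight_sum_loop_lists[OF b F]) auto
  finally show ?thesis by (simp add: exp_add mult.commute)
qed

lemma loops_tail:
  assumes b: "ratio_bound b" and e: "e > 0"
  shows "\<exists>L. finite L \<and> L \<subseteq> loops \<and>
    (\<forall>F. finite F \<longrightarrow> F \<subseteq> loops - L \<longrightarrow> (\<Sum>l\<in>F. upper_weight (max b 0) [l]) \<le> e)"
proof (rule finite_tail[OF _ _ e])
  fix F assume F: "finite F" "F \<subseteq> loops"
  have "(\<Sum>l\<in>F. upper_weight (max b 0) [l]) = (\<Sum>ls\<in>(\<lambda>l. [l]) ` F. upper_weight (max b 0) ls)"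
    by (subst sum.reindex) (auto simp: inj_on_def)
  also have "\<dots> \<le> exp (dist_const b + max b 0 * K)"
    using F by (intro upper_weight_sum_bounded[OF b, of _ 1]) (auto simp: loop_lists_def)
  finally show "(\<Sum>l\<in>F. upper_weight (max b 0) [l]) \<le> exp (dist_const b + max b 0 * K)" .
qed auto

text \<open>Each list is cut into the loops before position \<open>i\<close>, the loop at
  \<open>i\<close> and the loops after it. Submultiplicativity bounds the sum by a product of three
  sums, the middle one running over the small tail outside \<open>L\<close>.\<close>

lemma upper_weight_sum_avoiding:
  assumes b: "ratio_bound b" and F: "finite F" "F \<subseteq> loop_lists q" and i: "i < q"
    and L: "\<And>F. finite F \<Longrightarrow> F \<subseteq> loops - L \<Longrightarrow> (\<Sum>l\<in>F. upper_weight (max b 0) [l]) \<le> e"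
    and avoid: "\<And>ls. ls \<in> F \<Longrightarrow> ls ! i \<notin> L"
  defines "E \<equiv> exp (dist_const b + max b 0 * K)"
  shows "sum (upper_weight (max b 0)) F \<le> E * (e * E)"
proof -
  let ?u = "upper_weight (max b 0)"
  let ?t = "\<lambda>ls. (take i ls, ls ! i, drop (Suc i) ls)"
  have sp: "ls = take i ls @ [ls ! i] @ drop (Suc i) ls" "set ls \<subseteq> loops" "length ls = q" if "ls \<in> F" for ls
    using that F i by (auto simp: loop_lists_def id_take_nth_drop)
  have "(\<Sum>ls\<in>F. ?u ls) \<le> (\<Sum>ls\<in>F. ?u (take i ls) * (?u [ls ! i] * ?u (drop (Suc i) ls)))"
  proof (rule sum_mono)
    fix ls assume ls: "ls \<in> F"
    have s: "set (take i ls @ ([ls ! i] @ drop (Suc i) ls)) \<subseteq> loops" using sp[OF ls] by metis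
    have "?u ls \<le> ?u (take i ls) * ?u ([ls ! i] @ drop (Suc i) ls)"
      using upper_weight_append[OF s, of "max b 0"] sp(1)[OF ls] by simp
    also have "\<dots> \<le> ?u (take i ls) * (?u [ls ! i] * ?u (drop (Suc i) ls))"
      using s by (intro mult_left_mono upper_weight_append upper_weight_nonneg) auto
    finally show "?u ls \<le> ?u (take i ls) * (?u [ls ! i] * ?u (drop (Suc i) ls))" .
  qed
  also have "\<dots> = (\<Sum>(x, y, z)\<in>?t ` F. ?u x * (?u [y] * ?u z))"
  proof (subst sum.reindex)
    show "inj_on ?t F" using sp(1) by (intro inj_onI) (metis prod.inject)
  qed simp
  also have "\<dots> \<le> (\<Sum>(x, y, z)\<in>take i ` F \<times> (\<lambda>ls. ls ! i) ` F \<times> drop (Suc i) ` F. ?u x * (?u [y] * ?u z))"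
    using F by (intro sum_mono2) auto
  also have "\<dots> = (\<Sum>x\<in>take i ` F. ?u x) * ((\<Sum>y\<in>(\<lambda>ls. ls ! i) ` F. ?u [y]) * (\<Sum>z\<in>drop (Suc i) ` F. ?u z))"
    by (simp add: sum_product sum.cartesian_product case_prod_unfold)
  also have "\<dots> \<le> E * (e * E)"
  proof (intro mult_mono)
    show "(\<Sum>x\<in>take i ` F. ?u x) \<le> E" unfolding E_def
      using F(1) sp i by (intro upper_weight_sum_bounded[OF b, of _ i]) (force simp: loop_lists_def dest: in_set_takeD)+
    show "(\<Sum>z\<in>drop (Suc i) ` F. ?u z) \<le> E" unfolding E_def
      using F(1) sp i by (intro upper_weight_sum_bounded[OF b, of _ "q - Suc i"]) (force simp: loop_lists_def dest: in_set_dropD)+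
    show "(\<Sum>y\<in>(\<lambda>ls. ls ! i) ` F. ?u [y]) \<le> e"
    proof (rule L)
      show "(\<lambda>ls. ls ! i) ` F \<subseteq> loops - L"
        using avoid sp(2,3) i nth_mem by fastforce
    qed (use F in simp)
    show "0 \<le> e" using L[of "{}"] by simp
  qed (auto simp: E_def intro!: sum_nonneg mult_nonneg_nonneg)
  finally show ?thesis .
qed

text \<open>If every \<open>i\<close>-th loop of a list lies in a finite set \<open>L i\<close>,
  only finitely many lists occur, their infima have a positive lower bound, and a large exponent
  makes them light. Any other list has a loop in one of the small tails. As \<open>q\<close> depends
  on the sets \<open>L i\<close>, these are fixed beforehand for all \<open>i\<close>, with tail
  bounds summable in \<open>i\<close>.\<close>

lemma upper_weight_contraction:
  assumes b: "ratio_bound b"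
  shows "\<exists>q>0. \<exists>b1\<ge>max B (max b 0). \<forall>F. finite F \<longrightarrow> F \<subseteq> loop_lists q \<longrightarrow> (sum (upper_weight b1) F) \<le> 1 / 2"
proof -
  define b0 where "b0 = max b 0"
  have b0: "b0 \<ge> 0" by (simp add: b0_def)
  define E where "E = exp (dist_const b + b0 * K)"
  have E: "E > 0" by (simp add: E_def)
  \<comment> \<open>Chosen so that the sum of \<open>E * (e i * E)\<close> over \<open>i < q\<close>
    is at most 1/4, whatever \<open>q\<close> turns out to be.\<close>
  define e where "e = (\<lambda>i. 1 / (8 * E * E) * (1 / 2) ^ i)"
  have e: "e i > 0" for i using E by (simp add: e_def)
  obtain L where L: "\<And>i. finite (L i)" "\<And>i. L i \<subseteq> loops"
    "\<And>i F. finite F \<Longrightarrow> F \<subseteq> loops - L i \<Longrightarrow> (\<Sum>l\<in>F. upper_weight b0 [l]) \<le> e i"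
    using loops_tail[OF b e] unfolding b0_def by metis
  obtain q where q: "\<And>ls. length ls = q \<Longrightarrow> (\<forall>i<q. ls ! i \<in> L i) \<Longrightarrow> inf_sum (concat ls) > 0"
    using inf_sum_pos_eventually[of L] L(1,2) by metis
  have "inf_sum [] = 0" using upper_weight_Nil[of 1] upper_weight_Nil[of 0] by (simp add: upper_weight_def)
  then have q_pos: "q > 0" using q[of "[]"] by (cases q) auto
  define Tr where "Tr = {ls. length ls = q \<and> (\<forall>i<q. ls ! i \<in> L i)}"
  have "Tr \<subseteq> {ls. set ls \<subseteq> (\<Union>i<q. L i) \<and> length ls = q}" by (force simp: Tr_def in_set_conv_nth)
  then have finTr: "finite Tr" by (rule finite_subset) (intro finite_lists_length_eq finite_UN_I L(1) finite_lessThan)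
  \<comment> \<open>The inserted 1 provides a positive minimum even when \<open>Tr\<close> is
    empty.\<close>
  define \<delta> where "\<delta> = Min (insert 1 ((\<lambda>ls. inf_sum (concat ls)) ` Tr))"
  have \<delta>: "\<delta> > 0" unfolding \<delta>_def using finTr q by (subst Min_gr_iff) (auto simp: Tr_def)
  have \<delta>_le: "\<delta> \<le> inf_sum (concat ls)" if "ls \<in> Tr" for ls
    unfolding \<delta>_def using finTr that by (intro Min_le) auto
  \<comment> \<open>The second term makes \<open>exp (- t * \<delta>) * E\<close> at most 1/4; the
    first lifts the exponent above the prescribed bound \<open>B\<close>.\<close>
  define t where "t = max (\<bar>B\<bar>) (ln (4 * E) / \<delta>)"
  have t: "t \<ge> 0" "t \<ge> B" "t \<ge> ln (4 * E) / \<delta>" by (auto simp: t_def)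
  have "ln (4 * E) \<le> t * \<delta>" using t(3) \<delta> by (simp add: pos_divide_le_eq)
  then have "exp (ln (4 * E)) \<le> exp (t * \<delta>)" by (simp only: exp_le_cancel_iff)
  then have tE: "exp (- t * \<delta>) * E \<le> 1 / 4" using E by (simp add: exp_minus field_simps)
  define b1 where "b1 = b0 + t"
  have "sum (upper_weight b1) F \<le> 1 / 2" if F: "finite F" "F \<subseteq> loop_lists q" for F
  proof -
    have Fl: "set ls \<subseteq> loops" "length ls = q" if "ls \<in> F" for ls using that F by (auto simp: loop_lists_def)
    have "(\<Sum>ls\<in>F \<inter> Tr. upper_weight b1 ls) \<le> (\<Sum>ls\<in>F \<inter> Tr. exp (- t * \<delta>) * upper_weight b0 ls)"
    proof (rule sum_mono)
      fix ls assume "ls \<in> F \<inter> Tr"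
      then have "t * \<delta> \<le> t * inf_sum (concat ls)" using \<delta>_le t(1) by (intro mult_left_mono) auto
      then show "upper_weight b1 ls \<le> exp (- t * \<delta>) * upper_weight b0 ls"
        unfolding upper_weight_def exp_add[symmetric] by (simp add: b1_def algebra_simps)
    qed
    also have "\<dots> = exp (- t * \<delta>) * (\<Sum>ls\<in>F \<inter> Tr. upper_weight b0 ls)" by (simp add: sum_distrib_left)
    also have "\<dots> \<le> exp (- t * \<delta>) * E"
      unfolding E_def b0_def using F by (intro mult_left_mono upper_weight_sum_bounded[OF b, of _ q]) auto
    finally have 1: "(\<Sum>ls\<in>F \<inter> Tr. upper_weight b1 ls) \<le> 1 / 4" using tE by linarith
    have "(\<Sum>ls\<in>F - Tr. upper_weight b1 ls) \<le> (\<Sum>ls\<in>F - Tr. upper_weight b0 ls)"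
      using Fl t(1) by (intro sum_mono upper_weight_antimono) (auto simp: b1_def)
    also have "\<dots> \<le> (\<Sum>ls\<in>F - Tr. \<Sum>i<q. if ls ! i \<notin> L i then upper_weight b0 ls else 0)"
    proof (rule sum_mono)
      fix ls assume "ls \<in> F - Tr"
      then obtain i where i: "i < q" "ls ! i \<notin> L i" using Fl by (auto simp: Tr_def)
      then show "upper_weight b0 ls \<le> (\<Sum>i<q. if ls ! i \<notin> L i then upper_weight b0 ls else 0)"
        using member_le_sum[of i "{..<q}" "\<lambda>i. if ls ! i \<notin> L i then upper_weight b0 ls else 0"] by simp
    qed
    also have "\<dots> \<le> (\<Sum>ls\<in>F. \<Sum>i<q. if ls ! i \<notin> L i then upper_weight b0 ls else 0)"
      using F by (intro sum_mono2) (auto intro: sum_nonneg)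
    also have "\<dots> = (\<Sum>i<q. \<Sum>ls\<in>{ls \<in> F. ls ! i \<notin> L i}. upper_weight b0 ls)"
      using F by (subst sum.swap) (simp add: sum.inter_filter)
    also have "\<dots> \<le> (\<Sum>i<q. E * (e i * E))"
    proof (rule sum_mono)
      fix i assume "i \<in> {..<q}"
      then show "(\<Sum>ls\<in>{ls \<in> F. ls ! i \<notin> L i}. upper_weight b0 ls) \<le> E * (e i * E)"
        unfolding E_def b0_def using F L(3)[of _ i, unfolded b0_def]
        by (intro upper_weight_sum_avoiding[OF b, where q = q and i = i and L = "L i"]) auto
    qed
    also have "\<dots> = (1 / 8) * (\<Sum>i<q. (1 / 2) ^ i)" using E by (simp add: e_def sum_distrib_left)
    also have "(\<Sum>i<q. (1 / 2 :: real) ^ i) \<le> 2"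
      using geometric_sum_le[of "1 / 2" q] by simp
    finally have 2: "(\<Sum>ls\<in>F - Tr. upper_weight b1 ls) \<le> 1 / 4" by simp
    have "sum (upper_weight b1) F = (\<Sum>ls\<in>F \<inter> Tr. upper_weight b1 ls) + (\<Sum>ls\<in>F - Tr. upper_weight b1 ls)"
      using F by (subst sum.Int_Diff[of F _ Tr]) auto
    with 1 2 show ?thesis by linarith
  qed
  moreover have "b1 \<ge> max B (max b 0)" using t b0 by (auto simp: b1_def b0_def)
  ultimately show ?thesis using q_pos by blast
qed

text \<open>Splitting off \<open>q\<close> loops at a time gains a factor 1/2, which is
  \<open>\<theta> ^ q\<close>. Fewer than \<open>q\<close> remaining loops are bounded by
  \<open>E\<close>, and \<open>\<theta> ^ k\<close> is at least 1/2 for them, whence the constant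
  \<open>2 * E\<close>.\<close>

lemma upper_weight_decay:
  assumes b: "ratio_bound b"
  shows "\<exists>b1\<ge>max B 0. \<exists>C>0. \<exists>\<theta>>0. \<theta> < 1 \<and>
    (\<forall>k F. finite F \<longrightarrow> F \<subseteq> loop_lists k \<longrightarrow> (sum (upper_weight b1) F) \<le> C * \<theta> ^ k)"
proof -
  obtain q b1 where q: "q > 0" "b1 \<ge> max B (max b 0)"
    "\<And>F. finite F \<Longrightarrow> F \<subseteq> loop_lists q \<Longrightarrow> (sum (upper_weight b1) F) \<le> 1 / 2"
    using upper_weight_contraction[OF b] by metis
  define E where "E = exp (dist_const b + max b 0 * K)"
  have E: "E > 0" by (simp add: E_def)
  define \<theta> where "\<theta> = (1 / 2 :: real) powr (1 / real q)"
  have \<theta>: "\<theta> > 0" "\<theta> < 1" using q(1) by (auto simp: \<theta>_def powr_def ln_div)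
  have \<theta>q: "\<theta> ^ q = 1 / 2" using q(1) by (simp add: \<theta>_def powr_power powr_one)
  have "sum (upper_weight b1) F \<le> (2 * E) * \<theta> ^ k" if F: "finite F" "F \<subseteq> loop_lists k" for k F
    using F
  proof (induction k arbitrary: F rule: less_induct)
    case (less k)
    show ?case
    proof (cases "k < q")
      case True
      have "sum (upper_weight b1) F \<le> sum (upper_weight (max b 0)) F"
        using less.prems q(2) by (intro sum_mono upper_weight_antimono) (auto simp: loop_lists_def)
      also have "\<dots> \<le> E" unfolding E_def by (rule upper_weight_sum_bounded[OF b less.prems])
      also have "E \<le> (2 * E) * \<theta> ^ k"
      proof -
        have "1 / 2 \<le> \<theta> ^ k" unfolding \<theta>q[symmetric] using True \<theta> by (intro power_decreasing) auto
        then show ?thesis using E by simp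
      qed
      finally show ?thesis .
    next
      case False
      then have k: "k = q + (k - q)" by simp
      have "sum (upper_weight b1) F \<le> (1 / 2) * ((2 * E) * \<theta> ^ (k - q))"
      proof (rule loop_lists_split)
        show "F \<subseteq> loop_lists (q + (k - q))" using less.prems k by simp
        show "sum (upper_weight b1) F \<le> 2 * E * \<theta> ^ (k - q)" if "finite F" "F \<subseteq> loop_lists (k - q)" for F
          using that False q(1) by (intro less.IH) auto
      qed (use less.prems q in auto)
      also have "\<dots> = (2 * E) * (\<theta> ^ q * \<theta> ^ (k - q))" by (simp add: \<theta>q)
      also have "\<theta> ^ q * \<theta> ^ (k - q) = \<theta> ^ k" using k by (metis power_add)
      finally show ?thesis .
    qed
  qed
  moreover have "b1 \<ge> max B 0" "2 * E > 0" using q(2) E by auto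
  ultimately show ?thesis using \<theta> by blast
qed

text \<open>
  The weights at \<open>b\<close> are bounded and those at a large exponent \<open>b1\<close> decay exponentially;
  log-linearity of the weight in the exponent gives exponential decay at every \<open>b' > b\<close>.
\<close>

lemma weight_sum_per:
  assumes b: "ratio_bound b" and bb': "b < b'"
  shows "\<exists>M. \<forall>F. finite F \<longrightarrow> F \<subseteq> per \<longrightarrow> (\<Sum>w\<in>F. weight b' w) \<le> M"
proof -
  obtain b1 C \<theta> where b1: "b1 \<ge> max (b' + 1) 0" and C: "C > 0" and \<theta>: "\<theta> > 0" "\<theta> < 1"
    and decay: "\<And>k F. finite F \<Longrightarrow> F \<subseteq> loop_lists k \<Longrightarrow> (sum (upper_weight b1) F) \<le> C * \<theta> ^ k"
    using upper_weight_decay[OF b, of "b' + 1"] by metis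
  \<comment> \<open>The position of \<open>b'\<close> on the segment from \<open>b\<close> to
    \<open>b1\<close>; it is below 1 because \<open>b1\<close> was taken beyond
    \<open>b'\<close>.\<close>
  define t where "t = (b' - b) / (b1 - b)"
  have t: "0 < t" "t < 1" using b1 bb' by (auto simp: t_def field_simps)
  have b'_eq: "b' = (1 - t) * b + t * b1"
  proof -
    have "t * (b1 - b) = b' - b" using b1 bb' by (simp add: t_def)
    then show ?thesis by (simp add: algebra_simps)
  qed
  define \<kappa> where "\<kappa> = \<theta> powr t"
  have \<kappa>: "\<kappa> > 0" "\<kappa> < 1" using \<theta> t by (auto simp: \<kappa>_def powr_def mult_pos_neg)
  define D where "D = exp (dist_const b) + C"
  have D: "D > 0" using C by (simp add: D_def add_pos_pos)
  \<comment> \<open>Convexity of \<open>exp\<close>, after the weight at \<open>b1\<close> has been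
    normalized by \<open>\<theta> ^ k\<close>. Both averaged terms then have sums bounded
    independently of \<open>k\<close>, and the normalization reappears as the decaying factor
    \<open>\<kappa> ^ k\<close>.\<close>
  have interp: "weight b' w \<le> \<kappa> ^ k * ((1 - t) * weight b w + t * (weight b1 w / \<theta> ^ k))" for w k
  proof -
    define u where "u = \<Phi> w - b * \<Psi> w"
    define v where "v = \<Phi> w - b1 * \<Psi> w - real k * ln \<theta>"
    have "\<Phi> w - b' * \<Psi> w = t * (real k * ln \<theta>) + ((1 - t) * u + t * v)"
      unfolding b'_eq u_def v_def by (simp add: algebra_simps)
    then have "weight b' w = exp (t * (real k * ln \<theta>)) * exp ((1 - t) * u + t * v)"
      by (simp add: weight_def exp_add)
    also have "exp (t * (real k * ln \<theta>)) = \<kappa> ^ k"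
      using \<theta> by (simp add: \<kappa>_def powr_def mult_ac flip: exp_of_nat_mult)
    also have "exp ((1 - t) * u + t * v) \<le> (1 - t) * exp u + t * exp v"
      using convex_onD[OF exp_convex, of t u v] t by simp
    also have "exp v = weight b1 w / \<theta> ^ k"
      using \<theta> by (simp add: v_def weight_def exp_diff exp_of_nat_mult)
    also have "exp u = weight b w" by (simp add: u_def weight_def)
    finally show ?thesis using \<kappa> by simp
  qed
  have level: "(\<Sum>ls\<in>F. weight b' (concat ls)) \<le> \<kappa> ^ k * D" if F: "finite F" "F \<subseteq> loop_lists k" and k: "k > 0" for F k
  proof -
    have "(\<Sum>ls\<in>F. weight b' (concat ls))
        \<le> (\<Sum>ls\<in>F. \<kappa> ^ k * ((1 - t) * weight b (concat ls) + t * (weight b1 (concat ls) / \<theta> ^ k)))"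
      by (intro sum_mono interp)
    also have "\<dots> = \<kappa> ^ k * ((1 - t) * (\<Sum>ls\<in>F. weight b (concat ls)) + t * ((\<Sum>ls\<in>F. weight b1 (concat ls)) / \<theta> ^ k))"
      by (simp add: sum_distrib_left sum.distrib sum_divide_distrib distrib_left)
    also have "\<dots> \<le> \<kappa> ^ k * (1 * exp (dist_const b) + 1 * C)"
    proof (intro mult_left_mono add_mono mult_mono)
      show "(\<Sum>ls\<in>F. weight b (concat ls)) \<le> exp (dist_const b)" by (rule weight_sum_loop_lists[OF b F k])
      have "(\<Sum>ls\<in>F. weight b1 (concat ls)) \<le> sum (upper_weight b1) F"
        using F b1 by (intro sum_mono weight_le_upper_weight) (auto simp: loop_lists_def)
      also have "\<dots> \<le> C * \<theta> ^ k" by (rule decay[OF F])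
      finally show "(\<Sum>ls\<in>F. weight b1 (concat ls)) / \<theta> ^ k \<le> C" using \<theta> by (simp add: pos_divide_le_eq)
    qed (use t \<kappa> \<theta> in \<open>auto intro!: sum_nonneg divide_nonneg_nonneg less_imp_le[OF weight_pos]\<close>)
    finally show ?thesis by (simp add: D_def)
  qed
  obtain dec where dec: "\<And>w. w \<in> per \<Longrightarrow> set (dec w) \<subseteq> loops" "\<And>w. w \<in> per \<Longrightarrow> concat (dec w) = w"
    using per_decompose by metis
  have "(\<Sum>w\<in>F. weight b' w) \<le> D * (1 / (1 - \<kappa>))" if F: "finite F" "F \<subseteq> per" for F
  proof -
    define N where "N = Suc (\<Sum>w\<in>F. length (dec w))"
    have N: "length (dec w) \<in> {..<N}" if "w \<in> F" for w
    proof -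
      have "length (dec w) \<le> (\<Sum>w\<in>F. length (dec w))" using F that by (intro member_le_sum) auto
      then show ?thesis by (simp add: N_def)
    qed
    have inj: "inj_on dec F" using F dec by (metis inj_onI subsetD)
    have "(\<Sum>w\<in>F. weight b' w) = (\<Sum>k<N. \<Sum>w\<in>{w \<in> F. length (dec w) = k}. weight b' w)"
      using F N by (intro sum.group[symmetric]) auto
    also have "\<dots> \<le> (\<Sum>k<N. \<kappa> ^ k * D)"
    proof (rule sum_mono)
      fix k
      let ?G = "{w \<in> F. length (dec w) = k}"
      show "(\<Sum>w\<in>?G. weight b' w) \<le> \<kappa> ^ k * D"
      proof (cases "k = 0")
        case True
        have "dec w \<noteq> []" if "w \<in> F" for w
        proof
          assume "dec w = []"
          then have "w = []" using dec(2)[of w] F that by auto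
          then show False using F that by (auto simp: periodic_words_iff words_def)
        qed
        then have none: "?G = {}" using True by auto
        show ?thesis unfolding none using \<kappa> D by simp
      next
        case False
        have "(\<Sum>w\<in>?G. weight b' w) = (\<Sum>w\<in>?G. weight b' (concat (dec w)))"
          using F dec by (intro sum.cong) auto
        also have "\<dots> = (\<Sum>ls\<in>dec ` ?G. weight b' (concat ls))"
          by (subst sum.reindex[OF inj_on_subset[OF inj]]) auto
        also have "\<dots> \<le> \<kappa> ^ k * D"
          using F dec False by (intro level) (auto simp: loop_lists_def)
        finally show ?thesis .
      qed
    qed
    also have "\<dots> = D * (\<Sum>k<N. \<kappa> ^ k)" by (simp add: sum_distrib_left mult.commute)
    also have "(\<Sum>k<N. \<kappa> ^ k) \<le> 1 / (1 - \<kappa>)"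
      using \<kappa> by (intro geometric_sum_le) auto
    finally show ?thesis using D by (simp add: mult_left_mono)
  qed
  then show ?thesis by blast
qed

lemma pressure_le_ratio_bound:
  assumes "ratio_bound b"
  shows "induced_pressure I A \<eta> \<psi> \<phi> per \<le> ereal b"
proof (rule ereal_le_epsilon2)
  fix e :: real assume "e > 0"
  then obtain M where "\<And>F. finite F \<Longrightarrow> F \<subseteq> per \<Longrightarrow> (sum (weight (b + e)) F) \<le> M"
    using weight_sum_per[OF assms, of "b + e"] by auto
  from pressure_le[OF this] show "induced_pressure I A \<eta> \<psi> \<phi> per \<le> ereal b + ereal e" by simp
qed

section \<open>The variational principle\<close>

text \<open>For \<phi> - b \<psi> the entropy bound says that the entropy is at most
  \<open>b\<close> times the integral of \<psi> minus the integral of \<phi>. Dividing by the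
  integral of \<psi>, which is positive since \<psi> is, gives the ratio.\<close>

lemma invariant_ratio_le:
  assumes P: "induced_pressure I A \<eta> \<psi> \<phi> per < ereal b" and \<eta>: "\<eta> > 0"
    and \<nu>: "\<nu> \<in> invariant_measures I A" "integrable \<nu> \<phi>" "integrable \<nu> \<psi>"
  shows "measure_entropy \<nu> shift / ereal (\<integral>x. \<psi> x \<partial>\<nu>) + ereal ((\<integral>x. \<phi> x \<partial>\<nu>) / (\<integral>x. \<psi> x \<partial>\<nu>)) \<le> ereal b"
proof -
  have int: "integrable \<nu> (\<lambda>x. \<phi> x - b * \<psi> x)" using \<nu>(2,3) by simp
  interpret S: shift_measure I A \<nu> by unfold_locales (rule \<nu>(1))
  interpret W: weighted_measure I A \<nu> "\<lambda>x. \<phi> x - b * \<psi> x" "weight b" "\<bar>b\<bar> * K"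
  proof
    fix N
    let ?J = "{i \<in> I. i < N}"
    \<comment> \<open>One bound for each pair of end letters; only finitely many pairs lie below
      \<open>N\<close>, so the bounds can be added.\<close>
    define M where "M = (\<lambda>i j. SOME M. \<forall>F. finite F \<longrightarrow> F \<subseteq> {w \<in> words I A. hd w = i \<and> last w = j} \<longrightarrow>
      (sum (weight b) F) \<le> M)"
    have M: "sum (weight b) F \<le> M i j"
      if "i \<in> ?J" "j \<in> ?J" "finite F" "F \<subseteq> {w \<in> words I A. hd w = i \<and> last w = j}" for i j F
      using someI_ex[OF weight_sum_bounded[OF P \<eta>, of i j]] that unfolding M_def by blast
    have "sum (weight b) F \<le> (\<Sum>(i, j)\<in>?J \<times> ?J. M i j)"
      if F: "finite F" "F \<subseteq> {w \<in> words I A. hd w < N \<and> last w < N}" for F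
    proof -
      have "sum (weight b) F = (\<Sum>p\<in>?J \<times> ?J. \<Sum>w\<in>{w \<in> F. (hd w, last w) = p}. weight b w)"
        using F words_hd_last by (intro sum.group[symmetric]) auto
      also have "\<dots> \<le> (\<Sum>p\<in>?J \<times> ?J. M (fst p) (snd p))"
        using F by (intro sum_mono M) auto
      finally show ?thesis by (simp add: case_prod_beta)
    qed
    then show "\<exists>M. \<forall>F. finite F \<longrightarrow> F \<subseteq> {w \<in> words I A. hd w < N \<and> last w < N} \<longrightarrow> (sum (weight b) F) \<le> M"
      by blast
  next
    fix x and n :: nat assume x: "x \<in> X" and n: "n > 0"
    let ?w = "map x [0..<n]"
    note c = in_cylinder_prefix[OF x, of n]
    have "birkhoff_sum (\<lambda>x. \<phi> x - b * \<psi> x) n x = birkhoff_sum \<phi> n x - b * birkhoff_sum \<psi> n x"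
      by (simp add: birkhoff_sum_def sum_subtractf sum_distrib_left)
    also have "\<dots> = birkhoff_sum \<phi> n x - b * \<Psi> ?w + b * (\<Psi> ?w - birkhoff_sum \<psi> n x)"
      by (simp add: algebra_simps)
    also have "\<dots> \<le> \<Phi> ?w - b * \<Psi> ?w + \<bar>b\<bar> * K"
      using sup_sum_bounds(1,2)[OF distortion(1) c] sup_sum_bounds(1,2)[OF distortion(2) c] K_nonneg
      by (intro add_mono diff_mono mult_le_abs_mult) (auto simp: abs_le_iff)
    finally show "birkhoff_sum (\<lambda>x. \<phi> x - b * \<psi> x) n x \<le> ln (weight b ?w) + \<bar>b\<bar> * K"
      by (simp add: weight_def)
  qed (use int weight_pos K_nonneg in auto)
  define x where "x = (\<integral>y. \<phi> y \<partial>\<nu>)"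
  define y where "y = (\<integral>y. \<psi> y \<partial>\<nu>)"
  have y: "y > 0" unfolding y_def
    by (intro S.expectation_greater \<nu>(3) AE_I2) (simp_all add: psi_pos S.space_nu)
  have "measure_entropy \<nu> shift \<le> ereal (- (\<integral>x. \<phi> x - b * \<psi> x \<partial>\<nu>))" by (rule W.measure_entropy_le)
  also have "- (\<integral>x. \<phi> x - b * \<psi> x \<partial>\<nu>) = b * y - x" using \<nu>(2,3) by (simp add: x_def y_def)
  finally have "measure_entropy \<nu> shift / ereal y \<le> ereal (b * y - x) / ereal y"
    using y by (intro ereal_divide_right_mono) auto
  then have "measure_entropy \<nu> shift / ereal y + ereal (x / y) \<le> ereal (b * y - x) / ereal y + ereal (x / y)"
    by (rule add_right_mono)
  also have "\<dots> = ereal b" using y by (simp add: field_simps)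
  finally show ?thesis by (simp add: x_def y_def)
qed

end

text \<open>The complement of the support is a countable union of null cylinders.\<close>

lemma (in shift_measure) integrable_compact_support:
  assumes c: "compactin (shift_topology I A) (measure_support (shift_topology I A) \<nu>)"
    and f: "continuous_on X f"
  shows "integrable \<nu> (f :: _ \<Rightarrow> real)"
proof -
  let ?S = "measure_support (shift_topology I A) \<nu>"
  have S: "compact ?S" "?S \<subseteq> X"
    using c by (auto simp: shift_topology_eq compactin_subtopology)
  have "compact (f ` ?S)" using S f by (meson compact_continuous_image continuous_on_subset)
  then obtain B where B: "\<And>x. x \<in> ?S \<Longrightarrow> \<bar>f x\<bar> \<le> B"
    using compact_imp_bounded[of "f ` ?S"] by (auto simp: bounded_iff)
  let ?Z = "{w. emeasure \<nu> (cyl w) = 0}"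
  have "(\<Union>w\<in>?Z. cyl w) \<in> null_sets \<nu>"
    by (rule null_sets_UN') (auto simp: null_sets_def)
  then have "AE x in \<nu>. x \<notin> (\<Union>w\<in>?Z. cyl w)" by (rule AE_not_in)
  moreover have "AE x in \<nu>. x \<in> space \<nu>" by simp
  ultimately have "AE x in \<nu>. norm (f x) \<le> B"
  proof eventually_elim
    case (elim x)
    have x: "x \<in> X" using elim by (simp add: space_nu)
    have "emeasure \<nu> U > 0" if U: "openin (top_of_set X) U" "x \<in> U" for U
    proof -
      obtain w where w: "cyl w \<subseteq> U" "x \<in> cyl w"
        using openin_eq_Union_cylinders[OF U(1)] U(2) by blast
      obtain T where "open T" "U = X \<inter> T" using U(1) unfolding openin_open by blast
      then have "U \<in> sets \<nu>" unfolding sets_nu sets_restrict_space by (intro image_eqI[of _ _ T]) auto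
      then have "emeasure \<nu> (cyl w) \<le> emeasure \<nu> U" using w(1) by (intro emeasure_mono)
      moreover have "emeasure \<nu> (cyl w) \<noteq> 0" using elim(1) w(2) by blast
      ultimately show ?thesis by (metis less_le_trans zero_less_iff_neq_zero)
    qed
    then have "x \<in> ?S" using x by (simp add: measure_support_def shift_topology_eq)
    then show ?case using B by simp
  qed
  then show ?thesis by (rule integrable_const_bound) (rule continuous_on_measurable[OF f])
qed

theorem proposition3p26:
  fixes I :: "nat set" and A :: "nat \<Rightarrow> nat \<Rightarrow> nat"
    and \<phi> \<psi> :: "(nat \<Rightarrow> nat) \<Rightarrow> real" and a :: nat and \<eta> :: real
  assumes "\<forall>i\<in>I. \<forall>j\<in>I. A i j \<in> {0, 1}"
    and "irreducible_matrix I A"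
    and "hoelder_continuous I A \<phi>" and "hoelder_continuous I A \<psi>"
    and "\<forall>\<omega>\<in>shift_space I A. \<psi> \<omega> > 0"
    and "a \<in> I" and "\<eta> > 0"
  shows "induced_pressure I A \<eta> \<psi> \<phi> (periodic_words I A a) =
           (SUP \<nu>\<in>{\<nu> \<in> invariant_measures I A. integrable \<nu> \<phi> \<and> integrable \<nu> \<psi>}.
              measure_entropy \<nu> shift / ereal (\<integral>\<omega>. \<psi> \<omega> \<partial>\<nu>)
                + ereal ((\<integral>\<omega>. \<phi> \<omega> \<partial>\<nu>) / (\<integral>\<omega>. \<psi> \<omega> \<partial>\<nu>))) \<and>
         (SUP \<nu>\<in>{\<nu> \<in> invariant_measures I A. integrable \<nu> \<phi> \<and> integrable \<nu> \<psi>}.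
              measure_entropy \<nu> shift / ereal (\<integral>\<omega>. \<psi> \<omega> \<partial>\<nu>)
                + ereal ((\<integral>\<omega>. \<phi> \<omega> \<partial>\<nu>) / (\<integral>\<omega>. \<psi> \<omega> \<partial>\<nu>))) =
           (SUP \<nu>\<in>ergodic_compact_measures I A.
              measure_entropy \<nu> shift / ereal (\<integral>\<omega>. \<psi> \<omega> \<partial>\<nu>)
                + ereal ((\<integral>\<omega>. \<phi> \<omega> \<partial>\<nu>) / (\<integral>\<omega>. \<psi> \<omega> \<partial>\<nu>)))"
proof -
  obtain K1 K2 where K: "bounded_distortion I A \<phi> K1" "bounded_distortion I A \<psi> K2" "K1 \<ge> 0" "K2 \<ge> 0"
    using hoelder_bounded_distortion assms(3,4) by metis
  interpret induced_system I A \<phi> \<psi> a "max K1 K2"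
    using assms K by unfold_locales (auto intro: bounded_distortion_mono)
  define R where "R = (\<lambda>\<nu>. measure_entropy \<nu> shift / ereal (\<integral>\<omega>. \<psi> \<omega> \<partial>\<nu>)
      + ereal ((\<integral>\<omega>. \<phi> \<omega> \<partial>\<nu>) / (\<integral>\<omega>. \<psi> \<omega> \<partial>\<nu>)))"
  let ?P = "induced_pressure I A \<eta> \<psi> \<phi> (periodic_words I A a)"
  let ?M = "{\<nu> \<in> invariant_measures I A. integrable \<nu> \<phi> \<and> integrable \<nu> \<psi>}"
  let ?E = "ergodic_compact_measures I A"
  \<comment> \<open>A real \<open>b\<close> strictly between two extended reals reduces this
    comparison and the next to finite exponents, also when one of the values is infinite.\<close>
  have "(SUP \<nu>\<in>?M. R \<nu>) \<le> ?P"
  proof (rule SUP_least, rule ccontr)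
    fix \<nu> assume \<nu>: "\<nu> \<in> ?M" and "\<not> R \<nu> \<le> ?P"
    then obtain b where b: "?P < ereal b" "ereal b < R \<nu>" using ereal_dense2[of ?P "R \<nu>"] by (auto simp: not_le)
    from invariant_ratio_le[OF b(1) assms(7)] \<nu> have "R \<nu> \<le> ereal b" by (simp add: R_def)
    with b(2) show False by simp
  qed
  moreover have "?P \<le> (SUP \<nu>\<in>?E. R \<nu>)"
  proof (rule ccontr)
    assume "\<not> ?P \<le> (SUP \<nu>\<in>?E. R \<nu>)"
    then obtain b where b: "(SUP \<nu>\<in>?E. R \<nu>) < ereal b" "ereal b < ?P" using ereal_dense2 by (metis not_le)
    have "ratio_bound b"
      unfolding ratio_bound_def
    proof
      fix \<nu> assume "\<nu> \<in> ?E"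
      then have "R \<nu> \<le> (SUP \<nu>\<in>?E. R \<nu>)" by (rule SUP_upper)
      then show "measure_entropy \<nu> shift / ereal (\<integral>x. \<psi> x \<partial>\<nu>) + ereal ((\<integral>x. \<phi> x \<partial>\<nu>) / (\<integral>x. \<psi> x \<partial>\<nu>)) \<le> ereal b"
        using b(1) by (simp add: R_def)
    qed
    from pressure_le_ratio_bound[OF this, of \<eta>] b(2) show False by simp
  qed
  moreover have "(SUP \<nu>\<in>?E. R \<nu>) \<le> (SUP \<nu>\<in>?M. R \<nu>)"
  proof (rule SUP_subset_mono)
    \<comment> \<open>On a compact support both continuous potentials are bounded, hence
      integrable.\<close>
    show "?E \<subseteq> ?M"
    proof
      fix \<nu> assume \<nu>: "\<nu> \<in> ?E"
      then interpret S: shift_measure I A \<nu> by unfold_locales (simp add: ergodic_compact_measures_def)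
      show "\<nu> \<in> ?M"
        using \<nu> S.integrable_compact_support hoelder_continuous_on[OF assms(3)] hoelder_continuous_on[OF assms(4)]
        by (simp add: ergodic_compact_measures_def)
    qed
  qed simp
  ultimately have "?P = (SUP \<nu>\<in>?M. R \<nu>) \<and> (SUP \<nu>\<in>?M. R \<nu>) = (SUP \<nu>\<in>?E. R \<nu>)"
    by (intro conjI order_antisym) (blast intro: order_trans)+
  then show ?thesis unfolding R_def .
qed

end
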